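(* For a first order sentence $\varphi$ in the language of graphs let $G_n\sim G(n\mid\varphi)$. (i) There is a first order sentence $\varphi$ such that $\mathrm{FOC}(G_n)$ is a dense subset of $[0,1]$ (identifying the class of a constant sequence $\lambda$ with the real number $\lambda$). (ii) For each integer $d\geq 1$ there is a first order sentence $\varphi$ such that $\mathrm{FOC}(G_n)$ spans a $d$-dimensional linear subspace of $\ell^{\infty}/c_0$. (iii) There is a first order sentence $\varphi$ such that $\mathrm{FOC}(G_n)$ is totally bounded but spans an infinite-dimensional linear subspace of $\ell^{\infty}/c_0$. (iv) There is a first order sentence $\varphi$ such that $\mathrm{FOC}(G_n)$ is not totally bounded.
   Context: For a first order sentence $\varphi$ over the signature $\{=,\sim\}$ ($\sim$ binary), $G(n\mid\varphi)$ is the random graph chosen uniformly at random from the set of all simple undirected graphs without loops on vertex set $[n]$ that satisfy $\varphi$. $\ell^\infty$ is the Banach space of bounded real sequences with the sup norm, $c_0$ the subspace of sequences converging to $0$, $\ell^\infty/c_0$ the quotient with norm $\|x+c_0\|=\limsup_n|x_n|$, and $\pi$ the canonical projection; the class of a sequence converging to $\lambda$ is identified with $\lambda\in\mathbb{R}$. For a sequence $(D_n)$ of random structures on $[n]$, $\mathrm{FOC}(D_n)=\{\pi((\Pr(D_n\models\psi))_{n\in\mathbb{N}}):\psi\text{ a first order sentence}\}$. *)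

theory Defs
  imports "HOL-Probability.Probability"
begin

section \<open>First order sentences about graphs\<close>

text \<open>Variables are natural numbers. The remaining connectives and the universal quantifier are
  definable from the ones given.\<close>

datatype fol =
    Eq nat nat
  | Adj nat nat
  | Neg fol
  | Conj fol fol
  | Exi nat fol

fun free_vars :: "fol \<Rightarrow> nat set" where
  "free_vars (Eq x y) = {x, y}"
| "free_vars (Adj x y) = {x, y}"
| "free_vars (Neg \<phi>) = free_vars \<phi>"
| "free_vars (Conj \<phi> \<psi>) = free_vars \<phi> \<union> free_vars \<psi>"
| "free_vars (Exi x \<phi>) = free_vars \<phi> - {x}"

definition sentence :: "fol \<Rightarrow> bool" where
  "sentence \<phi> \<longleftrightarrow> free_vars \<phi> = {}"

text \<open>A simple graph on \<open>[n] = {1..n}\<close> is given by its set of edges, which are 2-element subsets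
  of \<open>[n]\<close>.\<close>

type_synonym edges = "nat set set"

definition graphs_on :: "nat \<Rightarrow> edges set" where
  "graphs_on n = Pow {e. e \<subseteq> {1..n} \<and> card e = 2}"

fun sat :: "nat \<Rightarrow> edges \<Rightarrow> (nat \<Rightarrow> nat) \<Rightarrow> fol \<Rightarrow> bool" where
  "sat n E \<sigma> (Eq x y) \<longleftrightarrow> \<sigma> x = \<sigma> y"
| "sat n E \<sigma> (Adj x y) \<longleftrightarrow> {\<sigma> x, \<sigma> y} \<in> E"
| "sat n E \<sigma> (Neg \<phi>) \<longleftrightarrow> \<not> sat n E \<sigma> \<phi>"
| "sat n E \<sigma> (Conj \<phi> \<psi>) \<longleftrightarrow> sat n E \<sigma> \<phi> \<and> sat n E \<sigma> \<psi>"
| "sat n E \<sigma> (Exi x \<phi>) \<longleftrightarrow> (\<exists>v\<in>{1..n}. sat n E (\<sigma>(x := v)) \<phi>)"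

lemma sat_cong:
  assumes "\<And>x. x \<in> free_vars \<phi> \<Longrightarrow> \<sigma> x = \<tau> x"
  shows "sat n E \<sigma> \<phi> \<longleftrightarrow> sat n E \<tau> \<phi>"
  using assms
proof (induction \<phi> arbitrary: \<sigma> \<tau>)
  case (Exi x \<phi>)
  have "sat n E (\<sigma>(x := v)) \<phi> \<longleftrightarrow> sat n E (\<tau>(x := v)) \<phi>" for v
    by (rule Exi.IH) (use Exi.prems in auto)
  then show ?case by simp
next
  case (Conj \<phi> \<psi>)
  have "sat n E \<sigma> \<phi> \<longleftrightarrow> sat n E \<tau> \<phi>"
    by (rule Conj.IH(1)) (use Conj.prems in auto)
  moreover have "sat n E \<sigma> \<psi> \<longleftrightarrow> sat n E \<tau> \<psi>"
    by (rule Conj.IH(2)) (use Conj.prems in auto)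
  ultimately show ?case by simp
next
  case (Neg \<phi>)
  have "sat n E \<sigma> \<phi> \<longleftrightarrow> sat n E \<tau> \<phi>"
    by (rule Neg.IH) (use Neg.prems in auto)
  then show ?case by simp
qed simp_all

definition models :: "nat \<Rightarrow> edges \<Rightarrow> fol \<Rightarrow> bool" where
  "models n E \<phi> \<longleftrightarrow> (\<forall>\<sigma>. sat n E \<sigma> \<phi>)"

lemma models_sentence: "sentence \<phi> \<Longrightarrow> models n E \<phi> \<longleftrightarrow> sat n E \<sigma> \<phi>"
  unfolding models_def sentence_def using sat_cong[of \<phi>] by blast

section \<open>The random graph conditioned on a sentence\<close>

definition models_on :: "fol \<Rightarrow> nat \<Rightarrow> edges set" where
  "models_on \<phi> n = {E \<in> graphs_on n. models n E \<phi>}"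

lemma finite_models_on: "finite (models_on \<phi> n)"
  unfolding models_on_def graphs_on_def by simp

text \<open>The uniform distribution on the models of a sentence requires that there are such models.
  The value at \<open>n = 0\<close> is irrelevant for everything below.\<close>

definition conditionable :: "fol \<Rightarrow> bool" where
  "conditionable \<phi> \<longleftrightarrow> sentence \<phi> \<and> (\<forall>n\<ge>1. models_on \<phi> n \<noteq> {})"

definition random_graph :: "fol \<Rightarrow> nat \<Rightarrow> edges pmf" where
  "random_graph \<phi> n = pmf_of_set (models_on \<phi> n)"

section \<open>The quotient of the bounded sequences by the null sequences\<close>

text \<open>Since the topology of \<open>nat\<close> is discrete, the type of bounded continuous functions from
  \<open>nat\<close> to \<open>real\<close> with the supremum norm is the Banach space of all bounded real sequences.\<close>

type_synonym linf = "nat \<Rightarrow>\<^sub>C real"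

lemma bcontfun_nat: "(f :: nat \<Rightarrow> real) \<in> bcontfun \<longleftrightarrow> bounded (range f)"
  unfolding bcontfun_def by simp

definition c0 :: "linf set" where
  "c0 = {x. apply_bcontfun x \<longlonglongrightarrow> 0}"

definition c0_rel :: "linf \<Rightarrow> linf \<Rightarrow> bool" where
  "c0_rel x y \<longleftrightarrow> x - y \<in> c0"

lemma c0_rel_iff: "c0_rel (x :: linf) (y :: linf) \<longleftrightarrow> (\<lambda>n. x n - y n) \<longlonglongrightarrow> 0"
  by (simp add: c0_rel_def c0_def minus_bcontfun.rep_eq)

quotient_type linf_c0 = linf / c0_rel morphisms rep_linf_c0 proj
proof (rule equivpI)
  show "reflp c0_rel" by (rule reflpI) (simp add: c0_rel_iff)
  show "symp c0_rel"
  proof (rule sympI)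
    fix x y assume "c0_rel x y"
    from tendsto_minus[OF this[unfolded c0_rel_iff]] show "c0_rel y x"
      by (simp add: c0_rel_iff)
  qed
  show "transp c0_rel"
  proof (rule transpI)
    fix x y z assume "c0_rel x y" "c0_rel y z"
    from tendsto_add[OF this[unfolded c0_rel_iff]] show "c0_rel x z"
      by (simp add: c0_rel_iff)
  qed
qed

definition limsup_abs :: "linf \<Rightarrow> real" where
  "limsup_abs x = real_of_ereal (limsup (\<lambda>n. ereal \<bar>x n\<bar>))"

lemma
  fixes x :: linf
  shows limsup_abs_ereal: "limsup (\<lambda>n. ereal \<bar>x n\<bar>) = ereal (limsup_abs x)"
    and limsup_abs_nonneg: "0 \<le> limsup_abs x"
proof -
  obtain B where B: "\<And>n. \<bar>x n\<bar> \<le> B"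
    using bounded_apply_bcontfun[of x] unfolding bounded_iff by auto
  have up: "limsup (\<lambda>n. ereal \<bar>x n\<bar>) \<le> ereal B"
    by (rule Limsup_bounded) (simp add: B)
  have lo: "0 \<le> limsup (\<lambda>n. ereal \<bar>x n\<bar>)"
    by (rule le_Limsup) auto
  show "limsup (\<lambda>n. ereal \<bar>x n\<bar>) = ereal (limsup_abs x)"
    unfolding limsup_abs_def using up lo
    by (cases "limsup (\<lambda>n. ereal \<bar>x n\<bar>)") auto
  with lo show "0 \<le> limsup_abs x" by simp
qed

lemma limsup_abs_eq_0_iff: "limsup_abs (x :: linf) = 0 \<longleftrightarrow> apply_bcontfun x \<longlonglongrightarrow> 0"
proof
  assume "limsup_abs x = 0"
  then have s: "limsup (\<lambda>n. ereal \<bar>x n\<bar>) = 0" by (simp add: limsup_abs_ereal zero_ereal_def)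
  have "0 \<le> liminf (\<lambda>n. ereal \<bar>x n\<bar>)"
    by (rule Liminf_bounded) simp
  moreover have "liminf (\<lambda>n. ereal \<bar>x n\<bar>) \<le> 0"
    using Liminf_le_Limsup[of sequentially "\<lambda>n. ereal \<bar>x n\<bar>"] s by simp
  ultimately have "liminf (\<lambda>n. ereal \<bar>x n\<bar>) = 0" by simp
  with s have "(\<lambda>n. ereal \<bar>x n\<bar>) \<longlonglongrightarrow> ereal 0"
    by (intro Liminf_eq_Limsup) (simp_all add: zero_ereal_def)
  then have "(\<lambda>n. \<bar>x n\<bar>) \<longlonglongrightarrow> 0" by (simp only: lim_ereal)
  then show "apply_bcontfun x \<longlonglongrightarrow> 0" by (rule tendsto_rabs_zero_cancel)
next
  assume "apply_bcontfun x \<longlonglongrightarrow> 0"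
  then have "(\<lambda>n. ereal \<bar>x n\<bar>) \<longlonglongrightarrow> ereal 0"
    by (simp only: lim_ereal tendsto_rabs_zero)
  from lim_imp_Limsup[OF _ this] show "limsup_abs x = 0"
    by (simp add: limsup_abs_ereal)
qed

lemma limsup_abs_triangle: "limsup_abs (x + y) \<le> limsup_abs x + limsup_abs y"
proof -
  have "limsup (\<lambda>n. ereal \<bar>(x + y) n\<bar>) \<le> limsup (\<lambda>n. ereal \<bar>x n\<bar> + ereal \<bar>y n\<bar>)"
    by (rule Limsup_mono) (simp add: plus_bcontfun.rep_eq abs_triangle_ineq)
  also have "\<dots> \<le> limsup (\<lambda>n. ereal \<bar>x n\<bar>) + limsup (\<lambda>n. ereal \<bar>y n\<bar>)"
    by (rule ereal_limsup_add_mono)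
  finally show ?thesis by (simp only: limsup_abs_ereal plus_ereal.simps ereal_less_eq)
qed

lemma limsup_abs_scaleR: "limsup_abs (a *\<^sub>R x) = \<bar>a\<bar> * limsup_abs x"
proof -
  have "limsup (\<lambda>n. ereal \<bar>(a *\<^sub>R x) n\<bar>) = limsup (\<lambda>n. ereal \<bar>a\<bar> * ereal \<bar>x n\<bar>)"
    by (simp add: scaleR_bcontfun.rep_eq abs_mult)
  also have "\<dots> = ereal \<bar>a\<bar> * limsup (\<lambda>n. ereal \<bar>x n\<bar>)"
    by (rule limsup_ereal_mult_left) simp
  finally show ?thesis by (simp only: limsup_abs_ereal times_ereal.simps ereal.inject)
qed

lemma limsup_abs_cong:
  assumes "c0_rel x y"
  shows "limsup_abs x = limsup_abs y"
proof -
  have *: "limsup_abs u \<le> limsup_abs v" if "c0_rel u v" for u v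
  proof -
    have "limsup_abs (u - v) = 0"
      using that unfolding c0_rel_def c0_def by (simp add: limsup_abs_eq_0_iff)
    with limsup_abs_triangle[of "u - v" v] show ?thesis by simp
  qed
  from assms have "c0_rel y x"
    using equivp_symp[OF linf_c0_equivp] by blast
  with assms * show ?thesis by (meson antisym)
qed

instantiation linf_c0 :: real_vector
begin

lift_definition zero_linf_c0 :: linf_c0 is 0 .

lift_definition plus_linf_c0 :: "linf_c0 \<Rightarrow> linf_c0 \<Rightarrow> linf_c0" is "(+)"
proof -
  fix x x' y y' assume "c0_rel x x'" "c0_rel y y'"
  from tendsto_add[OF this[unfolded c0_rel_iff]] show "c0_rel (x + y) (x' + y')"
    by (simp add: c0_rel_iff plus_bcontfun.rep_eq algebra_simps)
qed

lift_definition uminus_linf_c0 :: "linf_c0 \<Rightarrow> linf_c0" is uminus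
proof -
  fix x x' assume "c0_rel x x'"
  from tendsto_minus[OF this[unfolded c0_rel_iff]] show "c0_rel (- x) (- x')"
    by (simp add: c0_rel_iff uminus_bcontfun.rep_eq)
qed

lift_definition minus_linf_c0 :: "linf_c0 \<Rightarrow> linf_c0 \<Rightarrow> linf_c0" is "(-)"
proof -
  fix x x' y y' assume "c0_rel x x'" "c0_rel y y'"
  from tendsto_diff[OF this[unfolded c0_rel_iff]] show "c0_rel (x - y) (x' - y')"
    by (simp add: c0_rel_iff minus_bcontfun.rep_eq algebra_simps)
qed

lift_definition scaleR_linf_c0 :: "real \<Rightarrow> linf_c0 \<Rightarrow> linf_c0" is scaleR
proof -
  fix a x x' assume "c0_rel x x'"
  from tendsto_mult_left[OF this[unfolded c0_rel_iff], of a] show "c0_rel (a *\<^sub>R x) (a *\<^sub>R x')"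
    by (simp add: c0_rel_iff scaleR_bcontfun.rep_eq algebra_simps)
qed

instance
proof
  fix x y z :: linf_c0 and a b :: real
  have refl: "c0_rel u v" if "u = v" for u v using that by (simp add: c0_rel_iff)
  show "x + y + z = x + (y + z)" by transfer (simp add: refl algebra_simps)
  show "x + y = y + x" by transfer (simp add: refl algebra_simps)
  show "0 + x = x" by transfer (simp add: refl)
  show "- x + x = 0" by transfer (simp add: refl)
  show "x - y = x + - y" by transfer (simp add: refl)
  show "a *\<^sub>R (x + y) = a *\<^sub>R x + a *\<^sub>R y" by transfer (simp add: refl algebra_simps)
  show "(a + b) *\<^sub>R x = a *\<^sub>R x + b *\<^sub>R x" by transfer (simp add: refl algebra_simps)
  show "a *\<^sub>R b *\<^sub>R x = (a * b) *\<^sub>R x" by transfer (simp add: refl)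
  show "1 *\<^sub>R x = x" by transfer (simp add: refl)
qed

end

instantiation linf_c0 :: real_normed_vector
begin

lift_definition norm_linf_c0 :: "linf_c0 \<Rightarrow> real" is limsup_abs
  by (rule limsup_abs_cong)

definition dist_linf_c0 :: "linf_c0 \<Rightarrow> linf_c0 \<Rightarrow> real" where
  "dist_linf_c0 x y = norm (x - y)"

definition sgn_linf_c0 :: "linf_c0 \<Rightarrow> linf_c0" where
  "sgn_linf_c0 x = x /\<^sub>R norm x"

definition uniformity_linf_c0 :: "(linf_c0 \<times> linf_c0) filter" where
  "uniformity_linf_c0 = (INF e\<in>{0 <..}. principal {(x, y). dist x y < e})"

definition open_linf_c0 :: "linf_c0 set \<Rightarrow> bool" where
  "open_linf_c0 S = (\<forall>x\<in>S. \<forall>\<^sub>F (x', y) in uniformity. x' = x \<longrightarrow> y \<in> S)"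

instance
proof
  fix x y :: linf_c0 and a :: real and S :: "linf_c0 set"
  show "dist x y = norm (x - y)" by (rule dist_linf_c0_def)
  show "sgn x = x /\<^sub>R norm x" by (rule sgn_linf_c0_def)
  show "uniformity = (INF e\<in>{0 <..}. principal {(x, y :: linf_c0). dist x y < e})"
    by (rule uniformity_linf_c0_def)
  show "open S = (\<forall>x\<in>S. \<forall>\<^sub>F (x', y) in uniformity. x' = x \<longrightarrow> y \<in> S)"
    by (rule open_linf_c0_def)
  show "norm x = 0 \<longleftrightarrow> x = 0"
    by transfer (simp add: limsup_abs_eq_0_iff c0_rel_def c0_def)
  show "norm (x + y) \<le> norm x + norm y"
    by transfer (rule limsup_abs_triangle)
  show "norm (a *\<^sub>R x) = \<bar>a\<bar> * norm x"
    by transfer (rule limsup_abs_scaleR)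
qed

end

lemma norm_proj: "norm (proj (x :: linf)) = real_of_ereal (limsup (\<lambda>n. ereal \<bar>x n\<bar>))"
  by (simp add: norm_linf_c0.abs_eq limsup_abs_def)

text \<open>The image of a sequence in the quotient, meaningful for bounded sequences only.\<close>

definition seq_class :: "(nat \<Rightarrow> real) \<Rightarrow> linf_c0" where
  "seq_class f = proj (Bcontfun f)"

text \<open>The embedding along which real numbers are identified with elements of the quotient.\<close>

definition const_class :: "real \<Rightarrow> linf_c0" where
  "const_class c = proj (const_bcontfun c)"

lemma seq_class_eq_iff:
  assumes "bounded (range f)" "bounded (range g)"
  shows "seq_class f = seq_class g \<longleftrightarrow> (\<lambda>n. f n - g n) \<longlonglongrightarrow> 0"
  using assms unfolding seq_class_def
  by (simp add: linf_c0.abs_eq_iff c0_rel_iff Bcontfun_inverse bcontfun_nat)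

lemma seq_class_eq_const_class_iff:
  assumes "bounded (range f)"
  shows "seq_class f = const_class c \<longleftrightarrow> f \<longlonglongrightarrow> c"
  using assms unfolding seq_class_def const_class_def
  by (simp add: linf_c0.abs_eq_iff c0_rel_iff Bcontfun_inverse bcontfun_nat
      const_bcontfun.rep_eq LIM_zero_iff)

lemma dist_const_class: "dist (const_class a) (const_class b) = \<bar>a - b\<bar>"
proof -
  have "const_class a - const_class b = proj (const_bcontfun a - const_bcontfun b)"
    unfolding const_class_def by (simp add: minus_linf_c0.abs_eq)
  then show ?thesis
    by (simp add: dist_norm norm_proj minus_bcontfun.rep_eq const_bcontfun.rep_eq Limsup_const)
qed

section \<open>Limiting probabilities of first order sentences\<close>

definition FOC :: "(nat \<Rightarrow> edges pmf) \<Rightarrow> linf_c0 set" where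
  "FOC D = {seq_class (\<lambda>n. measure_pmf.prob (D n) {E. models n E \<psi>}) | \<psi>. sentence \<psi>}"

lemma bounded_prob_seq: "bounded (range (\<lambda>n. measure_pmf.prob (D n) (A n)))"
  unfolding bounded_iff by (intro exI[of _ 1]) auto

end

theory Submission
  imports Defs
begin

text \<open>All sentences axiomatize graphs containing a half graph, which provides a definable linear order of
  rows; such a graph is rigid up to the symmetries of the vertices attached to the rows. An isomorphism
  type with \<open>\<alpha>\<close> automorphisms has \<open>n! / \<alpha>\<close> labelled copies and hence weight \<open>1 / \<alpha>\<close>, and by
  Ehrenfeucht-Fraisse games the truth of a sentence stabilizes when the number of rows of each kind grows.

  (i) Attach two leaves to each of the first \<open>k\<close> rows, one leaf to each of the next \<open>p\<close> rows and none to the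
  last \<open>q\<close> rows. There are \<open>2 ^ k\<close> automorphisms, while \<open>p\<close> and \<open>q\<close> both tend to infinity in probability
  (the rows with one leaf are there to absorb the parity of \<open>n\<close>), so \<open>k\<close> is geometrically distributed in the
  limit, and the limiting probabilities of finite sets of values of \<open>k\<close> are the dyadic rationals.

  (ii)-(iv) Attach one vertex of each of \<open>b\<close> cliques, the columns, to every row, and add \<open>r\<close> isolated
  vertices, so that \<open>n - 3 = r + a (b + 2)\<close> where \<open>a\<close> is the number of rows. If \<open>b\<close> is fixed and
  \<open>r < b + 2\<close>, there is one isomorphism type for each \<open>n\<close>, and sentences only see \<open>n - 3\<close> modulo \<open>b + 2\<close>
  (dimension 1 is obtained from the graphs without edges). If \<open>b\<close> is arbitrary and \<open>r \<le> 1\<close>, the weight of \<open>b\<close> is \<open>1 / b!\<close>, and \<open>b = 0\<close> is always possible, so large \<open>b\<close> are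
  uniformly negligible; but the sentences identifying \<open>b = q - 2\<close> and \<open>r = 0\<close> for the primes \<open>q\<close> are
  linearly independent, since for \<open>n = 3 + q ^ t\<close> only the one belonging to \<open>q\<close> has positive probability.
  If \<open>r = 0\<close> is required, then for these \<open>n\<close> the value
  \<open>b = q - 2\<close> has probability at least 1/2, whereas it is impossible for \<open>n = 3 + p ^ t\<close> with a prime
  \<open>p \<noteq> q\<close>.\<close>

section \<open>Satisfaction in arbitrary structures\<close>

text \<open>A symmetric edge relation carries no order of its own. The half graph supplies one, and
  its nested neighbourhoods are expressible by finitely many axioms. The remaining axioms fix the
  graph up to the number of rows of each kind, which first order logic can count only up to a
  threshold: row 0 and the rows where the width changes act as constants of the game, and rank q
  sees their distances only up to \<open>2 ^ q\<close>.

  In (i), for every fixed k the number of admissible p is asymptotically a third of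
  \<open>half_size n\<close>, a quantity independent of k. Hence the weights alone decide, and k has
  limit probability \<open>(1 / 2) ^ Suc k\<close>.

  In (iii), at most one isolated vertex is allowed so that these vertices contribute no
  automorphisms, while two admissible remainders make b = 0 possible for either parity of n - 3. The
  total weight is then at least 1 for all n. Requiring r = 0 destroys this uniform bound: b + 2 must
  divide n - 3, and for \<open>n - 3 = q ^ t\<close> the smallest divisor above 1 is q. All other
  admissible b are at least q and together weigh no more than b = q - 2, which gives the 1/2 in
  (iv).\<close>

fun gsat :: "'a set \<Rightarrow> ('a \<Rightarrow> 'a \<Rightarrow> bool) \<Rightarrow> (nat \<Rightarrow> 'a) \<Rightarrow> fol \<Rightarrow> bool" where
  "gsat D A \<sigma> (Eq x y) \<longleftrightarrow> \<sigma> x = \<sigma> y"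
| "gsat D A \<sigma> (Adj x y) \<longleftrightarrow> A (\<sigma> x) (\<sigma> y)"
| "gsat D A \<sigma> (Neg \<phi>) \<longleftrightarrow> \<not> gsat D A \<sigma> \<phi>"
| "gsat D A \<sigma> (Conj \<phi> \<psi>) \<longleftrightarrow> gsat D A \<sigma> \<phi> \<and> gsat D A \<sigma> \<psi>"
| "gsat D A \<sigma> (Exi x \<phi>) \<longleftrightarrow> (\<exists>v\<in>D. gsat D A (\<sigma>(x := v)) \<phi>)"

text \<open>The polymorphic \<open>gsat\<close> is there because the model graphs live on pairs of
  naturals, whereas the random graphs live on \<open>{1..n}\<close>.\<close>

lemma sat_eq_gsat: "sat n E \<sigma> \<phi> \<longleftrightarrow> gsat {1..n} (\<lambda>x y. {x, y} \<in> E) \<sigma> \<phi>"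
  by (induction \<phi> arbitrary: \<sigma>) auto

lemma gsat_cong:
  assumes "\<And>x. x \<in> free_vars \<phi> \<Longrightarrow> \<sigma> x = \<tau> x"
  shows "gsat D A \<sigma> \<phi> \<longleftrightarrow> gsat D A \<tau> \<phi>"
  using assms
proof (induction \<phi> arbitrary: \<sigma> \<tau>)
  case (Exi x \<phi>)
  have "gsat D A (\<sigma>(x := v)) \<phi> \<longleftrightarrow> gsat D A (\<tau>(x := v)) \<phi>" for v
    by (rule Exi.IH) (use Exi.prems in auto)
  then show ?case by simp
next
  case (Conj \<phi> \<psi>)
  have "gsat D A \<sigma> \<phi> \<longleftrightarrow> gsat D A \<tau> \<phi>"
    by (rule Conj.IH(1)) (use Conj.prems in auto)
  moreover have "gsat D A \<sigma> \<psi> \<longleftrightarrow> gsat D A \<tau> \<psi>"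
    by (rule Conj.IH(2)) (use Conj.prems in auto)
  ultimately show ?case by simp
next
  case (Neg \<phi>)
  have "gsat D A \<sigma> \<phi> \<longleftrightarrow> gsat D A \<tau> \<phi>"
    by (rule Neg.IH) (use Neg.prems in auto)
  then show ?case by simp
qed simp_all

lemma gsat_sentence: "sentence \<phi> \<Longrightarrow> gsat D A \<sigma> \<phi> \<longleftrightarrow> gsat D A \<tau> \<phi>"
  unfolding sentence_def by (rule gsat_cong) auto

definition valid_in :: "'a set \<Rightarrow> ('a \<Rightarrow> 'a \<Rightarrow> bool) \<Rightarrow> fol \<Rightarrow> bool" where
  "valid_in D A \<phi> \<longleftrightarrow> (\<forall>\<sigma>. gsat D A \<sigma> \<phi>)"

lemma valid_in_sentence: "sentence \<phi> \<Longrightarrow> valid_in D A \<phi> \<longleftrightarrow> gsat D A \<sigma> \<phi>"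
  unfolding valid_in_def using gsat_sentence by blast

lemma models_iff_valid_in: "models n E \<phi> \<longleftrightarrow> valid_in {1..n} (\<lambda>x y. {x, y} \<in> E) \<phi>"
  by (simp add: models_def valid_in_def sat_eq_gsat)

definition isom :: "('a \<Rightarrow> 'b) \<Rightarrow> 'a set \<Rightarrow> ('a \<Rightarrow> 'a \<Rightarrow> bool) \<Rightarrow> 'b set \<Rightarrow> ('b \<Rightarrow> 'b \<Rightarrow> bool) \<Rightarrow> bool" where
  "isom g D A D' A' \<longleftrightarrow> bij_betw g D D' \<and> (\<forall>x\<in>D. \<forall>y\<in>D. A x y \<longleftrightarrow> A' (g x) (g y))"

text \<open>The assignment must send the free variables into D, since g is injective and preserves
  adjacency only there.\<close>

lemma isom_gsat:
  assumes g: "isom g D A D' A'" and "\<And>x. x \<in> free_vars \<phi> \<Longrightarrow> \<sigma> x \<in> D"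
  shows "gsat D A \<sigma> \<phi> \<longleftrightarrow> gsat D' A' (g \<circ> \<sigma>) \<phi>"
  using assms(2)
proof (induction \<phi> arbitrary: \<sigma>)
  case (Eq x y)
  then show ?case using g by (auto simp: isom_def bij_betw_def inj_on_eq_iff)
next
  case (Adj x y)
  then show ?case using g by (auto simp: isom_def)
next
  case (Exi x \<phi>)
  have *: "gsat D A (\<sigma>(x := v)) \<phi> \<longleftrightarrow> gsat D' A' ((g \<circ> \<sigma>)(x := g v)) \<phi>" if "v \<in> D" for v
  proof -
    have "gsat D A (\<sigma>(x := v)) \<phi> \<longleftrightarrow> gsat D' A' (g \<circ> (\<sigma>(x := v))) \<phi>"
      by (rule Exi.IH) (use Exi.prems that in auto)
    also have "g \<circ> (\<sigma>(x := v)) = (g \<circ> \<sigma>)(x := g v)" by auto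
    finally show ?thesis .
  qed
  moreover have "g ` D = D'" using g by (simp add: isom_def bij_betw_def)
  ultimately show ?case by (auto simp: comp_def)
next
  case (Neg \<phi>) then show ?case by simp
next
  case (Conj \<phi> \<psi>) then show ?case by simp
qed

lemma isom_valid_in:
  assumes "isom g D A D' A'" "sentence \<phi>"
  shows "valid_in D A \<phi> \<longleftrightarrow> valid_in D' A' \<phi>"
  using isom_gsat[OF assms(1), of \<phi> undefined] assms(2)
  by (metis valid_in_sentence empty_iff sentence_def)

lemma isom_inv:
  assumes "isom g D A D' A'"
  shows "isom (inv_into D g) D' A' D A"
proof -
  have g: "bij_betw g D D'" using assms by (simp add: isom_def)
  have "A' x y \<longleftrightarrow> A (inv_into D g x) (inv_into D g y)" if "x \<in> D'" "y \<in> D'" for x y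
  proof -
    have "g (inv_into D g x) = x" "g (inv_into D g y) = y" "inv_into D g x \<in> D" "inv_into D g y \<in> D"
      using that g by (auto simp: bij_betw_inv_into_right bij_betw_def inv_into_into)
    then show ?thesis using assms unfolding isom_def by metis
  qed
  then show ?thesis using bij_betw_inv_into[OF g] by (simp add: isom_def)
qed

lemma isom_trans:
  assumes "isom g D A D' A'" "isom h D' A' D'' A''"
  shows "isom (h \<circ> g) D A D'' A''"
  using assms unfolding isom_def by (auto simp: bij_betw_trans bij_betw_apply)

section \<open>Derived connectives and counting quantifiers\<close>

definition Or :: "fol \<Rightarrow> fol \<Rightarrow> fol" where "Or \<phi> \<psi> = Neg (Conj (Neg \<phi>) (Neg \<psi>))"
definition Imp :: "fol \<Rightarrow> fol \<Rightarrow> fol" where "Imp \<phi> \<psi> = Neg (Conj \<phi> (Neg \<psi>))"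
definition Iff :: "fol \<Rightarrow> fol \<Rightarrow> fol" where "Iff \<phi> \<psi> = Conj (Imp \<phi> \<psi>) (Imp \<psi> \<phi>)"
definition Forall :: "nat \<Rightarrow> fol \<Rightarrow> fol" where "Forall x \<phi> = Neg (Exi x (Neg \<phi>))"
definition Tru :: fol where "Tru = Forall 0 (Eq 0 0)"

lemma gsat_derived [simp]:
  "gsat D A \<sigma> (Or \<phi> \<psi>) \<longleftrightarrow> gsat D A \<sigma> \<phi> \<or> gsat D A \<sigma> \<psi>"
  "gsat D A \<sigma> (Imp \<phi> \<psi>) \<longleftrightarrow> (gsat D A \<sigma> \<phi> \<longrightarrow> gsat D A \<sigma> \<psi>)"
  "gsat D A \<sigma> (Iff \<phi> \<psi>) \<longleftrightarrow> (gsat D A \<sigma> \<phi> \<longleftrightarrow> gsat D A \<sigma> \<psi>)"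
  "gsat D A \<sigma> (Forall x \<phi>) \<longleftrightarrow> (\<forall>v\<in>D. gsat D A (\<sigma>(x := v)) \<phi>)"
  "gsat D A \<sigma> Tru"
  by (auto simp: Or_def Imp_def Iff_def Forall_def Tru_def)

lemma free_vars_derived [simp]:
  "free_vars (Or \<phi> \<psi>) = free_vars \<phi> \<union> free_vars \<psi>"
  "free_vars (Imp \<phi> \<psi>) = free_vars \<phi> \<union> free_vars \<psi>"
  "free_vars (Iff \<phi> \<psi>) = free_vars \<phi> \<union> free_vars \<psi>"
  "free_vars (Forall x \<phi>) = free_vars \<phi> - {x}"
  "free_vars Tru = {}"
  by (auto simp: Or_def Imp_def Iff_def Forall_def Tru_def)

lemma sentence_derived [simp]:
  "sentence (Or \<phi> \<psi>) \<longleftrightarrow> sentence \<phi> \<and> sentence \<psi>"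
  "sentence (Conj \<phi> \<psi>) \<longleftrightarrow> sentence \<phi> \<and> sentence \<psi>"
  "sentence (Neg \<phi>) \<longleftrightarrow> sentence \<phi>"
  "sentence Tru"
  by (auto simp: sentence_def)

lemma valid_in_derived:
  assumes "sentence \<phi>" "sentence \<psi>"
  shows "valid_in D A (Or \<phi> \<psi>) \<longleftrightarrow> valid_in D A \<phi> \<or> valid_in D A \<psi>"
    and "valid_in D A (Conj \<phi> \<psi>) \<longleftrightarrow> valid_in D A \<phi> \<and> valid_in D A \<psi>"
    and "valid_in D A (Neg \<phi>) \<longleftrightarrow> \<not> valid_in D A \<phi>"
  using assms by (simp_all add: valid_in_sentence[where \<sigma> = undefined])

text \<open>The counting quantifier binds the variables from 10 on, so that the formulas counted may use the
  variables below 10 as parameters.\<close>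

fun at_least :: "(nat \<Rightarrow> fol) \<Rightarrow> nat \<Rightarrow> nat \<Rightarrow> fol" where
  "at_least P 0 k = Tru"
| "at_least P (Suc m) k =
     Exi k (Conj (P k) (Conj (foldr (\<lambda>i. Conj (Neg (Eq i k))) [10..<k] Tru) (at_least P m (Suc k))))"

definition exactly :: "(nat \<Rightarrow> fol) \<Rightarrow> nat \<Rightarrow> fol" where
  "exactly P m = Conj (at_least P m 10) (Neg (at_least P (Suc m) 10))"

lemma gsat_foldr_neq:
  "gsat D A \<tau> (foldr (\<lambda>i. Conj (Neg (Eq i k))) is Tru) \<longleftrightarrow> \<tau> k \<notin> \<tau> ` set is"
  by (induction "is") auto

lemma free_vars_foldr_neq:
  "free_vars (foldr (\<lambda>i. Conj (Neg (Eq i k))) is Tru) \<subseteq> insert k (set is)"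
  by (induction "is") auto

text \<open>The recursion on sets that matches the recursion of \<open>at_least\<close>: remove a
  first witness, then count the rest.\<close>

lemma card_ge_Suc_iff:
  assumes "finite S"
  shows "Suc m \<le> card S \<longleftrightarrow> (\<exists>v\<in>S. m \<le> card (S - {v}))"
proof
  assume "Suc m \<le> card S"
  then obtain v where "v \<in> S" by fastforce
  then show "\<exists>v\<in>S. m \<le> card (S - {v})" using \<open>Suc m \<le> card S\<close> by force
next
  assume "\<exists>v\<in>S. m \<le> card (S - {v})"
  then show "Suc m \<le> card S" using assms by (metis card.remove Suc_le_mono)
qed

text \<open>The variables in \<open>{10..<k}\<close> hold the witnesses already chosen, hence the
  set subtracted. The meaning of P may depend on parameters below 10, so it is only assumed for
  assignments that agree with \<open>\<sigma>\<close> there.\<close>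

lemma gsat_at_least_aux:
  assumes "finite D"
    and "\<And>\<tau> k. k \<ge> 10 \<Longrightarrow> (\<And>i. i < 10 \<Longrightarrow> \<tau> i = \<sigma> i) \<Longrightarrow> gsat D A \<tau> (P k) \<longleftrightarrow> Q (\<tau> k)"
    and "k \<ge> 10" "\<And>i. i < 10 \<Longrightarrow> \<tau> i = \<sigma> i"
  shows "gsat D A \<tau> (at_least P m k) \<longleftrightarrow> m \<le> card ({v \<in> D. Q v} - \<tau> ` {10..<k})"
  using assms(3,4)
proof (induction m arbitrary: k \<tau>)
  case (Suc m)
  let ?S = "{v \<in> D. Q v} - \<tau> ` {10..<k}"
  have *: "gsat D A (\<tau>(k := v)) (at_least P m (Suc k)) \<longleftrightarrow> m \<le> card (?S - {v})" for v
  proof -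
    have eq: "{v' \<in> D. Q v'} - (\<tau>(k := v)) ` {10..<Suc k} = ?S - {v}"
    proof -
      have "(\<tau>(k := v)) ` {10..<Suc k} = insert v (\<tau> ` {10..<k})"
        using Suc.prems by (auto simp: atLeastLessThanSuc)
      then show ?thesis by auto
    qed
    have "gsat D A (\<tau>(k := v)) (at_least P m (Suc k)) \<longleftrightarrow>
        m \<le> card ({v' \<in> D. Q v'} - (\<tau>(k := v)) ` {10..<Suc k})"
      by (rule Suc.IH) (use Suc.prems in auto)
    then show ?thesis by (simp only: eq)
  qed
  have P: "gsat D A (\<tau>(k := v)) (P k) \<longleftrightarrow> Q v" for v
    using assms(2)[of k "\<tau>(k := v)"] Suc.prems by auto
  have neq: "gsat D A (\<tau>(k := v)) (foldr (\<lambda>i. Conj (Neg (Eq i k))) [10..<k] Tru) \<longleftrightarrow> v \<notin> \<tau> ` {10..<k}" for v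
    unfolding gsat_foldr_neq by auto
  have "gsat D A \<tau> (at_least P (Suc m) k) \<longleftrightarrow> (\<exists>v\<in>?S. m \<le> card (?S - {v}))"
    by (auto simp: * P neq)
  also have "\<dots> \<longleftrightarrow> Suc m \<le> card ?S"
    by (rule card_ge_Suc_iff[symmetric]) (use assms(1) in auto)
  finally show ?case .
qed simp

lemma gsat_at_least:
  assumes "finite D"
    and "\<And>\<tau> k. k \<ge> 10 \<Longrightarrow> (\<And>i. i < 10 \<Longrightarrow> \<tau> i = \<sigma> i) \<Longrightarrow> gsat D A \<tau> (P k) \<longleftrightarrow> Q (\<tau> k)"
  shows "gsat D A \<sigma> (at_least P m 10) \<longleftrightarrow> m \<le> card {v \<in> D. Q v}"
  using gsat_at_least_aux[of D \<sigma> A P Q 10 \<sigma> m] assms by auto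

lemma gsat_exactly:
  assumes "finite D"
    and "\<And>\<tau> k. k \<ge> 10 \<Longrightarrow> (\<And>i. i < 10 \<Longrightarrow> \<tau> i = \<sigma> i) \<Longrightarrow> gsat D A \<tau> (P k) \<longleftrightarrow> Q (\<tau> k)"
  shows "gsat D A \<sigma> (exactly P m) \<longleftrightarrow> card {v \<in> D. Q v} = m"
proof -
  have *: "gsat D A \<sigma> (at_least P m 10) \<longleftrightarrow> m \<le> card {v \<in> D. Q v}" for m
    by (rule gsat_at_least[OF assms])
  show ?thesis unfolding exactly_def gsat.simps * by arith
qed

lemma free_vars_at_least:
  assumes "\<And>k. k \<ge> 10 \<Longrightarrow> free_vars (P k) \<subseteq> insert k F" "k \<ge> 10"
  shows "free_vars (at_least P m k) \<subseteq> F \<union> {10..<k}"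
  using assms(2)
proof (induction m arbitrary: k)
  case (Suc m)
  have "free_vars (at_least P m (Suc k)) \<subseteq> F \<union> {10..<Suc k}"
    by (rule Suc.IH) (use Suc.prems in auto)
  then show ?case
    using assms(1)[OF Suc.prems] free_vars_foldr_neq[of k "[10..<k]"] by auto
qed simp

lemma free_vars_exactly:
  assumes "\<And>k. k \<ge> 10 \<Longrightarrow> free_vars (P k) \<subseteq> insert k F"
  shows "free_vars (exactly P m) \<subseteq> F"
proof -
  have "free_vars (at_least P m 10) \<subseteq> F \<union> {10..<10}" for m
    by (rule free_vars_at_least) (use assms in auto)
  then show ?thesis unfolding exactly_def by (simp del: at_least.simps)
qed

section \<open>The Ehrenfeucht-Fraisse game on graphs arranged in rows\<close>

fun qrank :: "fol \<Rightarrow> nat" where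
  "qrank (Eq x y) = 0"
| "qrank (Adj x y) = 0"
| "qrank (Neg \<phi>) = qrank \<phi>"
| "qrank (Conj \<phi> \<psi>) = max (qrank \<phi>) (qrank \<psi>)"
| "qrank (Exi x \<phi>) = Suc (qrank \<phi>)"

text \<open>Truncation to [-Q, Q], the usual measure of what remains visible of a distance in a
  linear order when few rounds are left: small distances exactly, large ones only by their
  direction.\<close>

definition clip :: "int \<Rightarrow> int \<Rightarrow> int" where
  "clip Q d = max (- Q) (min Q d)"

lemma clip_eq_iff:
  "Q > 0 \<Longrightarrow> clip Q x = clip Q y \<longleftrightarrow> x = y \<or> (x \<ge> Q \<and> y \<ge> Q) \<or> (x \<le> - Q \<and> y \<le> - Q)"
  by (auto simp: clip_def max_def min_def)

text \<open>The invariant of the game: with \<open>q\<close> rounds to go, the rows of corresponding pebbles, and of the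
  finitely many rows at which the width changes, have the same differences up to clipping at \<open>2 ^ q\<close>.\<close>

definition gaps_agree :: "int \<Rightarrow> (int \<times> int) set \<Rightarrow> bool" where
  "gaps_agree Q S \<longleftrightarrow> (\<forall>p p' r r'. (p, p') \<in> S \<longrightarrow> (r, r') \<in> S \<longrightarrow> clip Q (p - r) = clip Q (p' - r'))"

lemma gaps_agreeD:
  "gaps_agree Q S \<Longrightarrow> (p, p') \<in> S \<Longrightarrow> (r, r') \<in> S \<Longrightarrow> clip Q (p - r) = clip Q (p' - r')"
  unfolding gaps_agree_def by metis

text \<open>Clipping at a smaller bound is a function of clipping at a larger one.\<close>

lemma gaps_agree_mono:
  assumes "gaps_agree Q S" "Q' \<le> Q" "0 < Q'" "S' \<subseteq> S"
  shows "gaps_agree Q' S'"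
proof -
  have "clip Q' x = clip Q' y" if "clip Q x = clip Q y" for x y
    using that assms(2,3) by (auto simp: clip_eq_iff)
  then show ?thesis using assms(1,4) unfolding gaps_agree_def by blast
qed

lemma gaps_agree_converse: "gaps_agree Q (S\<inverse>) \<longleftrightarrow> gaps_agree Q S"
  unfolding gaps_agree_def converse_iff by metis

lemma gaps_agree_sgn:
  assumes "gaps_agree Q S" "Q > 0" "(p, p') \<in> S" "(r, r') \<in> S"
  shows "sgn (p - r) = sgn (p' - r')"
  using gaps_agreeD[OF assms(1,3,4)] assms(2) by (auto simp: clip_eq_iff)

lemma gaps_agree_insert:
  assumes "gaps_agree Q S" "0 < Q" "\<And>p p'. (p, p') \<in> S \<Longrightarrow> clip Q (i - p) = clip Q (i' - p')"
  shows "gaps_agree Q (insert (i, i') S)"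
proof -
  have odd: "clip Q (a - b) = clip Q (a' - b')" if "clip Q (b - a) = clip Q (b' - a')" for a b a' b'
    using that assms(2) by (auto simp: clip_eq_iff)
  show ?thesis unfolding gaps_agree_def
    using assms(3) gaps_agreeD[OF assms(1)] by (auto intro: odd)
qed

text \<open>One round of the game on a linear order, at the price of halving the bound. A move close
  to a pebble is answered at the same distance from its partner. Any other move lies in a gap of
  length at least 2Q; the corresponding gap is as long, and there is room in it for an answer far
  from both ends.\<close>

lemma gaps_agree_extend:
  assumes ag: "gaps_agree (2 * Q) S" and Q: "Q > 0" and fin: "finite S"
    and lo: "\<exists>(p, p')\<in>S. p \<le> i" and hi: "\<exists>(p, p')\<in>S. i \<le> p"
  shows "\<exists>i'. gaps_agree Q (insert (i, i') S)"
proof -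
  have agQ: "gaps_agree Q S" by (rule gaps_agree_mono[OF ag]) (use Q in auto)
  show ?thesis
  proof (cases "\<exists>(p, p')\<in>S. \<bar>i - p\<bar> < Q")
    case True
    then obtain p p' where p: "(p, p') \<in> S" "\<bar>i - p\<bar> < Q" by auto
    \<comment> \<open>The differences from p agree up to 2Q; a common shift by less than Q preserves
      equality, and differences of size at least 2Q stay at least Q in size.\<close>
    have "clip Q (i - r) = clip Q (p' + (i - p) - r')" if r: "(r, r') \<in> S" for r r'
      using gaps_agreeD[OF ag p(1) r] p(2) Q by (auto simp: clip_eq_iff abs_if split: if_splits)
    then show ?thesis using gaps_agree_insert[OF agQ Q] by blast
  next
    case far: False
    define L where "L = {p \<in> fst ` S. p \<le> i}"
    define H where "H = {p \<in> fst ` S. i \<le> p}"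
    have L: "finite L" "L \<noteq> {}" and H: "finite H" "H \<noteq> {}"
      using fin lo hi by (force simp: L_def H_def)+
    have "Max L \<in> L" "Min H \<in> H" using L H by (simp_all add: Max_in Min_in)
    then obtain p p' r r' where p: "(p, p') \<in> S" "p = Max L" "p \<le> i"
      and r: "(r, r') \<in> S" "r = Min H" "i \<le> r"
      by (auto simp: L_def H_def)
    have "i - p \<ge> Q" "r - i \<ge> Q" using far p r by fastforce+
    then have "r - p \<ge> 2 * Q" by linarith
    then have d': "r' - p' \<ge> 2 * Q"
      using gaps_agreeD[OF ag r(1) p(1)] Q by (auto simp: clip_eq_iff)
    \<comment> \<open>The answer is the point Q above the lower end of the gap; since the gap has
      length at least 2Q, its upper end is at distance at least Q as well.\<close>
    have "clip Q (i - s) = clip Q (p' + Q - s')" if s: "(s, s') \<in> S" for s s'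
    proof (cases "s \<le> i")
      case True
      have "s \<le> p" using s True L p by (auto simp: L_def intro!: Max_ge image_eqI)
      then have "s' \<le> p'" using gaps_agreeD[OF ag s p(1)] Q by (auto simp: clip_eq_iff)
      moreover have "i - s \<ge> Q" using far s True by fastforce
      ultimately show ?thesis using Q by (auto simp: clip_eq_iff)
    next
      case False
      have "s \<ge> r" using s False H r by (auto simp: H_def intro!: Min_le image_eqI)
      then have "s' \<ge> r'" using gaps_agreeD[OF ag s r(1)] Q by (auto simp: clip_eq_iff)
      moreover have "s - i \<ge> Q" using far s False by fastforce
      ultimately show ?thesis using Q d' by (auto simp: clip_eq_iff)
    qed
    then show ?thesis using gaps_agree_insert[OF agQ Q] by blast
  qed
qed

section \<open>Graphs arranged in rows and the game on them\<close>

text \<open>Only the vertex set, in spite of the name. The adjacency is supplied separately, so that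
  one relation serves for all widths.\<close>

definition row_graph :: "(nat \<Rightarrow> nat) \<Rightarrow> (nat \<times> nat) set" where
  "row_graph w = {(i, j). j < w i}"

text \<open>Adjacency may use the offsets freely, but of the rows only what the game preserves:
  their order and which of them are row 0.\<close>

definition row_invariant :: "(nat \<times> nat \<Rightarrow> nat \<times> nat \<Rightarrow> bool) \<Rightarrow> bool" where
  "row_invariant R \<longleftrightarrow> (\<forall>i k i' k' j l. sgn (int i - int k) = sgn (int i' - int k') \<longrightarrow>
     (i = 0 \<longleftrightarrow> i' = 0) \<longrightarrow> (k = 0 \<longleftrightarrow> k' = 0) \<longrightarrow> (R (i, j) (k, l) \<longleftrightarrow> R (i', j) (k', l)))"

text \<open>C pairs the rows at which the widths change on the two sides. The position relative to
  these rows has to determine the width.\<close>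

definition widths_agree :: "(int \<times> int) set \<Rightarrow> (nat \<Rightarrow> nat) \<Rightarrow> (nat \<Rightarrow> nat) \<Rightarrow> bool" where
  "widths_agree C w w' \<longleftrightarrow> 
     (\<forall>i i'. (\<forall>c c'. (c, c') \<in> C \<longrightarrow> sgn (int i - c) = sgn (int i' - c')) \<longrightarrow> w i = w' i')"

lemma widths_agree_converse: "widths_agree C w w' \<Longrightarrow> widths_agree (C\<inverse>) w' w"
  unfolding widths_agree_def converse_iff by metis

text \<open>The answer is found among the integers. Comparison with the pair (0, 0) makes it
  nonnegative, and comparison with C gives it the same width, so that the offset of the move can be
  copied.\<close>

lemma row_extend:
  assumes "gaps_agree (2 * Q) S" "Q > 0" "finite S" "C \<subseteq> S" "(0, 0) \<in> C"
    and "widths_agree C w w'" "\<exists>(c, c')\<in>C. int i \<le> c"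
  shows "\<exists>i'. gaps_agree Q (insert (int i, int i') S) \<and> w i = w' i'"
proof -
  obtain z where z: "gaps_agree Q (insert (int i, z) S)"
    using gaps_agree_extend[OF assms(1,2,3), of "int i"] assms(4,5,7) by fastforce
  have sg: "sgn (int i - c) = sgn (z - c')" if "(c, c') \<in> C" for c c'
    by (rule gaps_agree_sgn[OF z assms(2)]) (use that assms(4) in auto)
  from sg[OF assms(5)] have "z \<ge> 0" by (auto simp: sgn_if split: if_splits)
  then have zz: "int (nat z) = z" by simp
  have "w i = w' (nat z)"
    using assms(6) sg zz unfolding widths_agree_def by metis
  with z zz show ?thesis by metis
qed

definition pebbles :: "nat set \<Rightarrow> (nat \<Rightarrow> nat \<times> nat) \<Rightarrow> (nat \<Rightarrow> nat \<times> nat) \<Rightarrow> (int \<times> int) set" where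
  "pebbles X \<sigma> \<sigma>' = (\<lambda>x. (int (fst (\<sigma> x)), int (fst (\<sigma>' x)))) ` X"

text \<open>Only an inclusion, because the pebble previously carried by x is overwritten.\<close>

lemma pebbles_upd:
  "pebbles (insert x X) (\<sigma>(x := (i, j))) (\<sigma>'(x := (i', j'))) \<subseteq> insert (int i, int i') (pebbles X \<sigma> \<sigma>')"
  by (auto simp: pebbles_def)

text \<open>The second player always answers with the same offset, so only the rows need a strategy.
  X contains the variables that carry pebbles; C stays in the invariant as a set of pebbles that
  never move.\<close>

lemma row_game:
  assumes R: "row_invariant R" and C0: "(0, 0) \<in> C" and finC: "finite C"
    and w: "widths_agree C w w'"
    and up: "\<And>i. w i > 0 \<Longrightarrow> \<exists>(c, c')\<in>C. int i \<le> c"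
    and up': "\<And>i. w' i > 0 \<Longrightarrow> \<exists>(c, c')\<in>C. int i \<le> c'"
    and "finite X" "free_vars \<psi> \<subseteq> X"
    and "\<And>x. x \<in> X \<Longrightarrow> snd (\<sigma> x) = snd (\<sigma>' x)"
    and "gaps_agree (2 ^ qrank \<psi>) (C \<union> pebbles X \<sigma> \<sigma>')"
  shows "gsat (row_graph w) R \<sigma> \<psi> \<longleftrightarrow> gsat (row_graph w') R \<sigma>' \<psi>"
  using assms(7-10)
proof (induction \<psi> arbitrary: X \<sigma> \<sigma>')
  case (Eq x y)
  have "(int (fst (\<sigma> z)), int (fst (\<sigma>' z))) \<in> C \<union> pebbles X \<sigma> \<sigma>'" if "z \<in> {x, y}" for z
    using that Eq.prems by (auto simp: pebbles_def)
  then have "sgn (int (fst (\<sigma> x)) - int (fst (\<sigma> y))) = sgn (int (fst (\<sigma>' x)) - int (fst (\<sigma>' y)))"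
    by (intro gaps_agree_sgn[OF Eq.prems(4)]) auto
  then have "fst (\<sigma> x) = fst (\<sigma> y) \<longleftrightarrow> fst (\<sigma>' x) = fst (\<sigma>' y)"
    by (auto simp: sgn_if split: if_splits)
  then show ?case using Eq.prems(2,3) by (auto simp: prod_eq_iff)
next
  case (Adj x y)
  have mem: "(int (fst (\<sigma> z)), int (fst (\<sigma>' z))) \<in> C \<union> pebbles X \<sigma> \<sigma>'" if "z \<in> {x, y}" for z
    using that Adj.prems by (auto simp: pebbles_def)
  have 1: "sgn (int (fst (\<sigma> x)) - int (fst (\<sigma> y))) = sgn (int (fst (\<sigma>' x)) - int (fst (\<sigma>' y)))"
    by (intro gaps_agree_sgn[OF Adj.prems(4)] mem) auto
  have 2: "fst (\<sigma> z) = 0 \<longleftrightarrow> fst (\<sigma>' z) = 0" if "z \<in> {x, y}" for z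
  proof -
    have "sgn (int (fst (\<sigma> z)) - 0) = sgn (int (fst (\<sigma>' z)) - 0)"
      by (intro gaps_agree_sgn[OF Adj.prems(4)] mem) (use that C0 in auto)
    then show ?thesis by (auto simp: sgn_if split: if_splits)
  qed
  have "R (fst (\<sigma> x), snd (\<sigma> x)) (fst (\<sigma> y), snd (\<sigma> y)) \<longleftrightarrow>
      R (fst (\<sigma>' x), snd (\<sigma> x)) (fst (\<sigma>' y), snd (\<sigma> y))"
    using R 1 2 unfolding row_invariant_def by blast
  then show ?case using Adj.prems(2,3) by auto
next
  case (Neg \<psi>)
  then show ?case using Neg.IH[of X \<sigma> \<sigma>'] by simp
next
  case (Conj \<psi> \<theta>)
  have "gaps_agree (2 ^ qrank \<psi>) (C \<union> pebbles X \<sigma> \<sigma>')" "gaps_agree (2 ^ qrank \<theta>) (C \<union> pebbles X \<sigma> \<sigma>')"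
    by (rule gaps_agree_mono[OF Conj.prems(4)]; simp)+
  then show ?case using Conj.IH[of X \<sigma> \<sigma>'] Conj.prems by simp
next
  case (Exi x \<psi>)
  let ?S = "C \<union> pebbles X \<sigma> \<sigma>'" and ?Q = "2 ^ qrank \<psi> :: int"
  have ag: "gaps_agree (2 * ?Q) ?S" using Exi.prems(4) by simp
  have finS: "finite ?S" using finC Exi.prems(1) by (simp add: pebbles_def)
  have IH: "gsat (row_graph w) R (\<sigma>(x := (i, j))) \<psi> \<longleftrightarrow> gsat (row_graph w') R (\<sigma>'(x := (i', j))) \<psi>"
    if "gaps_agree ?Q (insert (int i, int i') ?S)" for i i' j
  proof (rule Exi.IH[of "insert x X"])
    show "gaps_agree ?Q (C \<union> pebbles (insert x X) (\<sigma>(x := (i, j))) (\<sigma>'(x := (i', j))))"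
      by (rule gaps_agree_mono[OF that]) (use pebbles_upd[of x X \<sigma> i j \<sigma>' i' j] in auto)
  qed (use Exi.prems in auto)
  show ?case
  proof
    assume "gsat (row_graph w) R \<sigma> (Exi x \<psi>)"
    then obtain i j where ij: "j < w i" "gsat (row_graph w) R (\<sigma>(x := (i, j))) \<psi>"
      by (auto simp: row_graph_def)
    then obtain i' where i': "gaps_agree ?Q (insert (int i, int i') ?S)" "w i = w' i'"
      using row_extend[OF ag _ finS _ C0 w up[of i]] by auto
    then show "gsat (row_graph w') R \<sigma>' (Exi x \<psi>)"
      using IH[OF i'(1), of j] ij by (auto simp: row_graph_def)
  next
    assume "gsat (row_graph w') R \<sigma>' (Exi x \<psi>)"
    then obtain i j where ij: "j < w' i" "gsat (row_graph w') R (\<sigma>'(x := (i, j))) \<psi>"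
      by (auto simp: row_graph_def)
    \<comment> \<open>A move in the second graph is handled by exchanging the two sides, that is, by
      passing to the converse relations.\<close>
    have ag': "gaps_agree (2 * ?Q) (?S\<inverse>)" using ag by (simp only: gaps_agree_converse)
    have "\<exists>(c, c')\<in>C\<inverse>. int i \<le> c" using up'[of i] ij by fastforce
    then obtain i' where i': "gaps_agree ?Q (insert (int i, int i') (?S\<inverse>))" "w' i = w i'"
      using row_extend[OF ag' _ _ _ _ widths_agree_converse[OF w]] finS C0 by auto
    have "insert (int i, int i') (?S\<inverse>) = (insert (int i', int i) ?S)\<inverse>" by auto
    then have "gaps_agree ?Q (insert (int i', int i) ?S)" using i'(1) by (metis gaps_agree_converse)
    from IH[OF this, of j] ij i'(2) show "gsat (row_graph w) R \<sigma> (Exi x \<psi>)"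
      by (auto simp: row_graph_def)
  qed
qed

text \<open>At the start no pebbles are placed, and the invariant only concerns C.\<close>

lemma row_game_sentence:
  assumes "row_invariant R" "(0, 0) \<in> C" "finite C" "widths_agree C w w'"
    and "\<And>i. w i > 0 \<Longrightarrow> \<exists>(c, c')\<in>C. int i \<le> c"
    and "\<And>i. w' i > 0 \<Longrightarrow> \<exists>(c, c')\<in>C. int i \<le> c'"
    and "sentence \<psi>" "gaps_agree (2 ^ qrank \<psi>) C"
  shows "valid_in (row_graph w) R \<psi> \<longleftrightarrow> valid_in (row_graph w') R \<psi>"
proof -
  have "gsat (row_graph w) R undefined \<psi> \<longleftrightarrow> gsat (row_graph w') R undefined \<psi>"
    by (rule row_game[OF assms(1-6), of "{}"]) (use assms(7,8) in \<open>auto simp: sentence_def pebbles_def\<close>)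
  then show ?thesis using assms(7) by (simp add: valid_in_sentence[where \<sigma> = undefined])
qed

section \<open>Counting labelled copies\<close>

definition copies :: "nat \<Rightarrow> 'a set \<Rightarrow> ('a \<Rightarrow> 'a \<Rightarrow> bool) \<Rightarrow> edges set" where
  "copies n D A = {E \<in> graphs_on n. \<exists>g. isom g {1..n} (\<lambda>x y. {x, y} \<in> E) D A}"

text \<open>With \<open>permutes\<close> a map is the identity outside D, which makes each
  automorphism of the graph count exactly once.\<close>

definition automorphisms :: "'a set \<Rightarrow> ('a \<Rightarrow> 'a \<Rightarrow> bool) \<Rightarrow> ('a \<Rightarrow> 'a) set" where
  "automorphisms D A = {h. h permutes D \<and> isom h D A D A}"

definition simple_rel :: "('a \<Rightarrow> 'a \<Rightarrow> bool) \<Rightarrow> bool" where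
  "simple_rel A \<longleftrightarrow> (\<forall>x y. A x y \<longrightarrow> A y x) \<and> (\<forall>x. \<not> A x x)"

definition pullback :: "nat \<Rightarrow> (nat \<Rightarrow> 'a) \<Rightarrow> ('a \<Rightarrow> 'a \<Rightarrow> bool) \<Rightarrow> edges" where
  "pullback n g A = {{x, y} | x y. x \<in> {1..n} \<and> y \<in> {1..n} \<and> A (g x) (g y)}"

lemma pullback_iff:
  assumes "simple_rel A" "x \<in> {1..n}" "y \<in> {1..n}"
  shows "{x, y} \<in> pullback n g A \<longleftrightarrow> A (g x) (g y)"
  using assms unfolding pullback_def simple_rel_def by (auto simp: doubleton_eq_iff)

lemma pullback_graph:
  assumes "simple_rel A"
  shows "pullback n g A \<in> graphs_on n"
proof -
  have "card {x, y} = 2" if "A (g x) (g y)" for x y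
    using that assms unfolding simple_rel_def by (cases "x = y") auto
  then show ?thesis unfolding pullback_def graphs_on_def by auto
qed

lemma graph_eqI:
  assumes "E \<in> graphs_on n" "E' \<in> graphs_on n"
    and "\<And>x y. x \<in> {1..n} \<Longrightarrow> y \<in> {1..n} \<Longrightarrow> {x, y} \<in> E \<longleftrightarrow> {x, y} \<in> E'"
  shows "E = E'"
proof -
  have "e \<in> E1 \<Longrightarrow> e \<in> E2"
    if "E1 \<in> graphs_on n" "\<And>x y. x \<in> {1..n} \<Longrightarrow> y \<in> {1..n} \<Longrightarrow> {x, y} \<in> E1 \<Longrightarrow> {x, y} \<in> E2" for E1 E2 e
  proof -
    assume e: "e \<in> E1"
    with that(1) have "e \<subseteq> {1..n}" "card e = 2" by (auto simp: graphs_on_def)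
    then obtain x y where "e = {x, y}" by (auto simp: card_2_iff)
    with e that(2)[of x y] \<open>e \<subseteq> {1..n}\<close> show "e \<in> E2" by auto
  qed
  from this[of E E'] this[of E' E] assms show ?thesis by blast
qed

lemma isom_pullback:
  assumes "simple_rel A" "bij_betw g {1..n} D"
  shows "isom g {1..n} (\<lambda>x y. {x, y} \<in> pullback n g A) D A"
  using assms pullback_iff[OF assms(1)] by (auto simp: isom_def)

text \<open>Orbit-stabilizer: the n! permutations of D, composed with one fixed enumeration, produce
  all labelled copies, and those producing a given copy form a coset of the automorphism
  group.\<close>

lemma card_copies:
  assumes A: "simple_rel A" and D: "finite D" "card D = n"
  shows "card (copies n D A) * card (automorphisms D A) = fact n"
proof -
  obtain g where g: "bij_betw g {1..n} D"
    using ex_bij_betw_nat_finite_1[OF D(1)] D(2) by auto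
  define P where "P = {h. h permutes D}"
  define F where "F h = pullback n (h \<circ> g) A" for h
  have finP: "finite P" and cardP: "card P = fact n"
    using D by (auto simp: P_def card_permutations finite_permutations)
  have F_iff: "{x, y} \<in> F h \<longleftrightarrow> A (h (g x)) (h (g y))" if "x \<in> {1..n}" "y \<in> {1..n}" for x y h
    using pullback_iff[OF A that] by (simp add: F_def)
  have F_eq: "F h = F h' \<longleftrightarrow> (\<forall>a\<in>D. \<forall>b\<in>D. A (h a) (h b) \<longleftrightarrow> A (h' a) (h' b))" for h h'
  proof
    assume "F h = F h'"
    then have "\<forall>x\<in>{1..n}. \<forall>y\<in>{1..n}. A (h (g x)) (h (g y)) \<longleftrightarrow> A (h' (g x)) (h' (g y))"
      using F_iff by metis
    moreover have "g ` {1..n} = D" using g by (simp add: bij_betw_def)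
    ultimately show "\<forall>a\<in>D. \<forall>b\<in>D. A (h a) (h b) \<longleftrightarrow> A (h' a) (h' b)" by blast
  next
    assume *: "\<forall>a\<in>D. \<forall>b\<in>D. A (h a) (h b) \<longleftrightarrow> A (h' a) (h' b)"
    show "F h = F h'"
    proof (rule graph_eqI)
      show "{x, y} \<in> F h \<longleftrightarrow> {x, y} \<in> F h'" if "x \<in> {1..n}" "y \<in> {1..n}" for x y
        using that * g F_iff[OF that] by (meson bij_betw_apply)
    qed (auto simp: F_def pullback_graph[OF A])
  qed
  have image: "F ` P = copies n D A"
  proof
    show "F ` P \<subseteq> copies n D A"
    proof
      fix E assume "E \<in> F ` P"
      then obtain h where h: "h permutes D" "E = F h" by (auto simp: P_def)
      then have "bij_betw (h \<circ> g) {1..n} D"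
        using g bij_betw_trans permutes_imp_bij by blast
      from isom_pullback[OF A this] show "E \<in> copies n D A"
        using h pullback_graph[OF A] by (auto simp: copies_def F_def)
    qed
    show "copies n D A \<subseteq> F ` P"
    proof
      fix E assume E: "E \<in> copies n D A"
      then obtain g' where g': "isom g' {1..n} (\<lambda>x y. {x, y} \<in> E) D A" "E \<in> graphs_on n"
        by (auto simp: copies_def)
      \<comment> \<open>The permutation that turns the fixed enumeration g into g', extended by the
        identity.\<close>
      define h where "h = (\<lambda>a. if a \<in> D then g' (inv_into {1..n} g a) else a)"
      have "bij_betw (g' \<circ> inv_into {1..n} g) D D"
        using g'(1) bij_betw_inv_into[OF g] by (auto simp: isom_def intro: bij_betw_trans)
      then have "bij_betw h D D"
        by (rule bij_betw_cong[THEN iffD1, rotated]) (simp add: h_def)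
      then have h: "h permutes D" by (rule bij_imp_permutes) (simp add: h_def)
      have hg: "h (g x) = g' x" if "x \<in> {1..n}" for x
        using that g by (simp add: h_def bij_betw_apply bij_betw_inv_into_left)
      have "E = F h"
      proof (rule graph_eqI)
        show "{x, y} \<in> E \<longleftrightarrow> {x, y} \<in> F h" if "x \<in> {1..n}" "y \<in> {1..n}" for x y
          using F_iff[OF that] hg that g'(1) unfolding isom_def by simp
      qed (use g' in \<open>auto simp: F_def pullback_graph[OF A]\<close>)
      with h show "E \<in> F ` P" by (auto simp: P_def)
    qed
  qed
  have fiber: "card {h \<in> P. F h = E} = card (automorphisms D A)" if "E \<in> F ` P" for E
  proof -
    from that obtain h0 where h0: "h0 permutes D" "E = F h0" by (auto simp: P_def)
    \<comment> \<open>Right multiplication by h0 identifies the stabilizer with the fibre of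
      h0.\<close>
    have "bij_betw (\<lambda>u. u \<circ> h0) (automorphisms D A) {h \<in> P. F h = E}"
    proof (rule bij_betw_byWitness[where f' = "\<lambda>h. h \<circ> inv h0"])
      show "\<forall>u\<in>automorphisms D A. (u \<circ> h0) \<circ> inv h0 = u"
        by (simp add: comp_assoc permutes_inv_o(1)[OF h0(1)])
      show "\<forall>h\<in>{h \<in> P. F h = E}. (h \<circ> inv h0) \<circ> h0 = h"
        by (simp add: comp_assoc permutes_inv_o(2)[OF h0(1)])
      show "(\<lambda>u. u \<circ> h0) ` automorphisms D A \<subseteq> {h \<in> P. F h = E}"
      proof (clarsimp simp: h0(2) automorphisms_def P_def, intro conjI)
        fix u assume u: "u permutes D" "isom u D A D A"
        show "u \<circ> h0 permutes D" using u h0 by (intro permutes_compose)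
        have "h0 a \<in> D" if "a \<in> D" for a using that permutes_in_image[OF h0(1)] by simp
        then show "F (u \<circ> h0) = F h0" unfolding F_eq
          using u(2) by (simp add: isom_def)
      qed
      show "(\<lambda>h. h \<circ> inv h0) ` {h \<in> P. F h = E} \<subseteq> automorphisms D A"
      proof (clarsimp simp: h0(2) automorphisms_def P_def, intro conjI)
        fix h assume h: "h permutes D" "F h = F h0"
        show 1: "h \<circ> inv h0 permutes D"
          using h h0 by (intro permutes_compose permutes_inv)
        have "A a b \<longleftrightarrow> A (h (inv h0 a)) (h (inv h0 b))" if "a \<in> D" "b \<in> D" for a b
        proof -
          have "inv h0 a \<in> D" "inv h0 b \<in> D"
            using that permutes_in_image[OF permutes_inv[OF h0(1)]] by auto
          then show ?thesis using h(2) permutes_inverses(1)[OF h0(1)] unfolding F_eq by metis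
        qed
        then show "isom (h \<circ> inv h0) D A D A"
          using 1 by (auto simp: isom_def permutes_imp_bij)
      qed
    qed
    then show ?thesis by (simp add: bij_betw_same_card)
  qed
  have "card P = (\<Sum>h\<in>P. 1)" by simp
  also have "\<dots> = (\<Sum>E\<in>F ` P. \<Sum>h\<in>{h \<in> P. F h = E}. 1)"
    by (rule sum.image_gen[OF finP])
  also have "\<dots> = (\<Sum>E\<in>F ` P. card (automorphisms D A))"
    using fiber by (intro sum.cong) auto
  also have "\<dots> = card (copies n D A) * card (automorphisms D A)"
    by (simp add: image)
  finally show ?thesis using cardP by simp
qed

lemma copies_nonempty:
  assumes "simple_rel A" "finite D" "card D = n"
  shows "copies n D A \<noteq> {}"
  using card_copies[OF assms] fact_nonzero[of n, where ?'a = nat] by auto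

lemma valid_in_copies:
  assumes "E \<in> copies n D A" "sentence \<psi>"
  shows "models n E \<psi> \<longleftrightarrow> valid_in D A \<psi>"
proof -
  obtain g where "isom g {1..n} (\<lambda>x y. {x, y} \<in> E) D A" using assms(1) by (auto simp: copies_def)
  from isom_valid_in[OF this assms(2)] show ?thesis by (simp only: models_iff_valid_in)
qed

text \<open>Used in contrapositive form: types that are not isomorphic have disjoint sets of
  copies.\<close>

lemma copies_disjoint:
  assumes "E \<in> copies n D A" "E \<in> copies n D' A'"
  shows "\<exists>g. isom g D A D' A'"
  using assms isom_trans isom_inv unfolding copies_def by blast

text \<open>Each type t contributes \<open>fact n / \<alpha> t\<close> labelled graphs, all of which
  agree on \<open>\<psi>\<close>; the factor \<open>fact n\<close> cancels in the quotient.\<close>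

lemma prob_random_graph:
  assumes A: "simple_rel A" and T: "finite T" "T \<noteq> {}"
    and D: "\<And>t. t \<in> T \<Longrightarrow> finite (D t)" "\<And>t. t \<in> T \<Longrightarrow> card (D t) = n"
    and disj: "\<And>t t' g. t \<in> T \<Longrightarrow> t' \<in> T \<Longrightarrow> isom g (D t) A (D t') A \<Longrightarrow> t = t'"
    and mod: "models_on \<phi> n = (\<Union>t\<in>T. copies n (D t) A)"
    and aut: "\<And>t. t \<in> T \<Longrightarrow> real (card (automorphisms (D t) A)) = \<alpha> t"
    and \<psi>: "sentence \<psi>"
  shows "measure_pmf.prob (random_graph \<phi> n) {E. models n E \<psi>} =
    (\<Sum>t\<in>T. if valid_in (D t) A \<psi> then 1 / \<alpha> t else 0) / (\<Sum>t\<in>T. 1 / \<alpha> t)"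
proof -
  have card_t: "real (card (copies n (D t) A)) = fact n / \<alpha> t" if "t \<in> T" for t
  proof -
    have "real (card (copies n (D t) A)) * \<alpha> t = fact n"
      using card_copies[OF A D[OF that]] aut[OF that] by (metis of_nat_fact of_nat_mult)
    moreover from this have "\<alpha> t \<noteq> 0" by auto
    ultimately show ?thesis by (simp add: field_simps)
  qed
  have fin: "finite (copies n (D t) A)" for t
    by (rule finite_subset[of _ "graphs_on n"]) (auto simp: copies_def graphs_on_def)
  have dis: "copies n (D t) A \<inter> copies n (D t') A = {}" if "t \<in> T" "t' \<in> T" "t \<noteq> t'" for t t'
    using copies_disjoint disj that by blast
  have card_sub: "real (card (\<Union>t\<in>T'. copies n (D t) A)) = fact n * (\<Sum>t\<in>T'. 1 / \<alpha> t)" if "T' \<subseteq> T" for T'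
  proof -
    have "card (\<Union>t\<in>T'. copies n (D t) A) = (\<Sum>t\<in>T'. card (copies n (D t) A))"
    proof (rule card_UN_disjoint)
      show "finite T'" using that T(1) by (rule finite_subset)
      show "\<forall>i\<in>T'. \<forall>j\<in>T'. i \<noteq> j \<longrightarrow> copies n (D i) A \<inter> copies n (D j) A = {}"
        using that by (intro ballI impI dis) auto
    qed (simp add: fin)
    then show ?thesis using that card_t by (auto simp: sum_distrib_left subset_eq)
  qed
  let ?T' = "{t \<in> T. valid_in (D t) A \<psi>}"
  have ne: "models_on \<phi> n \<noteq> {}"
    using T copies_nonempty[OF A D] by (auto simp: mod)
  have "models_on \<phi> n \<inter> {E. models n E \<psi>} = (\<Union>t\<in>?T'. copies n (D t) A)"
    unfolding mod using valid_in_copies[OF _ \<psi>] by blast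
  then have "measure_pmf.prob (random_graph \<phi> n) {E. models n E \<psi>} =
      real (card (\<Union>t\<in>?T'. copies n (D t) A)) / real (card (models_on \<phi> n))"
    unfolding random_graph_def by (subst measure_pmf_of_set[OF ne finite_models_on]) (simp add: Int_commute)
  also have "\<dots> = (fact n * (\<Sum>t\<in>?T'. 1 / \<alpha> t)) / (fact n * (\<Sum>t\<in>T. 1 / \<alpha> t))"
    by (subst card_sub) (auto simp: mod card_sub)
  also have "(\<Sum>t\<in>?T'. 1 / \<alpha> t) = (\<Sum>t\<in>T. if valid_in (D t) A \<psi> then 1 / \<alpha> t else 0)"
    using T(1) by (simp add: sum.inter_filter)
  finally show ?thesis by simp
qed

section \<open>Spines\<close>

text \<open>A vertex \<open>(i, j)\<close> has row \<open>i\<close> and offset \<open>j\<close>. Row 0 carries the path \<open>(0, 0), (0, 1), (0, 2)\<close>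
  and isolated vertices. In the rows \<open>i \<ge> 1\<close> the vertices \<open>u\<^sub>i = (i, 0)\<close> and \<open>v\<^sub>i = (i, 1)\<close> form a half
  graph, which makes the order of the rows definable; \<open>(0, 2)\<close> is joined to all \<open>v\<^sub>i\<close>, which tells the
  two sides apart. The cells \<open>(i, j)\<close> with \<open>j \<ge> 2\<close> are joined to \<open>u\<^sub>i\<close>, and if the flag \<open>f\<close> is set, the
  cells with the same offset form a clique.\<close>

definition half_adj :: "bool \<Rightarrow> nat \<times> nat \<Rightarrow> nat \<times> nat \<Rightarrow> bool" where
  "half_adj f = (\<lambda>(i, j) (k, l).
     (i = 0 \<and> k = 0 \<and> j < 2 \<and> l = Suc j) \<or>
     (i = 0 \<and> j = 2 \<and> 0 < k \<and> l = 1) \<or>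
     (0 < i \<and> i \<le> k \<and> j = 0 \<and> l = 1) \<or>
     (0 < i \<and> i = k \<and> j = 0 \<and> 2 \<le> l) \<or>
     (f \<and> 0 < i \<and> i < k \<and> j = l \<and> 2 \<le> j))"

definition spine_adj :: "bool \<Rightarrow> nat \<times> nat \<Rightarrow> nat \<times> nat \<Rightarrow> bool" where
  "spine_adj f p q \<longleftrightarrow> half_adj f p q \<or> half_adj f q p"

text \<open>The last conjunct excludes the degenerate cases in which \<open>(0, 0)\<close> is not the only vertex of degree
  1 whose neighbour has degree 2.\<close>

definition spine_widths :: "bool \<Rightarrow> nat \<Rightarrow> (nat \<Rightarrow> nat) \<Rightarrow> bool" where
  "spine_widths f a w \<longleftrightarrow> 1 \<le> a \<and> 3 \<le> w 0 \<and> (\<forall>i\<in>{1..a}. 2 \<le> w i) \<and> (\<forall>i>a. w i = 0) \<and>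
     (if f then (\<forall>i\<in>{1..a}. w i = w 1) \<and> (2 \<le> a \<or> 4 \<le> w 1) else 2 \<le> a \<and> w a = 2)"

lemmas adj_defs = spine_adj_def half_adj_def

lemma simple_rel_spine_adj: "simple_rel (spine_adj f)"
  by (auto simp: simple_rel_def adj_defs)

text \<open>The clauses of \<open>half_adj\<close> mention rows only through comparisons with each
  other and with 0.\<close>

lemma row_invariant_spine_adj: "row_invariant (spine_adj f)"
proof -
  have half: "half_adj f (i, j) (k, l) \<longleftrightarrow> half_adj f (i', j) (k', l)"
    if "sgn (int i - int k) = sgn (int i' - int k')" "i = 0 \<longleftrightarrow> i' = 0" "k = 0 \<longleftrightarrow> k' = 0" for i k i' k' j l
  proof -
    have "i < k \<longleftrightarrow> i' < k'" "i = k \<longleftrightarrow> i' = k'" "i \<le> k \<longleftrightarrow> i' \<le> k'"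
      using that(1) by (auto simp: sgn_if split: if_splits)
    then show ?thesis using that(2,3) by (auto simp: half_adj_def)
  qed
  have "spine_adj f (i, j) (k, l) \<longleftrightarrow> spine_adj f (i', j) (k', l)"
    if "sgn (int i - int k) = sgn (int i' - int k')" "i = 0 \<longleftrightarrow> i' = 0" "k = 0 \<longleftrightarrow> k' = 0" for i k i' k' j l
  proof -
    have "sgn (int k - int i) = sgn (int k' - int i')"
      using that(1) by (auto simp: sgn_if split: if_splits)
    from half[OF this that(3,2), of l j] half[OF that, of j l] show ?thesis
      by (simp add: spine_adj_def)
  qed
  then show ?thesis unfolding row_invariant_def by blast
qed

section \<open>Vertex classes definable from the path in row 0\<close>

text \<open>A leaf x whose neighbour y has degree 2, with z as the other neighbour of y. In a spine
  the only such triple is the path in row 0, so it can replace constants of the language.\<close>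

definition markers :: "'a set \<Rightarrow> ('a \<Rightarrow> 'a \<Rightarrow> bool) \<Rightarrow> 'a \<Rightarrow> 'a \<Rightarrow> 'a \<Rightarrow> bool" where
  "markers D A x y z \<longleftrightarrow> x \<in> D \<and> y \<in> D \<and> z \<in> D \<and> x \<noteq> z \<and>
     (\<forall>w\<in>D. A x w \<longleftrightarrow> w = y) \<and> (\<forall>w\<in>D. A y w \<longleftrightarrow> w = x \<or> w = z)"

definition side_v :: "('a \<Rightarrow> 'a \<Rightarrow> bool) \<Rightarrow> 'a \<Rightarrow> 'a \<Rightarrow> 'a \<Rightarrow> bool" where
  "side_v A y z w \<longleftrightarrow> A w z \<and> w \<noteq> y"

text \<open>z itself is joined to the v side and has to be excluded; the condition on adjacency to z
  separates the two sides in an arbitrary graph.\<close>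

definition side_u :: "'a set \<Rightarrow> ('a \<Rightarrow> 'a \<Rightarrow> bool) \<Rightarrow> 'a \<Rightarrow> 'a \<Rightarrow> 'a \<Rightarrow> bool" where
  "side_u D A y z w \<longleftrightarrow> \<not> A w z \<and> w \<noteq> z \<and> (\<exists>v\<in>D. side_v A y z v \<and> A w v)"

text \<open>Whatever is left: in a simple graph with markers, the three markers, the two sides, the
  cells and the isolated vertices partition the vertex set. This lets the axioms account for every
  vertex.\<close>

definition cell :: "'a set \<Rightarrow> ('a \<Rightarrow> 'a \<Rightarrow> bool) \<Rightarrow> 'a \<Rightarrow> 'a \<Rightarrow> 'a \<Rightarrow> 'a \<Rightarrow> bool" where
  "cell D A x y z w \<longleftrightarrow> \<not> A w z \<and> w \<noteq> z \<and> w \<noteq> x \<and> \<not> (\<exists>v\<in>D. side_v A y z v \<and> A w v) \<and>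
     (\<exists>v\<in>D. A w v)"

definition isolated :: "'a set \<Rightarrow> ('a \<Rightarrow> 'a \<Rightarrow> bool) \<Rightarrow> 'a \<Rightarrow> bool" where
  "isolated D A w \<longleftrightarrow> \<not> (\<exists>v\<in>D. A w v)"

lemma isom_bex:
  assumes "isom h D A D' A'" "\<And>v. v \<in> D \<Longrightarrow> P v \<longleftrightarrow> P' (h v)"
  shows "(\<exists>v\<in>D. P v) \<longleftrightarrow> (\<exists>v\<in>D'. P' v)"
  using assms unfolding isom_def bij_betw_def by blast

lemma isom_card:
  assumes "isom h D A D' A'" "\<And>v. v \<in> D \<Longrightarrow> P v \<longleftrightarrow> P' (h v)"
  shows "card {v \<in> D. P v} = card {v \<in> D'. P' v}"
proof -
  have "h ` {v \<in> D. P v} = {v \<in> D'. P' v}"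
    using assms unfolding isom_def bij_betw_def by blast
  moreover have "inj_on h {v \<in> D. P v}"
    using assms(1) unfolding isom_def bij_betw_def by (blast intro: inj_on_subset)
  ultimately show ?thesis by (metis card_image)
qed

context
  fixes h D A D' A'
  assumes h: "isom h D A D' A'"
begin

lemma isom_mem: "v \<in> D \<Longrightarrow> h v \<in> D'"
  using h by (auto simp: isom_def bij_betw_def)

lemma isom_adj: "v \<in> D \<Longrightarrow> w \<in> D \<Longrightarrow> A v w \<longleftrightarrow> A' (h v) (h w)"
  using h by (auto simp: isom_def)

lemma isom_eq: "v \<in> D \<Longrightarrow> w \<in> D \<Longrightarrow> v = w \<longleftrightarrow> h v = h w"
  using h by (auto simp: isom_def bij_betw_def inj_on_def)

lemma isom_markers: "markers D A x y z \<Longrightarrow> markers D' A' (h x) (h y) (h z)"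
  using h isom_mem isom_eq isom_adj unfolding markers_def isom_def bij_betw_def by auto

lemma isom_side_v: "y \<in> D \<Longrightarrow> z \<in> D \<Longrightarrow> w \<in> D \<Longrightarrow> side_v A y z w \<longleftrightarrow> side_v A' (h y) (h z) (h w)"
  unfolding side_v_def using isom_eq isom_adj by simp

lemma isom_side_u: "y \<in> D \<Longrightarrow> z \<in> D \<Longrightarrow> w \<in> D \<Longrightarrow> side_u D A y z w \<longleftrightarrow> side_u D' A' (h y) (h z) (h w)"
  unfolding side_u_def
  using isom_eq isom_adj isom_side_v
    isom_bex[OF h, of "\<lambda>v. side_v A y z v \<and> A w v" "\<lambda>v. side_v A' (h y) (h z) v \<and> A' (h w) v"]
  by simp

lemma isom_cell:
  "x \<in> D \<Longrightarrow> y \<in> D \<Longrightarrow> z \<in> D \<Longrightarrow> w \<in> D \<Longrightarrow> cell D A x y z w \<longleftrightarrow> cell D' A' (h x) (h y) (h z) (h w)"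
  unfolding cell_def
  using isom_eq isom_adj isom_side_v
    isom_bex[OF h, of "\<lambda>v. side_v A y z v \<and> A w v" "\<lambda>v. side_v A' (h y) (h z) v \<and> A' (h w) v"]
    isom_bex[OF h, of "\<lambda>v. A w v" "\<lambda>v. A' (h w) v"]
  by simp

lemma isom_isolated: "w \<in> D \<Longrightarrow> isolated D A w \<longleftrightarrow> isolated D' A' (h w)"
  unfolding isolated_def
  using isom_adj isom_bex[OF h, of "\<lambda>v. A w v" "\<lambda>v. A' (h w) v"] by simp

end

lemma spine_adj_z: "spine_adj f (i, j) (0, 2) \<longleftrightarrow> j = Suc 0"
  by (auto simp: adj_defs)

lemma spine_side_v_iff: "side_v (spine_adj f) (0, Suc 0) (0, 2) (i, j) \<longleftrightarrow> 1 \<le> i \<and> j = 1"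
  by (auto simp: side_v_def adj_defs)

section \<open>The definable classes computed in a spine\<close>

locale spine =
  fixes f :: bool and a :: nat and w :: "nat \<Rightarrow> nat"
  assumes w: "spine_widths f a w"
begin

abbreviation "V \<equiv> row_graph w"
abbreviation "R \<equiv> spine_adj f"
abbreviation "SU \<equiv> side_u V R (0, Suc 0) (0, 2)"
abbreviation "SV \<equiv> side_v R (0, Suc 0) (0, 2)"
abbreviation "SC \<equiv> cell V R (0, 0) (0, Suc 0) (0, 2)"

lemma mem_iff: "(i, j) \<in> V \<longleftrightarrow> j < w i" by (simp add: row_graph_def)

lemma a1: "1 \<le> a" and w0: "3 \<le> w 0" and w2: "1 \<le> i \<Longrightarrow> i \<le> a \<Longrightarrow> 2 \<le> w i"
  using w unfolding spine_widths_def by auto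

lemma wpos: "j < w i \<Longrightarrow> i \<le> a"
  using w by (metis spine_widths_def not_le not_less_zero)

lemma const: "f \<Longrightarrow> i \<in> {1..a} \<Longrightarrow> w i = w 1"
  and last: "\<not> f \<Longrightarrow> w a = 2"
  and short: "\<not> 2 \<le> a \<Longrightarrow> 4 \<le> w 1"
  using w unfolding spine_widths_def by presburger+

lemma mem_special: "(0, 0) \<in> V" "(0, Suc 0) \<in> V" "(0, 2) \<in> V" "1 \<le> i \<Longrightarrow> i \<le> a \<Longrightarrow> (i, 0) \<in> V"
  "1 \<le> i \<Longrightarrow> i \<le> a \<Longrightarrow> (i, Suc 0) \<in> V"
  using w0 w2[of i] by (auto simp: mem_iff)

lemma V_eq: "V = (SIGMA i:{..a}. {..<w i})"
  using wpos by (auto simp: row_graph_def)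

lemma finite_V: "finite V" unfolding V_eq by blast

lemma markers_V: "markers V R (0, 0) (0, Suc 0) (0, 2)"
  unfolding markers_def using mem_special
  by (auto simp: adj_defs)

text \<open>Together with the next lemma this refutes false candidates for markers, by exhibiting a
  second neighbour of x or a third neighbour of y.\<close>

lemma two_neighbours:
  assumes "markers V R x y z" "p \<in> V" "q \<in> V" "R x p" "R x q" shows "p = q"
  using assms unfolding markers_def by metis

lemma three_neighbours:
  assumes "markers V R x y z" "p \<in> V" "q \<in> V" "R y p" "R y q" "p \<noteq> x" "q \<noteq> x" shows "p = q"
  using assms unfolding markers_def by metis

text \<open>Every vertex other than (0, 0) fails to be the leaf: it is isolated, has two neighbours,
  or its only neighbour has degree at least 3. The side conditions of \<open>spine_widths\<close>
  are what the borderline cases at the last row and for a single row need.\<close>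

lemma markers_unique:
  assumes m: "markers V R x y z"
  shows "x = (0, 0) \<and> y = (0, Suc 0) \<and> z = (0, 2)"
proof -
  note two = two_neighbours[OF m] and three = three_neighbours[OF m]
  have xy: "x \<in> V" "y \<in> V" "R x y" "R y x" using m by (auto simp: markers_def)
  obtain i j where x: "x = (i, j)" by force
  have ij: "j < w i" "i \<le> a" using xy(1) wpos by (auto simp: x mem_iff)
  have S: "(0, 0) \<in> V" "(0, Suc 0) \<in> V" "(0, 2) \<in> V" "(1, 0) \<in> V" "(1, Suc 0) \<in> V" "(a, 0) \<in> V" "(a, Suc 0) \<in> V"
    using mem_special a1 by auto
  have "i = 0 \<and> j = 0"
  proof (rule ccontr)
    assume n: "\<not> (i = 0 \<and> j = 0)"
    consider "i = 0" "j = 1" | "i = 0" "j = 2" | "i = 0" "j \<ge> 3" | "i \<ge> 1" "j = 1" | "i \<ge> 1" "j = 0" | "i \<ge> 1" "j \<ge> 2"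
      using n by linarith
    then show False
    proof cases
      case 1 then show False using two[of "(0, 0)" "(0, 2)"] S by (auto simp: x adj_defs)
    next
      case 2 then show False using two[of "(0, Suc 0)" "(1, Suc 0)"] S by (auto simp: x adj_defs)
    next
      case 3 then show False using xy(3) by (auto simp: x adj_defs split: prod.splits)
    next
      case 4 then show False using two[of "(0, 2)" "(i, 0)"] S mem_special(4)[of i] ij
        by (auto simp: x adj_defs)
    next
      \<comment> \<open>A vertex \<open>u_i\<close> with i < a has the two neighbours
        \<open>v_i\<close> and \<open>v_a\<close>. If i = a >= 2, its neighbour \<open>v_a\<close>
        is joined to (0, 2) and \<open>u_1\<close> as well; if a = 1, the width is at least 4 and
        \<open>u_1\<close> is joined to a cell.\<close>
      case 5
      have "i = a" using two[of "(i, Suc 0)" "(a, Suc 0)"] S mem_special(5)[of i] ij 5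
        by (auto simp: x adj_defs)
      have y: "y = (a, Suc 0)" using two[of "(a, Suc 0)" y] S xy 5 \<open>i = a\<close> by (auto simp: x adj_defs)
      show False
      proof (cases "2 \<le> a")
        case True
        then show False using three[of "(0, 2)" "(1, 0)"] S \<open>i = a\<close> 5 by (auto simp: x y adj_defs)
      next
        case False
        then have "a = 1" "4 \<le> w 1" using short a1 by auto
        then show False using two[of "(1, Suc 0)" "(1, 2)"] S \<open>i = a\<close> 5
          by (auto simp: x adj_defs mem_iff)
      qed
    next
      \<comment> \<open>The neighbour of a cell has to be \<open>u_i\<close>. With cliques, a second
        row yields a second neighbour of the cell, and a single row yields another cell at
        \<open>u_1\<close>. Without cliques the last row has no cells, so i < a and
        \<open>u_i\<close> is joined to both \<open>v_i\<close> and \<open>v_a\<close>.\<close>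
      case 6
      have i0: "(i, 0) \<in> V" "(i, Suc 0) \<in> V" using mem_special ij 6 by auto
      have y: "y = (i, 0)" using two[of "(i, 0)" y] xy 6 i0 by (auto simp: x adj_defs)
      show False
      proof (cases f)
        case True
        show False
        proof (cases "2 \<le> a")
          case True
          define i' where "i' = (if i = 1 then 2 else (1::nat))"
          have i': "i' \<in> {1..a}" "i' \<noteq> i" using True 6 by (auto simp: i'_def)
          have "w i' = w i" using const[OF \<open>f\<close>, of i'] const[OF \<open>f\<close>, of i] i' ij 6 by simp
          then have "(i', j) \<in> V" using ij by (simp add: mem_iff)
          moreover have "i < i' \<or> i' < i" using i' by linarith
          ultimately show False using two[of "(i', j)" y] xy i' 6 \<open>f\<close> by (auto simp: x y adj_defs)
        next
          case False
          then have "a = 1" "4 \<le> w 1" using short a1 by auto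
          moreover define j' where "j' = (if j = 2 then 3 else (2::nat))"
          ultimately have "i = 1" "(1, j') \<in> V" "j' \<noteq> j" "j' \<ge> 2" using 6 ij by (auto simp: mem_iff)
          then show False using three[of "(1, Suc 0)" "(1, j')"] S 6 by (auto simp: x y adj_defs)
        qed
      next
        case False
        then have "i \<noteq> a" using last ij 6 by auto
        then show False using three[of "(i, Suc 0)" "(a, Suc 0)"] S i0 ij 6 by (auto simp: x y adj_defs)
      qed
    qed
  qed
  then have x0: "x = (0, 0)" by (simp add: x)
  then have y0: "y = (0, Suc 0)" using two[of "(0, Suc 0)" y] S xy by (auto simp: adj_defs)
  have "R y (0, 2)" by (simp add: y0 adj_defs)
  then have "(0, 2) = x \<or> (0, 2) = z" using m S unfolding markers_def by blast
  then show ?thesis using x0 y0 by auto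
qed

lemma side_v_nbr_iff:
  assumes "(i, j) \<in> V"
  shows "(\<exists>v\<in>V. SV v \<and> R (i, j) v) \<longleftrightarrow> i = 0 \<and> j = 2 \<or> 1 \<le> i \<and> j = 0"
proof
  assume "\<exists>v\<in>V. SV v \<and> R (i, j) v"
  then show "i = 0 \<and> j = 2 \<or> 1 \<le> i \<and> j = 0" by (auto simp: spine_side_v_iff adj_defs)
next
  assume "i = 0 \<and> j = 2 \<or> 1 \<le> i \<and> j = 0"
  \<comment> \<open>The last vertex \<open>v_a\<close> is joined to (0, 2) and to every
    \<open>u_i\<close>.\<close>
  then show "\<exists>v\<in>V. SV v \<and> R (i, j) v"
    using mem_special(5)[of a] a1 wpos[of j i] assms
    by (intro bexI[of _ "(a, Suc 0)"]) (auto simp: spine_side_v_iff adj_defs mem_iff)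
qed

lemma side_u_iff: "(i, j) \<in> V \<Longrightarrow> SU (i, j) \<longleftrightarrow> 1 \<le> i \<and> j = 0"
  unfolding side_u_def side_v_nbr_iff by (auto simp: adj_defs)

lemma nbr_iff:
  assumes "(i, j) \<in> V"
  shows "(\<exists>v\<in>V. R (i, j) v) \<longleftrightarrow> \<not> (i = 0 \<and> 3 \<le> j)"
proof
  assume "\<exists>v\<in>V. R (i, j) v"
  then show "\<not> (i = 0 \<and> 3 \<le> j)" by (auto simp: adj_defs)
next
  assume n: "\<not> (i = 0 \<and> 3 \<le> j)"
  have ij: "i \<le> a" "j < w i" using assms wpos by (auto simp: mem_iff)
  consider "i = 0" "j = 0" | "i = 0" "j = 1" | "i = 0" "j = 2" | "i \<ge> 1" "j = 1" | "i \<ge> 1" "j = 0" | "i \<ge> 1" "j \<ge> 2"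
    using n by linarith
  then show "\<exists>v\<in>V. R (i, j) v"
  proof cases
    case 1 then show ?thesis using mem_special(2) by (intro bexI[of _ "(0, Suc 0)"]) (auto simp: adj_defs)
  next
    case 2 then show ?thesis using mem_special(1) by (intro bexI[of _ "(0, 0)"]) (auto simp: adj_defs)
  next
    case 3 then show ?thesis using mem_special(2) by (intro bexI[of _ "(0, Suc 0)"]) (auto simp: adj_defs)
  next
    case 4 then show ?thesis using mem_special(3) by (intro bexI[of _ "(0, 2)"]) (auto simp: adj_defs)
  next
    case 5 then show ?thesis using mem_special(5)[of i] ij
      by (intro bexI[of _ "(i, Suc 0)"]) (auto simp: adj_defs)
  next
    case 6 then show ?thesis using mem_special(4)[of i] ij
      by (intro bexI[of _ "(i, 0)"]) (auto simp: adj_defs)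
  qed
qed

lemma isolated_iff: "(i, j) \<in> V \<Longrightarrow> isolated V R (i, j) \<longleftrightarrow> i = 0 \<and> 3 \<le> j"
  by (simp add: isolated_def nbr_iff)

lemma cell_iff: "(i, j) \<in> V \<Longrightarrow> SC (i, j) \<longleftrightarrow> 1 \<le> i \<and> 2 \<le> j"
  unfolding cell_def by (simp add: nbr_iff side_v_nbr_iff spine_adj_z) presburger

text \<open>This makes the number of a row invariant under isomorphism, and hence rigid.\<close>

lemma card_v_nbrs:
  assumes "1 \<le> i" "i \<le> a"
  shows "card {u \<in> V. SU u \<and> R u (i, Suc 0)} = i"
proof -
  have "{u \<in> V. SU u \<and> R u (i, Suc 0)} = (\<lambda>k. (k, 0)) ` {1..i}"
  proof (intro subset_antisym subsetI)
    fix u assume u: "u \<in> {u \<in> V. SU u \<and> R u (i, Suc 0)}"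
    obtain k l where kl: "u = (k, l)" by force
    with u have "1 \<le> k" "l = 0" "k \<le> i" using side_u_iff[of k l] by (auto simp: adj_defs)
    then show "u \<in> (\<lambda>k. (k, 0)) ` {1..i}" by (auto simp: kl)
  next
    fix u assume "u \<in> (\<lambda>k. (k, 0::nat)) ` {1..i}"
    then obtain k where k: "u = (k, 0)" "1 \<le> k" "k \<le> i" by auto
    with assms have "(k, 0) \<in> V" using mem_special(4)[of k] by auto
    with k show "u \<in> {u \<in> V. SU u \<and> R u (i, Suc 0)}"
      using side_u_iff[of k 0] by (auto simp: adj_defs)
  qed
  then show ?thesis by (simp add: card_image inj_on_def)
qed

end

section \<open>Isomorphisms between spines\<close>

text \<open>The markers are fixed because they are unique, each \<open>v_k\<close> because it has k
  neighbours on the u side, each \<open>u_k\<close> by its neighbours among the v, and a cell keeps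
  its row because it is joined to \<open>u_i\<close>. The only remaining freedom is to permute the
  cells of a row and the isolated vertices. Two width functions are allowed, so the lemma serves
  both for automorphisms and for telling types apart.\<close>

lemma spine_isom:
  assumes w: "spine_widths f a w" and w': "spine_widths f a' w'"
    and h: "isom h (row_graph w) (spine_adj f) (row_graph w') (spine_adj f)"
    and ij: "(i, j) \<in> row_graph w"
  shows "fst (h (i, j)) = i" "i = 0 \<Longrightarrow> j < 3 \<Longrightarrow> h (i, j) = (i, j)" "0 < i \<Longrightarrow> j < 2 \<Longrightarrow> h (i, j) = (i, j)"
    "0 < i \<Longrightarrow> 2 \<le> j \<Longrightarrow> 2 \<le> snd (h (i, j))" "i = 0 \<Longrightarrow> 3 \<le> j \<Longrightarrow> 3 \<le> snd (h (i, j))"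
proof -
  interpret s: spine f a w by unfold_locales (rule w)
  interpret s': spine f a' w' by unfold_locales (rule w')
  note S = s.mem_special
  have hm: "h (0, 0) = (0, 0)" "h (0, Suc 0) = (0, Suc 0)" "h (0, 2) = (0, 2)"
    using s'.markers_unique[OF isom_markers[OF h s.markers_V]] by auto
  have mem: "h v \<in> row_graph w'" if "v \<in> row_graph w" for v using isom_mem[OF h that] .
  have v: "h (k, Suc 0) = (k, Suc 0)" if k: "1 \<le> k" "k \<le> a" for k
  proof -
    have kV: "(k, Suc 0) \<in> row_graph w" using S(5)[OF k] .
    obtain k' l' where k': "h (k, Suc 0) = (k', l')" by force
    have k'V: "(k', l') \<in> row_graph w'" using mem[OF kV] k' by simp
    have "side_v (spine_adj f) (0, Suc 0) (0, 2) (k', l')"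
      using isom_side_v[OF h S(2,3) kV] spine_side_v_iff[of f k 1] k hm k' by simp
    then have kl: "1 \<le> k'" "l' = 1" by (auto simp: spine_side_v_iff)
    have "k' \<le> a'" using k'V s'.wpos by (auto simp: s'.mem_iff)
    have "card {u \<in> row_graph w. side_u (row_graph w) (spine_adj f) (0, Suc 0) (0, 2) u \<and> spine_adj f u (k, Suc 0)} =
      card {u \<in> row_graph w'. side_u (row_graph w') (spine_adj f) (0, Suc 0) (0, 2) u \<and> spine_adj f u (k', Suc 0)}"
    proof (rule isom_card[OF h])
      fix v assume v: "v \<in> row_graph w"
      show "side_u (row_graph w) (spine_adj f) (0, Suc 0) (0, 2) v \<and> spine_adj f v (k, Suc 0) \<longleftrightarrow>
        side_u (row_graph w') (spine_adj f) (0, Suc 0) (0, 2) (h v) \<and> spine_adj f (h v) (k', Suc 0)"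
        using isom_side_u[OF h S(2,3) v] isom_adj[OF h v kV] hm k' kl by simp
    qed
    then have "k = k'" using s.card_v_nbrs[OF k] s'.card_v_nbrs[OF kl(1) \<open>k' \<le> a'\<close>] by simp
    then show ?thesis using k' kl by simp
  qed
  have aa': "k \<le> a'" if "1 \<le> k" "k \<le> a" for k
    using mem[OF S(5)[OF that]] v[OF that] s'.wpos by (auto simp: s'.mem_iff)
  have u: "h (k, 0) = (k, 0)" if k: "1 \<le> k" "k \<le> a" for k
  proof -
    have kV: "(k, 0) \<in> row_graph w" using S(4)[OF k] .
    obtain k' l' where k': "h (k, 0) = (k', l')" by force
    have k'V: "(k', l') \<in> row_graph w'" using mem[OF kV] k' by simp
    have "side_u (row_graph w') (spine_adj f) (0, Suc 0) (0, 2) (k', l')"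
      using isom_side_u[OF h S(2,3) kV] s.side_u_iff[OF kV] k hm k' by simp
    then have kl: "1 \<le> k'" "l' = 0" using s'.side_u_iff[OF k'V] by auto
    have "spine_adj f (k, 0) (m, Suc 0) \<longleftrightarrow> spine_adj f (k', 0) (m, Suc 0)" if "1 \<le> m" "m \<le> a" for m
      using isom_adj[OF h kV S(5)[OF that]] v[OF that] k' kl by simp
    \<comment> \<open>The neighbours of \<open>u_k\<close> among the v are those with index at least
      k, so k can be read off as a threshold.\<close>
    then have *: "k \<le> m \<longleftrightarrow> k' \<le> m" if "1 \<le> m" "m \<le> a" for m
      using that k kl by (auto simp: adj_defs)
    have "k' \<le> k" using *[of k] k by simp
    moreover have "k \<le> k'" using *[of k'] k kl \<open>k' \<le> k\<close> by simp
    ultimately show ?thesis using k' kl by simp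
  qed
  have ia: "i \<le> a" using ij s.wpos by (auto simp: s.mem_iff)
  obtain i' j' where i': "h (i, j) = (i', j')" by force
  have i'V: "(i', j') \<in> row_graph w'" using mem[OF ij] i' by simp
  have cell: "i' = i \<and> 2 \<le> j'" if "0 < i" "2 \<le> j"
  proof -
    have "cell (row_graph w') (spine_adj f) (0, 0) (0, Suc 0) (0, 2) (i', j')"
      using isom_cell[OF h S(1,2,3) ij] s.cell_iff[OF ij] that hm i' by simp
    then have c: "1 \<le> i'" "2 \<le> j'" using s'.cell_iff[OF i'V] by auto
    have "spine_adj f (i, j) (i, 0)" using that by (auto simp: adj_defs)
    then have "spine_adj f (i', j') (i, 0)"
      using isom_adj[OF h ij S(4)[of i]] u[of i] ia that i' by simp
    then have "i' = i" using c by (auto simp: adj_defs)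
    with c show ?thesis by simp
  qed
  have iso: "i' = 0 \<and> 3 \<le> j'" if "i = 0" "3 \<le> j"
    using isom_isolated[OF h ij] s.isolated_iff[OF ij] s'.isolated_iff[OF i'V] that i' by simp
  show 2: "h (i, j) = (i, j)" if "i = 0" "j < 3"
  proof -
    have "j = 0 \<or> j = 1 \<or> j = 2" using that by linarith
    then show ?thesis using hm that by auto
  qed
  show 3: "h (i, j) = (i, j)" if "0 < i" "j < 2"
    using that u[of i] v[of i] ia less_2_cases[of j] by auto
  show "2 \<le> snd (h (i, j))" if "0 < i" "2 \<le> j" using cell[OF that] i' by simp
  show "3 \<le> snd (h (i, j))" if "i = 0" "3 \<le> j" using iso[OF that] i' by simp
  show "fst (h (i, j)) = i"
  proof (cases "i = 0")
    case True then show ?thesis using 2 iso i' by (cases "j < 3") auto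
  next
    case False then show ?thesis using 3 cell i' by (cases "j < 2") auto
  qed
qed

text \<open>Isomorphisms preserve rows, so each row injects into its counterpart, and the inverse
  gives the other inequality.\<close>

lemma spine_isom_widths:
  assumes w: "spine_widths f a w" and w': "spine_widths f a' w'"
    and h: "isom h (row_graph w) (spine_adj f) (row_graph w') (spine_adj f)"
  shows "w = w'"
proof -
  have le: "w i \<le> w' i"
    if w: "spine_widths f a w" and w': "spine_widths f a' w'"
      and h: "isom h (row_graph w) (spine_adj f) (row_graph w') (spine_adj f)" for w w' a a' h i
  proof -
    have sub: "h ` ({i} \<times> {..<w i}) \<subseteq> {i} \<times> {..<w' i}"
    proof
      fix q assume "q \<in> h ` ({i} \<times> {..<w i})"
      then obtain j where j: "q = h (i, j)" "(i, j) \<in> row_graph w" by (auto simp: row_graph_def)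
      have "fst q = i" using spine_isom(1)[OF w w' h j(2)] j by simp
      moreover have "q \<in> row_graph w'" using isom_mem[OF h j(2)] j by simp
      ultimately show "q \<in> {i} \<times> {..<w' i}" by (cases q) (auto simp: row_graph_def)
    qed
    have "inj_on h (row_graph w)" using h by (simp add: isom_def bij_betw_def)
    then have "inj_on h ({i} \<times> {..<w i})" by (rule inj_on_subset) (auto simp: row_graph_def)
    from card_inj_on_le[OF this sub] show ?thesis by simp
  qed
  show ?thesis
    using le[OF w w' h] le[OF w' w isom_inv[OF h]] by (intro ext antisym)
qed

section \<open>Recovering the rows from the adjacency\<close>

text \<open>The neighbourhoods form a chain, and on a chain of finite sets the cardinality is
  injective and determines inclusion. Stated for one side; exchanging the roles gives the
  other.\<close>

lemma nested_inj:
  assumes fin: "finite U"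
    and nested: "\<forall>u\<in>U. \<forall>u'\<in>U. \<forall>v\<in>V. \<forall>v'\<in>V. A u v \<longrightarrow> A u' v' \<longrightarrow> A u v' \<or> A u' v"
    and dist: "\<forall>v\<in>V. \<forall>v'\<in>V. v \<noteq> v' \<longrightarrow> (\<exists>u\<in>U. A u v \<noteq> A u v')"
    and ne: "\<forall>v\<in>V. \<exists>u\<in>U. A u v"
  defines "N \<equiv> \<lambda>v. {u \<in> U. A u v}"
  shows "inj_on (\<lambda>v. card (N v)) V" "(\<lambda>v. card (N v)) ` V \<subseteq> {1..card U}"
    "\<And>v v'. v \<in> V \<Longrightarrow> v' \<in> V \<Longrightarrow> card (N v) \<le> card (N v') \<Longrightarrow> N v \<subseteq> N v'"
proof -
  have finN: "finite (N v)" for v using fin by (simp add: N_def)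
  have cmp: "N v \<subseteq> N v' \<or> N v' \<subseteq> N v" if "v \<in> V" "v' \<in> V" for v v'
  proof (rule ccontr)
    assume "\<not> ?thesis"
    then obtain u u' where "u \<in> U" "u' \<in> U" "A u v" "\<not> A u v'" "A u' v'" "\<not> A u' v"
      by (auto simp: N_def)
    then show False using nested that by blast
  qed
  show sub: "N v \<subseteq> N v'" if "v \<in> V" "v' \<in> V" "card (N v) \<le> card (N v')" for v v'
    using cmp[OF that(1,2)] card_seteq[OF finN, of "N v'" v] that(3) by auto
  show "inj_on (\<lambda>v. card (N v)) V"
  proof (rule inj_onI)
    fix v v' assume v: "v \<in> V" "v' \<in> V" "card (N v) = card (N v')"
    then have "N v = N v'" using sub[of v v'] sub[of v' v] by auto
    then show "v = v'" using dist v(1,2) by (fastforce simp: N_def set_eq_iff)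
  qed
  show "(\<lambda>v. card (N v)) ` V \<subseteq> {1..card U}"
  proof clarsimp
    fix v assume "v \<in> V"
    then have "N v \<noteq> {}" using ne by (auto simp: N_def)
    then have "0 < card (N v)" using finN by (simp add: card_gt_0_iff)
    moreover have "card (N v) \<le> card U" using fin by (intro card_mono) (auto simp: N_def)
    ultimately show "Suc 0 \<le> card (N v) \<and> card (N v) \<le> card U" by simp
  qed
qed

text \<open>A bipartite graph without two independent edges in which distinct vertices of a side
  have distinct nonempty neighbourhoods is a half graph: the degrees on either side exhaust
  \<open>{1..a}\<close> and serve as coordinates.\<close>

lemma half_graph_enumeration:
  assumes fin: "finite U" "finite V"
    and nested: "\<forall>u\<in>U. \<forall>u'\<in>U. \<forall>v\<in>V. \<forall>v'\<in>V. A u v \<longrightarrow> A u' v' \<longrightarrow> A u v' \<or> A u' v"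
    and distv: "\<forall>v\<in>V. \<forall>v'\<in>V. v \<noteq> v' \<longrightarrow> (\<exists>u\<in>U. A u v \<noteq> A u v')"
    and distu: "\<forall>u\<in>U. \<forall>u'\<in>U. u \<noteq> u' \<longrightarrow> (\<exists>v\<in>V. A u v \<noteq> A u' v)"
    and nev: "\<forall>v\<in>V. \<exists>u\<in>U. A u v"
    and neu: "\<forall>u\<in>U. \<exists>v\<in>V. A u v"
  obtains a :: nat and iu iv where "bij_betw iu U {1..a}" "bij_betw iv V {1..a}"
    "\<And>u v. u \<in> U \<Longrightarrow> v \<in> V \<Longrightarrow> A u v \<longleftrightarrow> iu u \<le> iv v"
proof -
  define N where "N v = {u \<in> U. A u v}" for v
  define M where "M u = {v \<in> V. A u v}" for u
  have nv: "inj_on (\<lambda>v. card (N v)) V" "(\<lambda>v. card (N v)) ` V \<subseteq> {1..card U}"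
    "\<And>v v'. v \<in> V \<Longrightarrow> v' \<in> V \<Longrightarrow> card (N v) \<le> card (N v') \<Longrightarrow> N v \<subseteq> N v'"
    using nested_inj[OF fin(1) nested distv nev] by (simp_all add: N_def)
  have nested': "\<forall>v\<in>V. \<forall>v'\<in>V. \<forall>u\<in>U. \<forall>u'\<in>U. A u v \<longrightarrow> A u' v' \<longrightarrow> A u' v \<or> A u v'"
    using nested by blast
  have injM: "inj_on (\<lambda>u. card (M u)) U" and imM: "(\<lambda>u. card (M u)) ` U \<subseteq> {1..card V}"
    using nested_inj[where A = "\<lambda>v u. A u v", OF fin(2) nested' distu neu] by (simp_all add: M_def)
  define a where "a = card U"
  \<comment> \<open>The degrees inject each side into an interval as long as the other side, so both
    sides have the same size.\<close>
  have "card V \<le> a" using card_inj_on_le[OF nv(1,2)] by (simp add: a_def)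
  moreover have "a \<le> card V" using card_inj_on_le[OF injM imM] by (simp add: a_def)
  ultimately have aV: "card V = a" by simp
  define iv where "iv = (\<lambda>v. card (N v))"
  have biv: "bij_betw iv V {1..a}"
  proof -
    have "iv ` V = {1..a}"
    proof (rule card_subset_eq)
      show "iv ` V \<subseteq> {1..a}" using nv(2) by (simp add: iv_def a_def)
      show "card (iv ` V) = card {1..a}" using nv(1) aV by (simp add: iv_def card_image)
    qed simp
    then show ?thesis using nv(1) by (simp add: bij_betw_def iv_def)
  qed
  \<comment> \<open>In the half graph \<open>u_i\<close> is joined to \<open>v_i\<close>, ...,
    \<open>v_a\<close>, hence has a + 1 - i neighbours.\<close>
  define iu where "iu u = a + 1 - card (M u)" for u
  have M_range: "card (M u) \<in> {1..a}" if "u \<in> U" for u using imM that aV by auto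
  have biu: "bij_betw iu U {1..a}"
  proof -
    have inj: "inj_on iu U"
    proof (rule inj_onI)
      fix u u' assume u: "u \<in> U" "u' \<in> U" "iu u = iu u'"
      then have "card (M u) = card (M u')" using M_range[of u] M_range[of u'] by (auto simp: iu_def)
      then show "u = u'" using injM u by (auto simp: inj_on_def)
    qed
    have "iu ` U = {1..a}"
    proof (rule card_subset_eq)
      show "iu ` U \<subseteq> {1..a}" using M_range by (fastforce simp: iu_def)
      show "card (iu ` U) = card {1..a}" using inj by (simp add: card_image a_def)
    qed simp
    then show ?thesis using inj by (simp add: bij_betw_def)
  qed
  have "A u v \<longleftrightarrow> iu u \<le> iv v" if uv: "u \<in> U" "v \<in> V" for u v
  proof -
    have ivv: "1 \<le> iv v" "iv v \<le> a" using biv uv(2) by (auto simp: bij_betw_def)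
    have count: "card {v' \<in> V. P (iv v')} = card {k \<in> {1..a}. P k}" for P
    proof -
      have "iv ` {v' \<in> V. P (iv v')} = {k \<in> {1..a}. P k}" using biv by (auto simp: bij_betw_def)
      moreover have "inj_on iv {v' \<in> V. P (iv v')}" by (rule inj_on_subset[of iv V]) (use biv in \<open>auto simp: bij_betw_def\<close>)
      ultimately show ?thesis using card_image by fastforce
    qed
    \<comment> \<open>The neighbourhood of u is closed upwards in v. If it contains v, it has at
      least the number of elements counted here; otherwise it lies strictly above v and has at most
      the number counted next.\<close>
    have up: "card {v' \<in> V. iv v \<le> iv v'} = a + 1 - iv v"
    proof -
      have "{k \<in> {1..a}. iv v \<le> k} = {iv v..a}" using ivv by auto
      then show ?thesis using count[of "\<lambda>k. iv v \<le> k"] by simp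
    qed
    have dn: "card {v' \<in> V. iv v < iv v'} = a - iv v"
    proof -
      have "{k \<in> {1..a}. iv v < k} = {iv v<..a}" using ivv by auto
      then show ?thesis using count[of "\<lambda>k. iv v < k"] by simp
    qed
    show ?thesis
    proof
      assume "A u v"
      then have "{v' \<in> V. iv v \<le> iv v'} \<subseteq> M u"
        using nv(3)[OF uv(2)] uv by (auto simp: M_def iv_def N_def)
      then have "a + 1 - iv v \<le> card (M u)"
        using up card_mono[of "M u" "{v' \<in> V. iv v \<le> iv v'}"] fin by (simp add: M_def)
      then show "iu u \<le> iv v" by (simp add: iu_def)
    next
      assume le: "iu u \<le> iv v"
      show "A u v"
      proof (rule ccontr)
        assume n: "\<not> A u v"
        have "M u \<subseteq> {v' \<in> V. iv v < iv v'}"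
        proof
          fix v' assume v': "v' \<in> M u"
          show "v' \<in> {v' \<in> V. iv v < iv v'}"
          proof (rule ccontr)
            assume "v' \<notin> {v' \<in> V. iv v < iv v'}"
            then have "iv v' \<le> iv v" using v' by (auto simp: M_def)
            then have "N v' \<subseteq> N v" using nv(3)[of v' v] v' uv by (auto simp: M_def iv_def)
            then show False using n v' uv by (auto simp: M_def N_def)
          qed
        qed
        then have "card (M u) \<le> a - iv v"
          using dn card_mono[of "{v' \<in> V. iv v < iv v'}" "M u"] fin by auto
        then show False using le ivv M_range[OF uv(1)] by (auto simp: iu_def)
      qed
    qed
  qed
  with biu biv show ?thesis by (rule that)
qed

text \<open>The axioms shared by both families. The conjuncts four to seven are hypotheses of
  \<open>half_graph_enumeration\<close>; that every u has a neighbour is part of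
  \<open>side_u\<close>. How many cells a row has and how cells are joined is left to
  \<open>layered\<close> and \<open>columns\<close>.\<close>

definition spine_base :: "'a set \<Rightarrow> ('a \<Rightarrow> 'a \<Rightarrow> bool) \<Rightarrow> 'a \<Rightarrow> 'a \<Rightarrow> 'a \<Rightarrow> bool" where
  "spine_base D A x y z \<longleftrightarrow> markers D A x y z \<and>
     (\<forall>v\<in>D. \<forall>v'\<in>D. side_v A y z v \<and> side_v A y z v' \<longrightarrow> \<not> A v v') \<and>
     (\<forall>u\<in>D. \<forall>u'\<in>D. side_u D A y z u \<and> side_u D A y z u' \<longrightarrow> \<not> A u u') \<and>
     (\<forall>u\<in>D. \<forall>u'\<in>D. \<forall>v\<in>D. \<forall>v'\<in>D. side_u D A y z u \<and> side_u D A y z u' \<and> side_v A y z v \<and> side_v A y z v' \<and>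
        A u v \<and> A u' v' \<longrightarrow> A u v' \<or> A u' v) \<and>
     (\<forall>v\<in>D. \<forall>v'\<in>D. side_v A y z v \<and> side_v A y z v' \<and> v \<noteq> v' \<longrightarrow>
        (\<exists>u\<in>D. side_u D A y z u \<and> \<not> (A u v \<longleftrightarrow> A u v'))) \<and>
     (\<forall>u\<in>D. \<forall>u'\<in>D. side_u D A y z u \<and> side_u D A y z u' \<and> u \<noteq> u' \<longrightarrow>
        (\<exists>v\<in>D. side_v A y z v \<and> \<not> (A u v \<longleftrightarrow> A u' v))) \<and>
     (\<forall>v\<in>D. side_v A y z v \<longrightarrow> (\<exists>u\<in>D. side_u D A y z u \<and> A u v)) \<and>
     (\<exists>u\<in>D. side_u D A y z u) \<and>
     (\<forall>c\<in>D. cell D A x y z c \<longrightarrow>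
        (\<exists>u\<in>D. side_u D A y z u \<and> A c u \<and> (\<forall>u'\<in>D. side_u D A y z u' \<and> A c u' \<longrightarrow> u' = u)))"

text \<open>The offsets \<open>\<kappa>\<close> of the cells within their rows are left to the
  caller, since this is where the families differ: arbitrary for layers, constant along each clique
  for columns. The description of the order of the rows by v vertices is exported because
  \<open>layered\<close> speaks about it in this form.\<close>

lemma spine_reconstruction:
  fixes D :: "'a set" and A x y z and \<kappa> :: "'a \<Rightarrow> nat"
  defines "Us \<equiv> {u \<in> D. side_u D A y z u}" and "Vs \<equiv> {v \<in> D. side_v A y z v}"
    and "Cs \<equiv> {c \<in> D. cell D A x y z c}"
  assumes D: "finite D" and A: "simple_rel A" and base: "spine_base D A x y z"
    and \<kappa>: "\<And>u. u \<in> Us \<Longrightarrow> bij_betw \<kappa> {c \<in> Cs. A c u} {..<card {c \<in> Cs. A c u}}"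
    and cc: "\<And>c c'. c \<in> Cs \<Longrightarrow> c' \<in> Cs \<Longrightarrow> A c c' \<longleftrightarrow> f \<and> \<kappa> c = \<kappa> c' \<and> c \<noteq> c'"
  obtains a :: nat and iu g w where "bij_betw iu Us {1..a}" "1 \<le> a"
    "\<And>u u'. u \<in> Us \<Longrightarrow> u' \<in> Us \<Longrightarrow> iu u < iu u' \<longleftrightarrow> (\<exists>v\<in>Vs. A u v \<and> \<not> A u' v)"
    "isom g D A (row_graph w) (spine_adj f)" "w 0 = 3 + card {d \<in> D. isolated D A d}"
    "\<And>u. u \<in> Us \<Longrightarrow> w (iu u) = 2 + card {c \<in> Cs. A c u}" "\<And>i. a < i \<Longrightarrow> w i = 0"
proof -
  note b1 = base[unfolded spine_base_def, THEN conjunct1]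
  note b2 = base[unfolded spine_base_def, THEN conjunct2, THEN conjunct1]
  note b3 = base[unfolded spine_base_def, THEN conjunct2, THEN conjunct2, THEN conjunct1]
  note b4 = base[unfolded spine_base_def, THEN conjunct2, THEN conjunct2, THEN conjunct2, THEN conjunct1]
  note b5 = base[unfolded spine_base_def, THEN conjunct2, THEN conjunct2, THEN conjunct2, THEN conjunct2, THEN conjunct1]
  note b6 = base[unfolded spine_base_def, THEN conjunct2, THEN conjunct2, THEN conjunct2, THEN conjunct2, THEN conjunct2, THEN conjunct1]
  note b7 = base[unfolded spine_base_def, THEN conjunct2, THEN conjunct2, THEN conjunct2, THEN conjunct2, THEN conjunct2, THEN conjunct2, THEN conjunct1]
  note b8 = base[unfolded spine_base_def, THEN conjunct2, THEN conjunct2, THEN conjunct2, THEN conjunct2, THEN conjunct2, THEN conjunct2, THEN conjunct2, THEN conjunct1]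
  note b9 = base[unfolded spine_base_def, THEN conjunct2, THEN conjunct2, THEN conjunct2, THEN conjunct2, THEN conjunct2, THEN conjunct2, THEN conjunct2, THEN conjunct2]
  have sym: "A p q \<longleftrightarrow> A q p" and irr: "\<not> A p p" for p q using A by (auto simp: simple_rel_def)
  have m: "markers D A x y z" by (rule b1)
  have xyz: "x \<in> D" "y \<in> D" "z \<in> D" "x \<noteq> z" using m by (auto simp: markers_def)
  have Ax: "A x d \<longleftrightarrow> d = y" if "d \<in> D" for d using m that by (auto simp: markers_def)
  have Ay: "A y d \<longleftrightarrow> d = x \<or> d = z" if "d \<in> D" for d using m that by (auto simp: markers_def)
  have ne: "x \<noteq> y" "y \<noteq> z" using Ax[OF xyz(2)] Ay[OF xyz(3)] irr by auto
  have Az: "A z d \<longleftrightarrow> d = y \<or> d \<in> Vs" if "d \<in> D" for d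
    using that Ay[OF xyz(3)] sym by (auto simp: Vs_def side_v_def)
  have fin: "finite Us" "finite Vs" using D by (auto simp: Us_def Vs_def)
  have VV: "\<not> A v v'" if "v \<in> Vs" "v' \<in> Vs" for v v' using b2 that by (auto simp: Vs_def)
  have UU: "\<not> A u u'" if "u \<in> Us" "u' \<in> Us" for u u' using b3 that by (auto simp: Us_def)
  have UV: "\<exists>v\<in>Vs. A u v" if "u \<in> Us" for u using that by (auto simp: Us_def Vs_def side_u_def)
  obtain a :: nat and iu iv where iu: "bij_betw iu Us {1..a}" and iv: "bij_betw iv Vs {1..a}"
    and Auv: "\<And>u v. u \<in> Us \<Longrightarrow> v \<in> Vs \<Longrightarrow> A u v \<longleftrightarrow> iu u \<le> iv v"
  proof (rule half_graph_enumeration[OF fin, of A])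
    show "\<forall>u\<in>Us. \<forall>u'\<in>Us. \<forall>v\<in>Vs. \<forall>v'\<in>Vs. A u v \<longrightarrow> A u' v' \<longrightarrow> A u v' \<or> A u' v"
      using b4 unfolding Us_def Vs_def by blast
    show "\<forall>v\<in>Vs. \<forall>v'\<in>Vs. v \<noteq> v' \<longrightarrow> (\<exists>u\<in>Us. A u v \<noteq> A u v')"
      using b5 unfolding Us_def Vs_def by blast
    show "\<forall>u\<in>Us. \<forall>u'\<in>Us. u \<noteq> u' \<longrightarrow> (\<exists>v\<in>Vs. A u v \<noteq> A u' v)"
      using b6 unfolding Us_def Vs_def by blast
    show "\<forall>v\<in>Vs. \<exists>u\<in>Us. A u v"
      using b7 unfolding Us_def Vs_def by blast
    show "\<forall>u\<in>Us. \<exists>v\<in>Vs. A u v" using UV by blast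
  qed (rule that)
  have a1: "1 \<le> a"
  proof -
    obtain u where "u \<in> Us" using b8 by (auto simp: Us_def)
    then have "iu u \<in> {1..a}" using iu by (auto simp: bij_betw_def)
    then show ?thesis by simp
  qed
  have iu_range: "1 \<le> iu u" "iu u \<le> a" if "u \<in> Us" for u using iu that by (auto simp: bij_betw_def)
  have iv_range: "1 \<le> iv v" "iv v \<le> a" if "v \<in> Vs" for v using iv that by (auto simp: bij_betw_def)
  have iu_inj: "iu u = iu u' \<longleftrightarrow> u = u'" if "u \<in> Us" "u' \<in> Us" for u u'
    using iu that by (auto simp: bij_betw_def inj_on_def)
  have iv_inj: "iv u = iv u' \<longleftrightarrow> u = u'" if "u \<in> Vs" "u' \<in> Vs" for u u'
    using iv that by (auto simp: bij_betw_def inj_on_def)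
  define row where "row c = (THE u. u \<in> Us \<and> A c u)" for c
  have ex1: "\<exists>!u. u \<in> Us \<and> A c u" if "c \<in> Cs" for c
    using b9 that unfolding Us_def Cs_def by blast
  have row: "row c \<in> Us" "A c (row c)" if "c \<in> Cs" for c
    using theI'[OF ex1[OF that]] by (auto simp: row_def)
  have Acu: "A c u \<longleftrightarrow> u = row c" if "c \<in> Cs" "u \<in> Us" for c u
    using ex1[OF that(1)] row[OF that(1)] that by auto
  have row_range: "1 \<le> iu (row c)" "iu (row c) \<le> a" if "c \<in> Cs" for c
    using iu_range row(1)[OF that] by auto
  define Is where "Is = {d \<in> D. isolated D A d}"
  have Isadj: "\<not> A d e" if "d \<in> Is" "e \<in> D" for d e using that by (auto simp: Is_def isolated_def)
  have finI: "finite Is" using D by (simp add: Is_def)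
  obtain \<iota> where \<iota>: "bij_betw \<iota> Is {0..<card Is}" using ex_bij_betw_finite_nat[OF finI] by auto
  have \<iota>_inj: "\<iota> u = \<iota> u' \<longleftrightarrow> u = u'" if "u \<in> Is" "u' \<in> Is" for u u'
    using \<iota> that by (auto simp: bij_betw_def inj_on_def)
  have \<iota>_range: "\<iota> u < card Is" if "u \<in> Is" for u using \<iota> that by (auto simp: bij_betw_def)
  have CV: "\<not> A c v" if "c \<in> Cs" "v \<in> Vs" for c v using that by (auto simp: Cs_def Vs_def cell_def)
  have sub: "Us \<subseteq> D" "Vs \<subseteq> D" "Cs \<subseteq> D" "Is \<subseteq> D" by (auto simp: Us_def Vs_def Cs_def Is_def)
  have Cx: "x \<notin> Cs" "y \<notin> Cs" "z \<notin> Cs"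
    using Ay[OF xyz(3)] by (auto simp: Cs_def cell_def)
  have Ux: "x \<notin> Us" "y \<notin> Us" "z \<notin> Us"
    using Ay[OF xyz(3)] Ax by (auto simp: Us_def side_u_def side_v_def)
  have Vx: "x \<notin> Vs" "y \<notin> Vs" "z \<notin> Vs"
    using Ax[OF xyz(3)] ne irr by (auto simp: Vs_def side_v_def)
  have Ix: "x \<notin> Is" "y \<notin> Is" "z \<notin> Is"
    using Ay[OF xyz(3)] Ay[OF xyz(1)] Ax[OF xyz(2)] sym xyz by (auto simp: Is_def isolated_def)
  have disj: "Us \<inter> Vs = {}" "Us \<inter> Cs = {}" "Vs \<inter> Cs = {}" "Is \<inter> Us = {}" "Is \<inter> Vs = {}" "Is \<inter> Cs = {}"
    using xyz by (auto simp: Us_def Vs_def Cs_def Is_def side_u_def side_v_def cell_def isolated_def)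
  have all: "d \<in> {x, y, z} \<union> Is \<union> Vs \<union> Us \<union> Cs" if "d \<in> D" for d
    using that by (auto simp: Us_def Vs_def Cs_def Is_def side_u_def side_v_def cell_def isolated_def)
  \<comment> \<open>Offsets 0 to 2 in row 0 are taken by the path, and offsets 0 and 1 elsewhere by
    the two sides, hence the shifts by 3 and 2.\<close>
  define g where "g d = (if d = x then (0, 0) else if d = y then (0, Suc 0) else if d = z then (0, 2) else
     if d \<in> Is then (0, 3 + \<iota> d) else if d \<in> Vs then (iv d, Suc 0) else if d \<in> Us then (iu d, 0)
     else (iu (row d), 2 + \<kappa> d))" for d
  have gx: "g x = (0, 0)" and gy: "g y = (0, Suc 0)" and gz: "g z = (0, 2)"
    using ne xyz by (auto simp: g_def)
  have gI: "g d = (0, 3 + \<iota> d)" if "d \<in> Is" for d using that Ix by (auto simp: g_def)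
  have gV: "g d = (iv d, Suc 0)" if "d \<in> Vs" for d using that Vx disj by (auto simp: g_def)
  have gU: "g d = (iu d, 0)" if "d \<in> Us" for d using that Ux disj by (auto simp: g_def)
  have gC: "g d = (iu (row d), 2 + \<kappa> d)" if "d \<in> Cs" for d using that Cx disj by (auto simp: g_def)
  define w where "w i = (if i = 0 then 3 + card Is else if i \<le> a then
     2 + card {c \<in> Cs. A c (inv_into Us iu i)} else 0)" for i
  have wu: "w (iu u) = 2 + card {c \<in> Cs. A c u}" if "u \<in> Us" for u
    using that iu_range[OF that] iu by (simp add: w_def bij_betw_inv_into_left)
  have \<kappa>_range: "\<kappa> c < card {c' \<in> Cs. A c' (row c)}" if "c \<in> Cs" for c
    using \<kappa>[OF row(1)[OF that]] row[OF that] that by (auto simp: bij_betw_def)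
  have \<kappa>_inj: "c = c'" if "c \<in> Cs" "c' \<in> Cs" "row c = row c'" "\<kappa> c = \<kappa> c'" for c c'
  proof -
    have "inj_on \<kappa> {d \<in> Cs. A d (row c)}" using \<kappa>[OF row(1)[OF that(1)]] by (simp add: bij_betw_def)
    then show ?thesis using that row[OF that(1)] row[OF that(2)] by (auto simp: inj_on_def)
  qed
  \<comment> \<open>Case analysis over the partition into markers and definable classes.\<close>
  have cls: "thesis" if "d \<in> D" "d = x \<Longrightarrow> thesis" "d = y \<Longrightarrow> thesis" "d = z \<Longrightarrow> thesis" "d \<in> Is \<Longrightarrow> thesis"
    "d \<in> Vs \<Longrightarrow> thesis" "d \<in> Us \<Longrightarrow> thesis" "d \<in> Cs \<Longrightarrow> thesis" for d thesis
    using all[OF that(1)] that(2-) by blast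
  have inj: "inj_on g D"
  proof (rule inj_onI)
    fix d e assume d: "d \<in> D" and e: "e \<in> D" and eq: "g d = g e"
    show "d = e"
    proof (rule cls[OF d])
      assume "d = x" then show ?thesis using eq gx
        by (rule_tac cls[OF e]) (auto simp: gy gz gI gV gU gC dest: iu_range iv_range row_range)
    next
      assume "d = y" then show ?thesis using eq gy
        by (rule_tac cls[OF e]) (auto simp: gx gz gI gV gU gC dest: iu_range iv_range row_range)
    next
      assume "d = z" then show ?thesis using eq gz row
        by (rule_tac cls[OF e]) (auto simp: gx gy gI gV gU gC dest: iu_range iv_range row_range)
    next
      assume h: "d \<in> Is" then show ?thesis using eq gI[OF h] row
        by (rule_tac cls[OF e]) (auto simp: gx gy gz gI gV gU gC \<iota>_inj dest: iu_range iv_range row_range)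
    next
      assume h: "d \<in> Vs" then show ?thesis using eq gV[OF h] row iv_range[OF h]
        by (rule_tac cls[OF e]) (auto simp: gx gy gz gI gV gU gC iv_inj)
    next
      assume h: "d \<in> Us" then show ?thesis using eq gU[OF h] row iu_range[OF h]
        by (rule_tac cls[OF e]) (auto simp: gx gy gz gI gV gU gC iu_inj)
    next
      assume h: "d \<in> Cs" then show ?thesis using eq gC[OF h] row iu_range[OF row(1)[OF h]]
        by (rule_tac cls[OF e]) (auto simp: gx gy gz gI gV gU gC iu_inj intro: \<kappa>_inj)
    qed
  qed
  have im: "g ` D = row_graph w"
  proof (intro subset_antisym subsetI)
    fix p assume "p \<in> g ` D"
    then obtain d where d: "d \<in> D" "p = g d" by auto
    show "p \<in> row_graph w"
      by (rule cls[OF d(1)])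
        (auto simp: d(2) gx gy gz gI gV gU gC row_graph_def \<iota>_range wu row \<kappa>_range w_def[of 0],
         auto simp: w_def dest: iv_range iu_range)
  next
    fix p assume "p \<in> row_graph w"
    then obtain i j where p: "p = (i, j)" "j < w i" by (auto simp: row_graph_def)
    show "p \<in> g ` D"
    proof (cases "i = 0")
      case True
      consider "j = 0" | "j = Suc 0" | "j = 2" | "3 \<le> j" by linarith
      then show ?thesis
      proof cases
        case 4
        have "j - 3 \<in> \<iota> ` Is" using \<iota> p(2) True 4 by (auto simp: bij_betw_def w_def)
        then obtain d where "d \<in> Is" "\<iota> d = j - 3" by auto
        then have "g d = (0, j)" using gI 4 by simp
        then show ?thesis using \<open>d \<in> Is\<close> sub p True by force
      qed (use True p gx gy gz xyz in \<open>force+\<close>)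
    next
      case False
      then have ia: "i \<in> {1..a}" using p(2) by (auto simp: w_def split: if_splits)
      then have "i \<in> iu ` Us" "i \<in> iv ` Vs" using iu iv by (simp_all add: bij_betw_def)
      then obtain u v where u: "u \<in> Us" "iu u = i" and v: "v \<in> Vs" "iv v = i" by auto
      consider "j = 0" | "j = Suc 0" | "2 \<le> j" by linarith
      then show ?thesis
      proof cases
        case 1 then show ?thesis using gU[OF u(1)] u p sub by force
      next
        case 2 then show ?thesis using gV[OF v(1)] v p sub by force
      next
        case 3
        have "j - 2 < card {c \<in> Cs. A c u}" using wu[OF u(1)] u p(2) 3 by simp
        then have "j - 2 \<in> \<kappa> ` {c \<in> Cs. A c u}" using \<kappa>[OF u(1)] by (auto simp: bij_betw_def)
        then obtain c where c: "c \<in> Cs" "A c u" "\<kappa> c = j - 2" by auto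
        then have "row c = u" using Acu u by auto
        then have "g c = (i, j)" using gC[OF c(1)] c 3 u by simp
        then show ?thesis using c(1) sub p by force
      qed
    qed
  qed
  have nbr_sym: "spine_adj f p q \<longleftrightarrow> spine_adj f q p" for p q by (auto simp: spine_adj_def)
  have adj: "A d e \<longleftrightarrow> spine_adj f (g d) (g e)" if d: "d \<in> D" and e: "e \<in> D" for d e
  proof (rule cls[OF d])
    assume "d = x" then show ?thesis using Ax[OF e] Ax ne
      by (rule_tac cls[OF e]) (auto simp: gx gy gz gI gV gU gC adj_defs Ix Vx Ux Cx dest: iu_range iv_range row_range)
  next
    assume "d = y" then show ?thesis using Ay[OF e] ne xyz
      by (rule_tac cls[OF e]) (auto simp: gx gy gz gI gV gU gC adj_defs Ix Vx Ux Cx dest: iu_range iv_range row_range)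
  next
    assume "d = z" then show ?thesis using Az[OF e] ne xyz Vx disj row
      by (rule_tac cls[OF e]) (auto simp: gx gy gz gI gV gU gC adj_defs Ix Vx Ux Cx dest: iu_range iv_range row_range)
  next
    assume h: "d \<in> Is" then show ?thesis using Isadj[OF h e]
      by (auto simp: gI adj_defs)
  next
    assume h: "d \<in> Vs"
    have ii: "1 \<le> iv d" using iv_range[OF h] by simp
    have 1: "A d e \<longleftrightarrow> A e d" by (rule sym)
    show ?thesis
    proof (rule cls[OF e])
      assume "e = x" then show ?thesis using 1 Ax[OF d] h Vx ii by (auto simp: gx gV adj_defs)
    next
      assume "e = y" then show ?thesis using 1 Ay[OF d] h Vx ii by (auto simp: gy gV adj_defs)
    next
      assume "e = z" then show ?thesis using 1 Az[OF d] h Vx ii by (auto simp: gz gV adj_defs)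
    next
      assume k: "e \<in> Is" then show ?thesis using 1 Isadj[OF k d] h ii by (auto simp: gI gV adj_defs)
    next
      assume k: "e \<in> Vs" then show ?thesis using VV[OF h k] h ii iv_range[OF k] by (auto simp: gV adj_defs)
    next
      assume k: "e \<in> Us" then show ?thesis using 1 Auv[OF k h] h ii iu_range[OF k]
        by (auto simp: gV gU adj_defs)
    next
      assume k: "e \<in> Cs" then show ?thesis using 1 CV[OF k h] h ii iu_range[OF row(1)[OF k]]
        by (auto simp: gV gC adj_defs)
    qed
  next
    assume h: "d \<in> Us"
    have ii: "1 \<le> iu d" using iu_range[OF h] by simp
    have 1: "A d e \<longleftrightarrow> A e d" by (rule sym)
    show ?thesis
    proof (rule cls[OF e])
      assume "e = x" then show ?thesis using 1 Ax[OF d] h Ux ii by (auto simp: gx gU adj_defs)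
    next
      assume "e = y" then show ?thesis using 1 Ay[OF d] h Ux ii by (auto simp: gy gU adj_defs)
    next
      assume "e = z" then show ?thesis using 1 Az[OF d] h Ux disj ii by (auto simp: gz gU adj_defs)
    next
      assume k: "e \<in> Is" then show ?thesis using 1 Isadj[OF k d] h ii by (auto simp: gI gU adj_defs)
    next
      assume k: "e \<in> Vs" then show ?thesis using Auv[OF h k] h ii iv_range[OF k] by (auto simp: gV gU adj_defs)
    next
      assume k: "e \<in> Us" then show ?thesis using UU[OF h k] h ii by (auto simp: gU adj_defs)
    next
      assume k: "e \<in> Cs" then show ?thesis using 1 Acu[OF k h] h ii iu_inj[OF h row(1)[OF k]]
        by (auto simp: gU gC adj_defs)
    qed
  next
    assume h: "d \<in> Cs"
    have ii: "1 \<le> iu (row d)" using iu_range[OF row(1)[OF h]] by simp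
    have 1: "A d e \<longleftrightarrow> A e d" by (rule sym)
    show ?thesis
    proof (rule cls[OF e])
      assume "e = x" then show ?thesis using 1 Ax[OF d] h Cx ii by (auto simp: gx gC adj_defs)
    next
      assume "e = y" then show ?thesis using 1 Ay[OF d] h Cx ii by (auto simp: gy gC adj_defs)
    next
      assume "e = z" then show ?thesis using 1 Az[OF d] h Cx disj ii by (auto simp: gz gC adj_defs)
    next
      assume k: "e \<in> Is" then show ?thesis using 1 Isadj[OF k d] h ii by (auto simp: gI gC adj_defs)
    next
      assume k: "e \<in> Vs" then show ?thesis using CV[OF h k] h ii iv_range[OF k] by (auto simp: gV gC adj_defs)
    next
      assume k: "e \<in> Us" then show ?thesis using Acu[OF h k] h ii iu_inj[OF k row(1)[OF h]]
        by (auto simp: gU gC adj_defs)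
    next
      assume k: "e \<in> Cs"
      \<comment> \<open>Cells with the same row and the same offset coincide, so distinct cells with
        equal offsets lie in different rows, as \<open>half_adj\<close> demands.\<close>
      have "iu (row d) = iu (row e) \<longleftrightarrow> row d = row e" using iu_inj row h k by simp
      then show ?thesis using cc[OF h k] \<kappa>_inj[OF h k] ii iu_range[OF row(1)[OF k]] h k
        by (cases "iu (row d) < iu (row e)"; cases "iu (row d) = iu (row e)")
           (auto simp: gC adj_defs)
    qed
  qed
  \<comment> \<open>The vertex \<open>v_k\<close> with k the row of u is joined to u and to no u' of
    a later row.\<close>
  have ord: "iu u < iu u' \<longleftrightarrow> (\<exists>v\<in>Vs. A u v \<and> \<not> A u' v)" if uu: "u \<in> Us" "u' \<in> Us" for u u'
  proof
    assume lt: "iu u < iu u'"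
    have "iu u \<in> iv ` Vs" using iv iu_range[OF uu(1)] by (simp add: bij_betw_def)
    then obtain v where v: "v \<in> Vs" "iv v = iu u" by auto
    then show "\<exists>v\<in>Vs. A u v \<and> \<not> A u' v" using Auv uu lt by (intro bexI[of _ v]) auto
  next
    assume "\<exists>v\<in>Vs. A u v \<and> \<not> A u' v"
    then show "iu u < iu u'" using Auv uu by auto
  qed
  show ?thesis
  proof (rule that[OF iu a1 ord _ _ wu])
    show "isom g D A (row_graph w) (spine_adj f)" using inj im adj by (simp add: isom_def bij_betw_def)
    show "w 0 = 3 + card {d \<in> D. isolated D A d}" by (simp add: w_def Is_def)
    show "\<And>i. a < i \<Longrightarrow> w i = 0" by (simp add: w_def)
  qed
qed

section \<open>Axiomatizing spines\<close>

text \<open>The variables 0, 1, 2 denote the path that marks row 0, and 9 is bound in the formulas below.\<close>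

definition fol_v :: "nat \<Rightarrow> fol" where
  "fol_v k = Conj (Adj k 2) (Neg (Eq k 1))"

definition fol_u :: "nat \<Rightarrow> fol" where
  "fol_u k = Conj (Neg (Adj k 2)) (Conj (Neg (Eq k 2)) (Exi 9 (Conj (fol_v 9) (Adj k 9))))"

definition fol_cell :: "nat \<Rightarrow> fol" where
  "fol_cell k = Conj (Neg (Adj k 2)) (Conj (Neg (Eq k 2)) (Conj (Neg (Eq k 0))
     (Conj (Neg (Exi 9 (Conj (fol_v 9) (Adj k 9)))) (Exi 9 (Adj k 9)))))"

definition fol_isolated :: "nat \<Rightarrow> fol" where
  "fol_isolated k = Neg (Exi 9 (Adj k 9))"

definition fol_markers :: fol where
  "fol_markers = Conj (Neg (Eq 0 2)) (Conj (Forall 3 (Iff (Adj 0 3) (Eq 3 1)))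
     (Forall 3 (Iff (Adj 1 3) (Or (Eq 3 0) (Eq 3 2)))))"

definition fol_base :: fol where
  "fol_base = Conj fol_markers (Conj
     (Forall 3 (Forall 4 (Imp (Conj (fol_v 3) (fol_v 4)) (Neg (Adj 3 4))))) (Conj
     (Forall 3 (Forall 4 (Imp (Conj (fol_u 3) (fol_u 4)) (Neg (Adj 3 4))))) (Conj
     (Forall 3 (Forall 4 (Forall 5 (Forall 6 (Imp (Conj (fol_u 3) (Conj (fol_u 4) (Conj (fol_v 5) (Conj (fol_v 6)
        (Conj (Adj 3 5) (Adj 4 6)))))) (Or (Adj 3 6) (Adj 4 5))))))) (Conj
     (Forall 3 (Forall 4 (Imp (Conj (fol_v 3) (Conj (fol_v 4) (Neg (Eq 3 4))))
        (Exi 5 (Conj (fol_u 5) (Neg (Iff (Adj 5 3) (Adj 5 4)))))))) (Conj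
     (Forall 3 (Forall 4 (Imp (Conj (fol_u 3) (Conj (fol_u 4) (Neg (Eq 3 4))))
        (Exi 5 (Conj (fol_v 5) (Neg (Iff (Adj 3 5) (Adj 4 5)))))))) (Conj
     (Forall 3 (Imp (fol_v 3) (Exi 4 (Conj (fol_u 4) (Adj 4 3))))) (Conj
     (Exi 3 (fol_u 3))
     (Forall 3 (Imp (fol_cell 3) (Exi 4 (Conj (fol_u 4) (Conj (Adj 3 4)
        (Forall 5 (Imp (Conj (fol_u 5) (Adj 3 5)) (Eq 5 4)))))))))))))))"

lemma gsat_fol_v: "gsat D A \<sigma> (fol_v k) \<longleftrightarrow> side_v A (\<sigma> 1) (\<sigma> 2) (\<sigma> k)"
  by (simp add: fol_v_def side_v_def)

lemma gsat_fol_u: "k \<noteq> 9 \<Longrightarrow> gsat D A \<sigma> (fol_u k) \<longleftrightarrow> side_u D A (\<sigma> 1) (\<sigma> 2) (\<sigma> k)"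
  by (simp add: fol_u_def side_u_def gsat_fol_v)

lemma gsat_fol_cell: "k \<noteq> 9 \<Longrightarrow> gsat D A \<sigma> (fol_cell k) \<longleftrightarrow> cell D A (\<sigma> 0) (\<sigma> 1) (\<sigma> 2) (\<sigma> k)"
  by (simp add: fol_cell_def cell_def gsat_fol_v)

lemma gsat_fol_isolated: "k \<noteq> 9 \<Longrightarrow> gsat D A \<sigma> (fol_isolated k) \<longleftrightarrow> isolated D A (\<sigma> k)"
  by (simp add: fol_isolated_def isolated_def)

lemma gsat_fol_markers:
  "\<sigma> 0 \<in> D \<Longrightarrow> \<sigma> 1 \<in> D \<Longrightarrow> \<sigma> 2 \<in> D \<Longrightarrow>
     gsat D A \<sigma> fol_markers \<longleftrightarrow> markers D A (\<sigma> 0) (\<sigma> 1) (\<sigma> 2)"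
  by (simp add: fol_markers_def markers_def)

lemma gsat_fol_base:
  "\<sigma> 0 \<in> D \<Longrightarrow> \<sigma> 1 \<in> D \<Longrightarrow> \<sigma> 2 \<in> D \<Longrightarrow>
     gsat D A \<sigma> fol_base \<longleftrightarrow> spine_base D A (\<sigma> 0) (\<sigma> 1) (\<sigma> 2)"
  by (simp add: fol_base_def spine_base_def gsat_fol_v gsat_fol_u gsat_fol_cell gsat_fol_markers)

lemma free_vars_spine_formulas:
  "free_vars (fol_v k) = {1, 2, k}" "k \<noteq> 9 \<Longrightarrow> free_vars (fol_u k) = {1, 2, k}"
  "k \<noteq> 9 \<Longrightarrow> free_vars (fol_cell k) = {0, 1, 2, k}" "k \<noteq> 9 \<Longrightarrow> free_vars (fol_isolated k) = {k}"
  "free_vars fol_markers = {0, 1, 2}" "free_vars fol_base = {0, 1, 2}"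
proof -
  show v: "free_vars (fol_v k) = {1, 2, k}" for k by (auto simp: fol_v_def)
  show u: "k \<noteq> 9 \<Longrightarrow> free_vars (fol_u k) = {1, 2, k}" for k by (auto simp: fol_u_def v)
  show c: "k \<noteq> 9 \<Longrightarrow> free_vars (fol_cell k) = {0, 1, 2, k}" for k by (auto simp: fol_cell_def v)
  show "k \<noteq> 9 \<Longrightarrow> free_vars (fol_isolated k) = {k}" by (auto simp: fol_isolated_def)
  show m: "free_vars fol_markers = {0, 1, 2}" by (auto simp: fol_markers_def)
  show "free_vars fol_base = {0, 1, 2}" by (auto simp: fol_base_def v u c m)
qed

text \<open>In a spine exactly one triple satisfies \<open>fol_markers\<close>, so these quantifiers
  act like three constants.\<close>

definition marked :: "fol \<Rightarrow> fol" where
  "marked \<phi> = Exi 0 (Exi 1 (Exi 2 (Conj fol_markers \<phi>)))"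

lemma sentence_marked: "free_vars \<phi> \<subseteq> {0, 1, 2} \<Longrightarrow> sentence (marked \<phi>)"
  by (auto simp: marked_def sentence_def free_vars_spine_formulas)

lemma gsat_marked:
  assumes "\<And>\<tau>. \<tau> 0 \<in> D \<Longrightarrow> \<tau> 1 \<in> D \<Longrightarrow> \<tau> 2 \<in> D \<Longrightarrow> gsat D A \<tau> \<phi> \<longleftrightarrow> Q (\<tau> 0) (\<tau> 1) (\<tau> 2)"
  shows "gsat D A \<sigma> (marked \<phi>) \<longleftrightarrow> (\<exists>x y z. markers D A x y z \<and> Q x y z)"
proof -
  have "gsat D A (\<sigma>(0 := x, 1 := y, 2 := z)) (Conj fol_markers \<phi>) \<longleftrightarrow> markers D A x y z \<and> Q x y z"
    if "x \<in> D" "y \<in> D" "z \<in> D" for x y z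
    using that by (simp add: gsat_fol_markers assms)
  moreover have "markers D A x y z \<Longrightarrow> x \<in> D \<and> y \<in> D \<and> z \<in> D" for x y z by (simp add: markers_def)
  ultimately show ?thesis unfolding marked_def gsat.simps(5) by blast
qed

definition fol_cells_of :: "nat \<Rightarrow> nat \<Rightarrow> fol" where
  "fol_cells_of j k = Conj (fol_cell k) (Adj k j)"

definition num_cells :: "'a set \<Rightarrow> ('a \<Rightarrow> 'a \<Rightarrow> bool) \<Rightarrow> 'a \<Rightarrow> 'a \<Rightarrow> 'a \<Rightarrow> 'a \<Rightarrow> nat" where
  "num_cells D A x y z u = card {c \<in> D. cell D A x y z c \<and> A c u}"

text \<open>The bound j < 9 protects the parameter from capture: 9 is bound inside
  \<open>fol_cell\<close>, and the counting quantifier binds from 10 on.\<close>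

lemma gsat_cells_of:
  assumes "finite D" "j < 9"
  shows "gsat D A \<sigma> (at_least (fol_cells_of j) m 10) \<longleftrightarrow> m \<le> num_cells D A (\<sigma> 0) (\<sigma> 1) (\<sigma> 2) (\<sigma> j)"
    and "gsat D A \<sigma> (exactly (fol_cells_of j) m) \<longleftrightarrow> num_cells D A (\<sigma> 0) (\<sigma> 1) (\<sigma> 2) (\<sigma> j) = m"
proof -
  have *: "gsat D A \<tau> (fol_cells_of j k) \<longleftrightarrow> cell D A (\<sigma> 0) (\<sigma> 1) (\<sigma> 2) (\<tau> k) \<and> A (\<tau> k) (\<sigma> j)"
    if "k \<ge> 10" "\<And>i. i < 10 \<Longrightarrow> \<tau> i = \<sigma> i" for \<tau> k
    using that assms(2) by (simp add: fol_cells_of_def gsat_fol_cell)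
  show "gsat D A \<sigma> (at_least (fol_cells_of j) m 10) \<longleftrightarrow> m \<le> num_cells D A (\<sigma> 0) (\<sigma> 1) (\<sigma> 2) (\<sigma> j)"
    unfolding num_cells_def by (rule gsat_at_least[OF assms(1) *])
  show "gsat D A \<sigma> (exactly (fol_cells_of j) m) \<longleftrightarrow> num_cells D A (\<sigma> 0) (\<sigma> 1) (\<sigma> 2) (\<sigma> j) = m"
    unfolding num_cells_def by (rule gsat_exactly[OF assms(1) *])
qed

lemma free_vars_cells_of:
  assumes "j < 9"
  shows "free_vars (at_least (fol_cells_of j) m 10) \<subseteq> {0, 1, 2, j}"
    "free_vars (exactly (fol_cells_of j) m) \<subseteq> {0, 1, 2, j}"
proof -
  have *: "free_vars (fol_cells_of j k) \<subseteq> insert k {0, 1, 2, j}" if "k \<ge> 10" for k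
    using that by (auto simp: fol_cells_of_def free_vars_spine_formulas)
  show "free_vars (at_least (fol_cells_of j) m 10) \<subseteq> {0, 1, 2, j}"
    using free_vars_at_least[where k = 10, OF *, of m] by simp
  show "free_vars (exactly (fol_cells_of j) m) \<subseteq> {0, 1, 2, j}"
    by (rule free_vars_exactly[OF *])
qed

definition fol_isolated_eq :: "nat \<Rightarrow> fol" where
  "fol_isolated_eq r = exactly fol_isolated r"

definition fol_isolated_less :: "nat \<Rightarrow> fol" where
  "fol_isolated_less r = Neg (at_least fol_isolated r 10)"

lemma sentence_isolated: "sentence (fol_isolated_eq r)" "sentence (fol_isolated_less r)"
proof -
  have *: "free_vars (fol_isolated k) \<subseteq> insert k {}" if "k \<ge> 10" for k
    using that by (simp add: free_vars_spine_formulas)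
  show "sentence (fol_isolated_eq r)"
    using free_vars_exactly[OF *, of r] by (simp add: sentence_def fol_isolated_eq_def)
  show "sentence (fol_isolated_less r)"
    using free_vars_at_least[where k = 10, OF *, of r] by (simp add: sentence_def fol_isolated_less_def)
qed

lemma gsat_isolated:
  assumes "finite D"
  shows "gsat D A \<sigma> (fol_isolated_eq r) \<longleftrightarrow> card {d \<in> D. isolated D A d} = r"
    and "gsat D A \<sigma> (fol_isolated_less r) \<longleftrightarrow> card {d \<in> D. isolated D A d} < r"
proof -
  have *: "gsat D A \<tau> (fol_isolated k) \<longleftrightarrow> isolated D A (\<tau> k)"
    if "k \<ge> 10" "\<And>i. i < 10 \<Longrightarrow> \<tau> i = \<sigma> i" for \<tau> k
    using that by (simp add: gsat_fol_isolated)
  show "gsat D A \<sigma> (fol_isolated_eq r) \<longleftrightarrow> card {d \<in> D. isolated D A d} = r"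
    unfolding fol_isolated_eq_def by (rule gsat_exactly[OF assms *])
  show "gsat D A \<sigma> (fol_isolated_less r) \<longleftrightarrow> card {d \<in> D. isolated D A d} < r"
    unfolding fol_isolated_less_def using gsat_at_least[OF assms *] by (simp del: at_least.simps add: not_le)
qed

text \<open>Disjunction with this sentence provides models on few vertices; it does not affect limits.\<close>

definition fol_small :: "nat \<Rightarrow> fol" where
  "fol_small m = Neg (at_least (\<lambda>_. Tru) m 10)"

lemma sentence_small: "sentence (fol_small m)"
  using free_vars_at_least[of "\<lambda>_. Tru" "{}" 10 m] by (simp add: sentence_def fol_small_def)

lemma gsat_small: "finite D \<Longrightarrow> gsat D A \<sigma> (fol_small m) \<longleftrightarrow> card D < m"
  unfolding fol_small_def using gsat_at_least[of D \<sigma> A "\<lambda>_. Tru" "\<lambda>_. True" m]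
  by (simp add: not_le)

section \<open>Axioms and test sentences for the two families\<close>

text \<open>In the fourth conjunct the vertex v witnesses that the row of u precedes that of u', so
  the numbers of cells, which are at most 2, decrease along the rows. The last conjunct says that q
  is positive.\<close>

definition layered :: "'a set \<Rightarrow> ('a \<Rightarrow> 'a \<Rightarrow> bool) \<Rightarrow> 'a \<Rightarrow> 'a \<Rightarrow> 'a \<Rightarrow> bool" where
  "layered D A x y z \<longleftrightarrow>
     (\<forall>c\<in>D. \<forall>c'\<in>D. cell D A x y z c \<and> cell D A x y z c' \<longrightarrow> \<not> A c c') \<and>
     (\<forall>d\<in>D. \<not> isolated D A d) \<and>
     (\<forall>u\<in>D. side_u D A y z u \<longrightarrow> \<not> 3 \<le> num_cells D A x y z u) \<and>
     (\<forall>u\<in>D. \<forall>u'\<in>D. side_u D A y z u \<and> side_u D A y z u' \<and> (\<exists>v\<in>D. side_v A y z v \<and> A u v \<and> \<not> A u' v) \<longrightarrow>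
        (1 \<le> num_cells D A x y z u' \<longrightarrow> 1 \<le> num_cells D A x y z u) \<and>
        (2 \<le> num_cells D A x y z u' \<longrightarrow> 2 \<le> num_cells D A x y z u)) \<and>
     (\<exists>u\<in>D. side_u D A y z u \<and> \<not> 1 \<le> num_cells D A x y z u)"

definition fol_layered :: fol where
  "fol_layered =
     Conj (Forall 3 (Forall 4 (Imp (Conj (fol_cell 3) (fol_cell 4)) (Neg (Adj 3 4))))) (Conj
     (Forall 3 (Neg (fol_isolated 3))) (Conj
     (Forall 3 (Imp (fol_u 3) (Neg (at_least (fol_cells_of 3) 3 10)))) (Conj
     (Forall 3 (Forall 4 (Imp (Conj (fol_u 3) (Conj (fol_u 4)
          (Exi 5 (Conj (fol_v 5) (Conj (Adj 3 5) (Neg (Adj 4 5)))))))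
        (Conj (Imp (at_least (fol_cells_of 4) 1 10) (at_least (fol_cells_of 3) 1 10))
          (Imp (at_least (fol_cells_of 4) 2 10) (at_least (fol_cells_of 3) 2 10))))))
     (Exi 3 (Conj (fol_u 3) (Neg (at_least (fol_cells_of 3) 1 10)))))))"

lemma gsat_fol_layered:
  "finite D \<Longrightarrow> gsat D A \<sigma> fol_layered \<longleftrightarrow> layered D A (\<sigma> 0) (\<sigma> 1) (\<sigma> 2)"
  unfolding fol_layered_def layered_def
  by (simp add: gsat_fol_v gsat_fol_u gsat_fol_cell gsat_fol_isolated gsat_cells_of del: at_least.simps One_nat_def)

lemma free_vars_fol_layered: "free_vars fol_layered \<subseteq> {0, 1, 2}"
proof -
  have "free_vars (at_least (fol_cells_of j) m 10) - {j} \<subseteq> {0, 1, 2}" if "j < 9" for m j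
    using free_vars_cells_of(1)[OF that, of m] by auto
  from this[of 3 1] this[of 3 2] this[of 3 3] this[of 4 1] this[of 4 2] show ?thesis
    unfolding fol_layered_def
    by (simp add: free_vars_spine_formulas del: at_least.simps One_nat_def) blast
qed

text \<open>Equality or adjacency is an equivalence relation on the cells (symmetry comes from the
  graph), and each of its classes meets every row exactly once.\<close>

definition columns :: "'a set \<Rightarrow> ('a \<Rightarrow> 'a \<Rightarrow> bool) \<Rightarrow> 'a \<Rightarrow> 'a \<Rightarrow> 'a \<Rightarrow> bool" where
  "columns D A x y z \<longleftrightarrow>
     (\<forall>c\<in>D. \<forall>c'\<in>D. \<forall>c''\<in>D. cell D A x y z c \<and> cell D A x y z c' \<and> cell D A x y z c'' \<and>
        A c c' \<and> A c' c'' \<longrightarrow> c = c'' \<or> A c c'') \<and>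
     (\<forall>c\<in>D. \<forall>u\<in>D. cell D A x y z c \<and> side_u D A y z u \<longrightarrow>
        (\<exists>c'\<in>D. (cell D A x y z c' \<and> (c' = c \<or> A c' c) \<and> A c' u) \<and>
          (\<forall>c''\<in>D. cell D A x y z c'' \<and> (c'' = c \<or> A c'' c) \<and> A c'' u \<longrightarrow> c'' = c')))"

definition fol_columns :: fol where
  "fol_columns =
     Conj (Forall 3 (Forall 4 (Forall 5 (Imp (Conj (fol_cell 3) (Conj (fol_cell 4) (Conj (fol_cell 5)
        (Conj (Adj 3 4) (Adj 4 5))))) (Or (Eq 3 5) (Adj 3 5))))))
     (Forall 3 (Forall 4 (Imp (Conj (fol_cell 3) (fol_u 4))
        (Exi 5 (Conj (Conj (fol_cell 5) (Conj (Or (Eq 5 3) (Adj 5 3)) (Adj 5 4)))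
          (Forall 6 (Imp (Conj (fol_cell 6) (Conj (Or (Eq 6 3) (Adj 6 3)) (Adj 6 4))) (Eq 6 5))))))))"

lemma gsat_fol_columns:
  "gsat D A \<sigma> fol_columns \<longleftrightarrow> columns D A (\<sigma> 0) (\<sigma> 1) (\<sigma> 2)"
  unfolding fol_columns_def columns_def
  by (simp add: gsat_fol_u gsat_fol_cell)

lemma free_vars_fol_columns: "free_vars fol_columns \<subseteq> {0, 1, 2}"
  unfolding fol_columns_def by (auto simp: free_vars_spine_formulas)

text \<open>One row suffices, as all rows of a grid have the same number of cells.\<close>

definition fol_num_columns :: "nat \<Rightarrow> fol" where
  "fol_num_columns b = marked (Exi 3 (Conj (fol_u 3) (exactly (fol_cells_of 3) b)))"

text \<open>At least two cells at j; in a layered spine this holds precisely for the first k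
  rows.\<close>

definition fol_double :: "nat \<Rightarrow> fol" where
  "fol_double j = Conj (fol_u j) (Exi 3 (Exi 4 (Conj (Conj (fol_cell 3) (fol_cell 4))
     (Conj (Neg (Eq 3 4)) (Conj (Adj 3 j) (Adj 4 j))))))"

definition fol_num_doubles :: "nat \<Rightarrow> fol" where
  "fol_num_doubles k = marked (exactly fol_double k)"

lemma sentence_num_columns: "sentence (fol_num_columns b)"
  unfolding fol_num_columns_def
  by (rule sentence_marked) (use free_vars_cells_of(2)[of 3 b] in \<open>auto simp: free_vars_spine_formulas\<close>)

lemma sentence_num_doubles: "sentence (fol_num_doubles k)"
  unfolding fol_num_doubles_def
proof (rule sentence_marked, rule free_vars_exactly)
  show "free_vars (fol_double j) \<subseteq> insert j {0, 1, 2}" if "j \<ge> 10" for j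
    using that by (auto simp: fol_double_def free_vars_spine_formulas)
qed

lemma valid_in_num_columns:
  assumes "finite D"
  shows "valid_in D A (fol_num_columns b) \<longleftrightarrow>
    (\<exists>x y z. markers D A x y z \<and> (\<exists>u\<in>D. side_u D A y z u \<and> num_cells D A x y z u = b))"
  unfolding valid_in_sentence[OF sentence_num_columns, where \<sigma> = undefined]
  unfolding fol_num_columns_def
  by (rule gsat_marked) (simp add: gsat_fol_u gsat_cells_of[OF assms])

lemma valid_in_num_doubles:
  assumes "finite D"
  shows "valid_in D A (fol_num_doubles k) \<longleftrightarrow>
    (\<exists>x y z. markers D A x y z \<and> card {u \<in> D. side_u D A y z u \<and>
       (\<exists>c\<in>D. \<exists>c'\<in>D. (cell D A x y z c \<and> cell D A x y z c') \<and> c \<noteq> c' \<and> A c u \<and> A c' u)} = k)"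
  unfolding valid_in_sentence[OF sentence_num_doubles, where \<sigma> = undefined]
  unfolding fol_num_doubles_def
proof (rule gsat_marked)
  fix \<tau> :: "nat \<Rightarrow> 'a"
  show "gsat D A \<tau> (exactly fol_double k) \<longleftrightarrow> card {u \<in> D. side_u D A (\<tau> 1) (\<tau> 2) u \<and>
       (\<exists>c\<in>D. \<exists>c'\<in>D. (cell D A (\<tau> 0) (\<tau> 1) (\<tau> 2) c \<and> cell D A (\<tau> 0) (\<tau> 1) (\<tau> 2) c') \<and>
          c \<noteq> c' \<and> A c u \<and> A c' u)} = k"
  proof (rule gsat_exactly[OF assms])
    fix \<rho> j assume j: "j \<ge> (10::nat)" and "\<And>i. i < (10::nat) \<Longrightarrow> \<rho> i = \<tau> i"
    then have "\<rho> 0 = \<tau> 0" "\<rho> 1 = \<tau> 1" "\<rho> 2 = \<tau> 2" by simp_all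
    with j show "gsat D A \<rho> (fol_double j) \<longleftrightarrow> side_u D A (\<tau> 1) (\<tau> 2) (\<rho> j) \<and>
       (\<exists>c\<in>D. \<exists>c'\<in>D. (cell D A (\<tau> 0) (\<tau> 1) (\<tau> 2) c \<and> cell D A (\<tau> 0) (\<tau> 1) (\<tau> 2) c') \<and>
          c \<noteq> c' \<and> A c (\<rho> j) \<and> A c' (\<rho> j))"
      by (simp add: fol_double_def gsat_fol_u gsat_fol_cell)
  qed
qed

definition fol_spine_layered :: fol where
  "fol_spine_layered = marked (Conj fol_base fol_layered)"

definition fol_spine_columns :: fol where
  "fol_spine_columns = marked (Conj fol_base fol_columns)"

lemma sentence_spine: "sentence fol_spine_layered" "sentence fol_spine_columns"
  unfolding fol_spine_layered_def fol_spine_columns_def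
  using free_vars_fol_layered free_vars_fol_columns
  by (auto intro!: sentence_marked simp: free_vars_spine_formulas)

lemma valid_in_spine:
  assumes "finite D"
  shows "valid_in D A fol_spine_layered \<longleftrightarrow> (\<exists>x y z. spine_base D A x y z \<and> layered D A x y z)"
    "valid_in D A fol_spine_columns \<longleftrightarrow> (\<exists>x y z. spine_base D A x y z \<and> columns D A x y z)"
proof -
  have m: "spine_base D A x y z \<Longrightarrow> markers D A x y z" for x y z by (simp add: spine_base_def)
  have "gsat D A undefined fol_spine_layered \<longleftrightarrow>
      (\<exists>x y z. markers D A x y z \<and> (spine_base D A x y z \<and> layered D A x y z))"
    unfolding fol_spine_layered_def
    by (rule gsat_marked) (simp add: gsat_fol_base gsat_fol_layered[OF assms])
  then show "valid_in D A fol_spine_layered \<longleftrightarrow> (\<exists>x y z. spine_base D A x y z \<and> layered D A x y z)"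
    unfolding valid_in_sentence[OF sentence_spine(1), where \<sigma> = undefined] using m by blast
  have "gsat D A undefined fol_spine_columns \<longleftrightarrow>
      (\<exists>x y z. markers D A x y z \<and> (spine_base D A x y z \<and> columns D A x y z))"
    unfolding fol_spine_columns_def
    by (rule gsat_marked) (simp add: gsat_fol_base gsat_fol_columns)
  then show "valid_in D A fol_spine_columns \<longleftrightarrow> (\<exists>x y z. spine_base D A x y z \<and> columns D A x y z)"
    unfolding valid_in_sentence[OF sentence_spine(2), where \<sigma> = undefined] using m by blast
qed

lemma spine_adj_simps:
  assumes "1 \<le> i" "1 \<le> k"
  shows "spine_adj f (i, 0) (k, Suc 0) \<longleftrightarrow> i \<le> k" "spine_adj f (k, Suc 0) (i, 0) \<longleftrightarrow> i \<le> k"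
    "\<not> spine_adj f (i, Suc 0) (k, Suc 0)" "\<not> spine_adj f (i, 0) (k, 0)"
    "2 \<le> j \<Longrightarrow> spine_adj f (i, j) (k, 0) \<longleftrightarrow> i = k"
    "2 \<le> j \<Longrightarrow> 2 \<le> l \<Longrightarrow> spine_adj f (i, j) (k, l) \<longleftrightarrow> f \<and> j = l \<and> i \<noteq> k"
  using assms by (auto simp: adj_defs)

section \<open>Spines satisfy the axioms\<close>

context spine
begin

lemma side_u_V: "u \<in> V \<Longrightarrow> SU u \<longleftrightarrow> (\<exists>i. 1 \<le> i \<and> i \<le> a \<and> u = (i, 0))"
  using wpos by (cases u) (auto simp: side_u_iff mem_iff)

lemma side_v_V: "u \<in> V \<Longrightarrow> SV u \<longleftrightarrow> (\<exists>i. 1 \<le> i \<and> i \<le> a \<and> u = (i, Suc 0))"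
  using wpos by (cases u) (auto simp: spine_side_v_iff mem_iff)

lemma cell_V: "u \<in> V \<Longrightarrow> SC u \<longleftrightarrow>
    (\<exists>i j. 1 \<le> i \<and> i \<le> a \<and> 2 \<le> j \<and> j < w i \<and> u = (i, j))"
  using wpos by (cases u) (auto simp: cell_iff mem_iff)

lemma ex_markers_iff: "(\<exists>x y z. markers V R x y z \<and> P x y z) \<longleftrightarrow> P (0, 0) (0, Suc 0) (0, 2)"
proof
  assume "\<exists>x y z. markers V R x y z \<and> P x y z"
  then obtain x y z where m: "markers V R x y z" and P: "P x y z" by blast
  have "x = (0, 0)" "y = (0, Suc 0)" "z = (0, 2)" using markers_unique[OF m] by simp_all
  with P show "P (0, 0) (0, Suc 0) (0, 2)" by simp
next
  assume "P (0, 0) (0, Suc 0) (0, 2)"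
  with markers_V show "\<exists>x y z. markers V R x y z \<and> P x y z" by blast
qed

lemma spine_base_V: "spine_base V R (0, 0) (0, Suc 0) (0, 2)"
  unfolding spine_base_def
proof (intro conjI)
  show "markers V R (0, 0) (0, Suc 0) (0, 2)" by (rule markers_V)
  show "\<forall>v\<in>V. \<forall>v'\<in>V. SV v \<and> SV v' \<longrightarrow> \<not> R v v'"
    by (auto simp: side_v_V spine_adj_simps)
  show "\<forall>u\<in>V. \<forall>u'\<in>V. SU u \<and> SU u' \<longrightarrow> \<not> R u u'"
    by (auto simp: side_u_V spine_adj_simps)
  show "\<forall>u\<in>V. \<forall>u'\<in>V. \<forall>v\<in>V. \<forall>v'\<in>V. SU u \<and> SU u' \<and>
      SV v \<and> SV v' \<and> R u v \<and> R u' v' \<longrightarrow> R u v' \<or> R u' v"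
    by (auto simp: side_u_V side_v_V spine_adj_simps)
  show "\<forall>v\<in>V. \<forall>v'\<in>V. SV v \<and> SV v' \<and> v \<noteq> v' \<longrightarrow>
      (\<exists>u\<in>V. SU u \<and> \<not> (R u v \<longleftrightarrow> R u v'))"
  proof (intro ballI impI, elim conjE)
    fix v v' assume v: "v \<in> V" "v' \<in> V" "SV v" "SV v'" "v \<noteq> v'"
    then obtain i i' where i: "v = (i, Suc 0)" "v' = (i', Suc 0)" "1 \<le> i" "i \<le> a" "1 \<le> i'" "i' \<le> a" "i \<noteq> i'"
      by (auto simp: side_v_V)
    \<comment> \<open>The vertex \<open>u_m\<close> with the larger index is joined to the later of
      the two v vertices only.\<close>
    define m where "m = max i i'"
    have m: "1 \<le> m" "m \<le> a" using i by (auto simp: m_def)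
    then have "(m, 0) \<in> V" "SU (m, 0)"
      using mem_special(4) by (auto simp: side_u_V)
    moreover have "\<not> (R (m, 0) v \<longleftrightarrow> R (m, 0) v')" using i m by (auto simp: spine_adj_simps m_def)
    ultimately show "\<exists>u\<in>V. SU u \<and> \<not> (R u v \<longleftrightarrow> R u v')" by blast
  qed
  show "\<forall>u\<in>V. \<forall>u'\<in>V. SU u \<and> SU u' \<and> u \<noteq> u' \<longrightarrow>
      (\<exists>v\<in>V. SV v \<and> \<not> (R u v \<longleftrightarrow> R u' v))"
  proof (intro ballI impI, elim conjE)
    fix v v' assume v: "v \<in> V" "v' \<in> V" "SU v" "SU v'" "v \<noteq> v'"
    then obtain i i' where i: "v = (i, 0)" "v' = (i', 0)" "1 \<le> i" "i \<le> a" "1 \<le> i'" "i' \<le> a" "i \<noteq> i'"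
      by (auto simp: side_u_V)
    \<comment> \<open>Dually, \<open>v_m\<close> with the smaller index is joined to the earlier of
      the two u vertices only.\<close>
    define m where "m = min i i'"
    have m: "1 \<le> m" "m \<le> a" using i by (auto simp: m_def)
    then have "(m, Suc 0) \<in> V" "SV (m, Suc 0)"
      using mem_special(5) by (auto simp: side_v_V)
    moreover have "\<not> (R v (m, Suc 0) \<longleftrightarrow> R v' (m, Suc 0))" using i m by (auto simp: spine_adj_simps m_def)
    ultimately show "\<exists>u\<in>V. SV u \<and> \<not> (R v u \<longleftrightarrow> R v' u)" by blast
  qed
  show "\<forall>v\<in>V. SV v \<longrightarrow> (\<exists>u\<in>V. SU u \<and> R u v)"
  proof (intro ballI impI)
    fix v assume "v \<in> V" "SV v"
    then obtain i where i: "v = (i, Suc 0)" "1 \<le> i" "i \<le> a" by (auto simp: side_v_V)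
    then show "\<exists>u\<in>V. SU u \<and> R u v"
      using mem_special(4) by (intro bexI[of _ "(i, 0)"]) (auto simp: side_u_V spine_adj_simps)
  qed
  show "\<exists>u\<in>V. SU u"
    using mem_special(4)[of a] a1 by (intro bexI[of _ "(a, 0)"]) (auto simp: side_u_V)
  show "\<forall>c\<in>V. SC c \<longrightarrow> (\<exists>u\<in>V. SU u \<and> R c u \<and>
      (\<forall>u'\<in>V. SU u' \<and> R c u' \<longrightarrow> u' = u))"
  proof (intro ballI impI)
    fix c assume "c \<in> V" "SC c"
    then obtain i j where i: "c = (i, j)" "1 \<le> i" "i \<le> a" "2 \<le> j" by (auto simp: cell_V)
    then show "\<exists>u\<in>V. SU u \<and> R c u \<and>
      (\<forall>u'\<in>V. SU u' \<and> R c u' \<longrightarrow> u' = u)"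
      using mem_special(4) by (intro bexI[of _ "(i, 0)"]) (auto simp: side_u_V spine_adj_simps)
  qed
qed

lemma num_cells_V:
  assumes "1 \<le> i" "i \<le> a"
  shows "num_cells V R (0, 0) (0, Suc 0) (0, 2) (i, 0) = w i - 2"
proof -
  have "{c \<in> V. SC c \<and> R c (i, 0)} = (\<lambda>j. (i, j)) ` {2..<w i}"
    using assms by (auto simp: cell_V spine_adj_simps mem_iff)
  then show ?thesis by (simp add: num_cells_def card_image inj_on_def)
qed

lemma num_isolated_V: "card {d \<in> V. isolated V R d} = w 0 - 3"
proof -
  have "{d \<in> V. isolated V R d} = (\<lambda>j. (0, j)) ` {3..<w 0}"
    by (auto simp: isolated_iff mem_iff)
  then show ?thesis by (simp add: card_image inj_on_def)
qed

end

section \<open>The two families of graphs\<close>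

text \<open>A width includes the two vertices of the half graph, so 4, 3, 2 stand for two, one and
  no leaves.\<close>

definition layer_widths :: "nat \<Rightarrow> nat \<Rightarrow> nat \<Rightarrow> nat \<Rightarrow> nat" where
  "layer_widths k p q i = (if i = 0 then 3 else if i \<le> k then 4 else if i \<le> k + p then 3 else
     if i \<le> k + p + q then 2 else 0)"

definition grid_widths :: "nat \<Rightarrow> nat \<Rightarrow> nat \<Rightarrow> nat \<Rightarrow> nat" where
  "grid_widths a b r i = (if i = 0 then 3 + r else if i \<le> a then 2 + b else 0)"

lemma row_graph_Sigma: "(\<And>i. m < i \<Longrightarrow> w i = 0) \<Longrightarrow> row_graph w = (SIGMA i:{..m}. {..<w i})"
  by (force simp: row_graph_def not_le[symmetric])

lemma card_row_graph: "(\<And>i. m < i \<Longrightarrow> w i = 0) \<Longrightarrow> card (row_graph w) = (\<Sum>i\<le>m. w i)"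
  by (subst row_graph_Sigma[of m]) auto

lemma card_layer: "card (row_graph (layer_widths k p q)) = 3 + 4 * k + 3 * p + 2 * q"
proof -
  have "card (row_graph (layer_widths k p q)) = (\<Sum>i\<le>k + p + q. layer_widths k p q i)"
    by (rule card_row_graph) (simp add: layer_widths_def)
  also have "{..k + p + q} = {0} \<union> {0<..k} \<union> {k<..k + p} \<union> {k + p<..k + p + q}" by auto
  also have "(\<Sum>i\<in>\<dots>. layer_widths k p q i) = (\<Sum>i\<in>{0}. layer_widths k p q i) + (\<Sum>i\<in>{0<..k}. layer_widths k p q i) +
      (\<Sum>i\<in>{k<..k + p}. layer_widths k p q i) + (\<Sum>i\<in>{k + p<..k + p + q}. layer_widths k p q i)"
    by (subst sum.union_disjoint; (subst sum.union_disjoint)?; (subst sum.union_disjoint)?) auto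
  also have "\<dots> = (\<Sum>i\<in>{0::nat}. 3) + (\<Sum>i\<in>{0<..k}. 4) + (\<Sum>i\<in>{k<..k + p}. 3) + (\<Sum>i\<in>{k + p<..k + p + q}. 2)"
    by (intro arg_cong2[where f = "(+)"] sum.cong) (auto simp: layer_widths_def)
  finally show ?thesis by simp
qed

lemma card_grid: "card (row_graph (grid_widths a b r)) = 3 + r + a * (b + 2)"
proof -
  have "card (row_graph (grid_widths a b r)) = (\<Sum>i\<le>a. grid_widths a b r i)"
    by (rule card_row_graph) (simp add: grid_widths_def)
  also have "{..a} = {0} \<union> {0<..a}" by auto
  also have "(\<Sum>i\<in>\<dots>. grid_widths a b r i) = (\<Sum>i\<in>{0}. grid_widths a b r i) + (\<Sum>i\<in>{0<..a}. grid_widths a b r i)"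
    by (rule sum.union_disjoint) auto
  also have "\<dots> = (\<Sum>i\<in>{0::nat}. 3 + r) + (\<Sum>i\<in>{0<..a}. 2 + b)"
    by (intro arg_cong2[where f = "(+)"] sum.cong) (auto simp: grid_widths_def)
  finally show ?thesis by simp
qed

lemma finite_layer: "finite (row_graph (layer_widths k p q))"
  and finite_grid: "finite (row_graph (grid_widths a b r))"
  by (subst row_graph_Sigma[of "k + p + q"]; simp add: layer_widths_def)
     (subst row_graph_Sigma[of a]; simp add: grid_widths_def)

lemma spine_widths_layer:
  assumes "1 \<le> q" "2 \<le> k + p + q"
  shows "spine_widths False (k + p + q) (layer_widths k p q)"
  using assms by (auto simp: spine_widths_def layer_widths_def)

lemma spine_widths_grid:
  assumes "1 \<le> a" "2 \<le> a \<or> 2 \<le> b"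
  shows "spine_widths True a (grid_widths a b r)"
  using assms by (auto simp: spine_widths_def grid_widths_def)

lemma layer_valid:
  assumes "1 \<le> q" "2 \<le> k + p + q"
  shows "valid_in (row_graph (layer_widths k p q)) (spine_adj False) fol_spine_layered"
proof -
  interpret spine False "k + p + q" "layer_widths k p q"
    by unfold_locales (rule spine_widths_layer[OF assms])
  have "layered V R (0, 0) (0, Suc 0) (0, 2)"
    unfolding layered_def
  proof (intro conjI)
    show "\<forall>c\<in>V. \<forall>c'\<in>V. SC c \<and> SC c' \<longrightarrow> \<not> R c c'"
      by (auto simp: cell_V spine_adj_simps)
    show "\<forall>d\<in>V. \<not> isolated V R d"
      by (auto simp: isolated_iff mem_iff layer_widths_def)
    show "\<forall>u\<in>V. SU u \<longrightarrow> \<not> 3 \<le> num_cells V R (0, 0) (0, Suc 0) (0, 2) u"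
      by (auto simp: side_u_V num_cells_V layer_widths_def split: if_splits)
    show "\<forall>u\<in>V. \<forall>u'\<in>V. SU u \<and> SU u' \<and>
        (\<exists>v\<in>V. SV v \<and> R u v \<and> \<not> R u' v) \<longrightarrow>
        (1 \<le> num_cells V R (0, 0) (0, Suc 0) (0, 2) u' \<longrightarrow> 1 \<le> num_cells V R (0, 0) (0, Suc 0) (0, 2) u) \<and>
        (2 \<le> num_cells V R (0, 0) (0, Suc 0) (0, 2) u' \<longrightarrow> 2 \<le> num_cells V R (0, 0) (0, Suc 0) (0, 2) u)"
    proof (intro ballI impI, elim conjE bexE)
      fix u u' v assume h: "u \<in> V" "u' \<in> V" "v \<in> V" "SU u" "SU u'"
        "SV v" "R u v" "\<not> R u' v"
      then obtain i i' m where i: "u = (i, 0)" "u' = (i', 0)" "v = (m, Suc 0)" "1 \<le> i" "i \<le> k + p + q"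
        "1 \<le> i'" "i' \<le> k + p + q" "1 \<le> m" by (auto simp: side_u_V side_v_V)
      then have "i < i'" using h by (auto simp: spine_adj_simps)
      then show "(1 \<le> num_cells V R (0, 0) (0, Suc 0) (0, 2) u' \<longrightarrow> 1 \<le> num_cells V R (0, 0) (0, Suc 0) (0, 2) u) \<and>
        (2 \<le> num_cells V R (0, 0) (0, Suc 0) (0, 2) u' \<longrightarrow> 2 \<le> num_cells V R (0, 0) (0, Suc 0) (0, 2) u)"
        using i by (auto simp: num_cells_V layer_widths_def)
    qed
    show "\<exists>u\<in>V. SU u \<and> \<not> 1 \<le> num_cells V R (0, 0) (0, Suc 0) (0, 2) u"
      using mem_special(4)[of "k + p + q"] assms
      by (intro bexI[of _ "(k + p + q, 0)"]) (auto simp: side_u_V num_cells_V layer_widths_def)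
  qed
  then show ?thesis using spine_base_V valid_in_spine(1)[OF finite_V] by blast
qed

lemma grid_valid:
  assumes "1 \<le> a" "2 \<le> a \<or> 2 \<le> b"
  shows "valid_in (row_graph (grid_widths a b r)) (spine_adj True) fol_spine_columns"
proof -
  interpret spine True a "grid_widths a b r"
    by unfold_locales (rule spine_widths_grid[OF assms])
  have "columns V R (0, 0) (0, Suc 0) (0, 2)"
    unfolding columns_def
  proof (intro conjI)
    show "\<forall>c\<in>V. \<forall>c'\<in>V. \<forall>c''\<in>V. SC c \<and> SC c' \<and>
       SC c'' \<and> R c c' \<and> R c' c'' \<longrightarrow> c = c'' \<or> R c c''"
      by (auto simp: cell_V spine_adj_simps)
    show "\<forall>c\<in>V. \<forall>u\<in>V. SC c \<and> SU u \<longrightarrow>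
        (\<exists>c'\<in>V. (SC c' \<and> (c' = c \<or> R c' c) \<and> R c' u) \<and>
          (\<forall>c''\<in>V. SC c'' \<and> (c'' = c \<or> R c'' c) \<and> R c'' u \<longrightarrow> c'' = c'))"
    proof (intro ballI impI, elim conjE)
      fix c u assume "c \<in> V" "u \<in> V" "SC c" "SU u"
      then obtain i j k where i: "c = (i, j)" "1 \<le> i" "i \<le> a" "2 \<le> j" "j < grid_widths a b r i"
        "u = (k, 0)" "1 \<le> k" "k \<le> a" by (auto simp: cell_V side_u_V)
      then have "(k, j) \<in> V" "SC (k, j)"
        by (auto simp: mem_iff cell_iff grid_widths_def)
      then show "\<exists>c'\<in>V. (SC c' \<and> (c' = c \<or> R c' c) \<and> R c' u) \<and>
          (\<forall>c''\<in>V. SC c'' \<and> (c'' = c \<or> R c'' c) \<and> R c'' u \<longrightarrow> c'' = c')"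
        using i by (intro bexI[of _ "(k, j)"]) (auto simp: cell_V spine_adj_simps)
    qed
  qed
  then show ?thesis using spine_base_V valid_in_spine(2)[OF finite_V] by blast
qed

lemma layer_num_doubles:
  assumes "1 \<le> q" "2 \<le> k + p + q"
  shows "valid_in (row_graph (layer_widths k p q)) (spine_adj False) (fol_num_doubles m) \<longleftrightarrow> m = k"
proof -
  interpret spine False "k + p + q" "layer_widths k p q"
    by unfold_locales (rule spine_widths_layer[OF assms])
  have "{u \<in> V. SU u \<and> (\<exists>c\<in>V. \<exists>c'\<in>V. (SC c \<and>
      SC c') \<and> c \<noteq> c' \<and> R c u \<and> R c' u)} = (\<lambda>i. (i, 0)) ` {1..k}" (is "?L = ?S")
  proof (intro subset_antisym subsetI)
    fix u assume "u \<in> ?L"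
    then obtain c c' where h: "u \<in> V" "SU u" "c \<in> V" "c' \<in> V"
      "SC c" "SC c'" "c \<noteq> c'" "R c u" "R c' u" by blast
    obtain i where i0: "u = (i, 0)" "1 \<le> i" using h(1,2) by (auto simp: side_u_V)
    obtain i1 j1 where i1: "c = (i1, j1)" "1 \<le> i1" "2 \<le> j1" "j1 < layer_widths k p q i1"
      using h(3,5) by (auto simp: cell_V)
    obtain i2 j2 where i2: "c' = (i2, j2)" "1 \<le> i2" "2 \<le> j2" "j2 < layer_widths k p q i2"
      using h(4,6) by (auto simp: cell_V)
    note i = i0 i1 i2
    have "i1 = i" "i2 = i" using h i by (auto simp: spine_adj_simps)
    then have "i \<le> k" using i h(7) by (auto simp: layer_widths_def split: if_splits)
    then show "u \<in> ?S" using i by auto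
  next
    fix u assume "u \<in> ?S"
    then obtain i where i: "u = (i, 0)" "1 \<le> i" "i \<le> k" by auto
    then have V: "u \<in> V" "(i, 2) \<in> V" "(i, 3) \<in> V" by (auto simp: mem_iff layer_widths_def)
    moreover have "SU u" using V i by (auto simp: side_u_V)
    moreover have "SC (i, 2)" "SC (i, 3)"
      using V i by (auto simp: cell_iff)
    moreover have "R (i, 2) u" "R (i, 3) u" using i by (auto simp: spine_adj_simps)
    ultimately show "u \<in> ?L"
      by (intro CollectI conjI bexI[of _ "(i, 2)"] bexI[of _ "(i, 3)"]) simp_all
  qed
  then have card: "card {u \<in> V. SU u \<and> (\<exists>c\<in>V. \<exists>c'\<in>V. (SC c \<and>
      SC c') \<and> c \<noteq> c' \<and> R c u \<and> R c' u)} = k"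
    by (simp add: card_image inj_on_def)
  show ?thesis
    unfolding valid_in_num_doubles[OF finite_V] ex_markers_iff card by auto
qed

lemma grid_num_columns:
  assumes "1 \<le> a" "2 \<le> a \<or> 2 \<le> b"
  shows "valid_in (row_graph (grid_widths a b r)) (spine_adj True) (fol_num_columns m) \<longleftrightarrow> m = b"
proof -
  interpret spine True a "grid_widths a b r"
    by unfold_locales (rule spine_widths_grid[OF assms])
  have "(\<exists>u\<in>V. SU u \<and> num_cells V R (0, 0) (0, Suc 0) (0, 2) u = m) \<longleftrightarrow> m = b"
  proof
    assume "\<exists>u\<in>V. SU u \<and> num_cells V R (0, 0) (0, Suc 0) (0, 2) u = m"
    then show "m = b" by (auto simp: side_u_V num_cells_V grid_widths_def)
  next
    assume "m = b"
    then show "\<exists>u\<in>V. SU u \<and> num_cells V R (0, 0) (0, Suc 0) (0, 2) u = m"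
      using mem_special(4)[of a] assms
      by (intro bexI[of _ "(a, 0)"]) (auto simp: side_u_V num_cells_V grid_widths_def)
  qed
  then show ?thesis
    unfolding valid_in_num_columns[OF finite_V] ex_markers_iff .
qed

lemma grid_num_isolated:
  assumes "1 \<le> a" "2 \<le> a \<or> 2 \<le> b"
  shows "valid_in (row_graph (grid_widths a b r)) (spine_adj True) (fol_isolated_eq m) \<longleftrightarrow> r = m"
    "valid_in (row_graph (grid_widths a b r)) (spine_adj True) (fol_isolated_less m) \<longleftrightarrow> r < m"
proof -
  interpret spine True a "grid_widths a b r"
    by unfold_locales (rule spine_widths_grid[OF assms])
  have "card {d \<in> V. isolated V R d} = r" by (simp add: num_isolated_V grid_widths_def)
  then show "valid_in V R (fol_isolated_eq m) \<longleftrightarrow> r = m" "valid_in V R (fol_isolated_less m) \<longleftrightarrow> r < m"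
    using sentence_isolated gsat_isolated[OF finite_V, of R]
    by (simp_all add: valid_in_sentence[where \<sigma> = undefined])
qed

section \<open>Models of the axioms are spines of the intended form\<close>

lemma spine_base_u:
  assumes "spine_base D A x y z"
  shows "\<exists>u\<in>D. side_u D A y z u"
  using assms[unfolded spine_base_def, THEN conjunct2, THEN conjunct2, THEN conjunct2, THEN conjunct2,
      THEN conjunct2, THEN conjunct2, THEN conjunct2, THEN conjunct1] .

lemma spine_base_cell:
  assumes "spine_base D A x y z" "c \<in> D" "cell D A x y z c"
  shows "\<exists>!u. u \<in> {u \<in> D. side_u D A y z u} \<and> A c u"
  using assms(1)[unfolded spine_base_def, THEN conjunct2, THEN conjunct2, THEN conjunct2, THEN conjunct2,
      THEN conjunct2, THEN conjunct2, THEN conjunct2, THEN conjunct2] assms(2,3) by blast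

lemma initial_segment:
  fixes S :: "nat set"
  assumes "S \<subseteq> {1..a}" "\<And>i i'. i \<in> S \<Longrightarrow> 1 \<le> i' \<Longrightarrow> i' \<le> i \<Longrightarrow> i' \<in> S"
  shows "S = {1..card S}"
proof (cases "S = {}")
  case False
  have fin: "finite S" using assms(1) by (rule finite_subset) simp
  have "S = {1..Max S}"
    using Max_ge[OF fin] Max_in[OF fin False] assms by (intro subset_antisym subsetI) fastforce+
  moreover from this have "card S = Max S" by (metis card_atLeastAtMost diff_Suc_1 One_nat_def add.commute plus_1_eq_Suc)
  ultimately show ?thesis by simp
qed simp

text \<open>The rows of width at least 4, respectively 3, form initial segments, whose lengths are k
  and k + p. The row of width 2 shows that the second segment does not exhaust all rows, hence q is
  positive.\<close>

lemma antitone_widths: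
  assumes "w 0 = 3" "\<And>i. i \<in> {1..a} \<Longrightarrow> 2 \<le> w i \<and> w i \<le> 4" "\<And>i. a < i \<Longrightarrow> w i = 0"
    and anti: "\<And>i i'. 1 \<le> i \<Longrightarrow> i < i' \<Longrightarrow> i' \<le> a \<Longrightarrow> w i' \<le> w i"
    and ex: "i0 \<in> {1..a}" "w i0 = 2"
  shows "\<exists>k p q. 1 \<le> q \<and> w = layer_widths k p q"
proof -
  define S where "S m = {i \<in> {1..a}. m \<le> w i}" for m :: nat
  have S: "S m = {1..card (S m)}" for m
  proof (rule initial_segment)
    show "S m \<subseteq> {1..a}" by (auto simp: S_def)
    show "i' \<in> S m" if "i \<in> S m" "1 \<le> i'" "i' \<le> i" for i i'
      using that anti[of i' i] by (cases "i' = i") (auto simp: S_def)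
  qed
  define k where "k = card (S 4)"
  define k' where "k' = card (S 3)"
  have fin: "finite (S m)" for m by (simp add: S_def)
  have kk': "k \<le> k'" unfolding k_def k'_def using fin by (intro card_mono) (auto simp: S_def)
  have "i0 \<notin> S 3" using ex by (simp add: S_def)
  have "S 3 \<subseteq> {1..a}" by (auto simp: S_def)
  with \<open>i0 \<notin> S 3\<close> ex(1) have "S 3 \<subset> {1..a}" by blast
  then have k'a: "k' < a" unfolding k'_def using psubset_card_mono[of "{1..a}" "S 3"] by simp
  have 4: "4 \<le> w i \<longleftrightarrow> i \<le> k" and 3: "3 \<le> w i \<longleftrightarrow> i \<le> k'" if "i \<in> {1..a}" for i
    using that S[of 4] S[of 3] by (auto simp: S_def k_def k'_def)
  have "w i = layer_widths k (k' - k) (a - k') i" for i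
  proof (cases "i = 0")
    case True then show ?thesis using assms(1) by (simp add: layer_widths_def)
  next
    case False
    show ?thesis
    proof (cases "i \<le> a")
      case True
      then have "i \<in> {1..a}" using False by simp
      from 4[OF this] 3[OF this] assms(2)[OF this] False True kk' k'a show ?thesis
        by (auto simp: layer_widths_def)
    next
      case i: False
      then show ?thesis using assms(3)[of i] kk' k'a by (simp add: layer_widths_def)
    qed
  qed
  then show ?thesis using k'a by (intro exI[of _ k] exI[of _ "k' - k"] exI[of _ "a - k'"]) auto
qed

text \<open>The cells of a layered graph are leaves, so any numbering of the cells within each row
  may serve as offsets.\<close>

lemma layered_reconstruction:
  assumes D: "finite D" and A: "simple_rel A" and base: "spine_base D A x y z" and lay: "layered D A x y z"
  shows "\<exists>k p q g. 1 \<le> q \<and> isom g D A (row_graph (layer_widths k p q)) (spine_adj False)"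
proof -
  define Us where "Us = {u \<in> D. side_u D A y z u}"
  define Vs where "Vs = {v \<in> D. side_v A y z v}"
  define Cs where "Cs = {c \<in> D. cell D A x y z c}"
  have num: "num_cells D A x y z u = card {c \<in> Cs. A c u}" for u
    by (simp add: num_cells_def Cs_def conj_assoc)
  note l1 = lay[unfolded layered_def, THEN conjunct1]
  note l2 = lay[unfolded layered_def, THEN conjunct2, THEN conjunct1]
  note l3 = lay[unfolded layered_def, THEN conjunct2, THEN conjunct2, THEN conjunct1]
  note l4 = lay[unfolded layered_def, THEN conjunct2, THEN conjunct2, THEN conjunct2, THEN conjunct1]
  note l5 = lay[unfolded layered_def, THEN conjunct2, THEN conjunct2, THEN conjunct2, THEN conjunct2]
  have ex1: "\<exists>!u. u \<in> Us \<and> A c u" if "c \<in> Cs" for c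
    using spine_base_cell[OF base] that unfolding Us_def Cs_def by blast
  \<comment> \<open>An arbitrary numbering for each row; \<open>\<kappa>\<close> glues them together
    along the unique row of each cell.\<close>
  define e where "e u = (SOME h. bij_betw h {c \<in> Cs. A c u} {..<card {c \<in> Cs. A c u}})" for u
  have e: "bij_betw (e u) {c \<in> Cs. A c u} {..<card {c \<in> Cs. A c u}}" for u
  proof -
    have "finite {c \<in> Cs. A c u}" using D by (simp add: Cs_def)
    from ex_bij_betw_finite_nat[OF this] show ?thesis
      unfolding e_def atLeast0LessThan by (rule someI_ex)
  qed
  define \<kappa> where "\<kappa> c = e (THE u. u \<in> Us \<and> A c u) c" for c
  have \<kappa>: "bij_betw \<kappa> {c \<in> Cs. A c u} {..<card {c \<in> Cs. A c u}}" if u: "u \<in> Us" for u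
  proof (rule bij_betw_cong[THEN iffD1, OF _ e])
    fix c assume c: "c \<in> {c \<in> Cs. A c u}"
    then have "(THE u. u \<in> Us \<and> A c u) = u" using ex1[of c] u by (intro the1_equality) auto
    then show "e u c = \<kappa> c" by (simp add: \<kappa>_def)
  qed
  have cc: "A c c' \<longleftrightarrow> False \<and> \<kappa> c = \<kappa> c' \<and> c \<noteq> c'" if "c \<in> Cs" "c' \<in> Cs" for c c'
    using l1 that by (auto simp: Cs_def)
  obtain a :: nat and iu g w where r: "bij_betw iu Us {1..a}" "1 \<le> a"
    "\<And>u u'. u \<in> Us \<Longrightarrow> u' \<in> Us \<Longrightarrow> iu u < iu u' \<longleftrightarrow> (\<exists>v\<in>Vs. A u v \<and> \<not> A u' v)"
    "isom g D A (row_graph w) (spine_adj False)" "w 0 = 3 + card {d \<in> D. isolated D A d}"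
    "\<And>u. u \<in> Us \<Longrightarrow> w (iu u) = 2 + card {c \<in> Cs. A c u}" "\<And>i. a < i \<Longrightarrow> w i = 0"
    by (rule spine_reconstruction[of D A x y z \<kappa> False, folded Us_def Vs_def Cs_def, OF D A base \<kappa> cc]) (assumption | rule that)+
  have surj: "\<exists>u\<in>Us. iu u = i" if "i \<in> {1..a}" for i
    using r(1) that unfolding bij_betw_def by (metis imageE)
  obtain u1 where u1: "u1 \<in> Us" "\<not> 1 \<le> num_cells D A x y z u1" using l5 by (auto simp: Us_def)
  have "\<exists>k p q. 1 \<le> q \<and> w = layer_widths k p q"
  proof (rule antitone_widths)
    have "{d \<in> D. isolated D A d} = {}" using l2 by blast
    then show "w 0 = 3" using r(5) by (simp only: card.empty)
    show "2 \<le> w i \<and> w i \<le> 4" if i: "i \<in> {1..a}" for i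
    proof -
      obtain u where u: "u \<in> Us" "iu u = i" using surj[OF i] by blast
      then have "\<not> 3 \<le> card {c \<in> Cs. A c u}" using l3 num by (auto simp: Us_def)
      then show ?thesis using r(6)[OF u(1)] u by simp
    qed
    show "\<And>i. a < i \<Longrightarrow> w i = 0" by (rule r(7))
    show "w i' \<le> w i" if i: "1 \<le> i" "i < i'" "i' \<le> a" for i i'
    proof -
      obtain u where u: "u \<in> Us" "iu u = i" using surj[of i] i by auto
      obtain u' where u': "u' \<in> Us" "iu u' = i'" using surj[of i'] i by auto
      have "\<exists>v\<in>Vs. A u v \<and> \<not> A u' v" using r(3)[OF u(1) u'(1)] u u' i by simp
      then obtain v where "v \<in> D" "side_v A y z v" "A u v" "\<not> A u' v" by (auto simp: Vs_def)
      moreover have "u \<in> D" "u' \<in> D" "side_u D A y z u" "side_u D A y z u'" using u u' by (auto simp: Us_def)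
      ultimately have "(1 \<le> num_cells D A x y z u' \<longrightarrow> 1 \<le> num_cells D A x y z u) \<and>
          (2 \<le> num_cells D A x y z u' \<longrightarrow> 2 \<le> num_cells D A x y z u)"
        by (intro l4[THEN bspec, THEN bspec, THEN mp] conjI bexI[of _ v])
      then have "(1 \<le> card {c \<in> Cs. A c u'} \<longrightarrow> 1 \<le> card {c \<in> Cs. A c u}) \<and>
          (2 \<le> card {c \<in> Cs. A c u'} \<longrightarrow> 2 \<le> card {c \<in> Cs. A c u})"
        unfolding num .
      moreover have "\<not> 3 \<le> card {c \<in> Cs. A c u'}" using l3 num u' by (auto simp: Us_def)
      ultimately show ?thesis using r(6)[OF u(1)] r(6)[OF u'(1)] u u' by (simp only:) linarith
    qed
    show "iu u1 \<in> {1..a}" using r(1) u1 by (auto simp: bij_betw_def)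
    show "w (iu u1) = 2" using r(6)[OF u1(1)] u1(2) unfolding num by simp
  qed
  then show ?thesis using r(4) by blast
qed

text \<open>Fix a row u0 and project every cell along its clique to that row. Numbering the cells of
  u0 and pulling back along the projection gives offsets that agree exactly on cliques.\<close>

lemma columns_reconstruction:
  assumes D: "finite D" and A: "simple_rel A" and base: "spine_base D A x y z" and col: "columns D A x y z"
  shows "\<exists>a b g. 1 \<le> a \<and> isom g D A (row_graph (grid_widths a b (card {d \<in> D. isolated D A d}))) (spine_adj True)"
proof -
  define Us where "Us = {u \<in> D. side_u D A y z u}"
  define Vs where "Vs = {v \<in> D. side_v A y z v}"
  define Cs where "Cs = {c \<in> D. cell D A x y z c}"
  have sym: "A p q \<longleftrightarrow> A q p" and irr: "\<not> A p p" for p q using A by (auto simp: simple_rel_def)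
  define eq where "eq c c' \<longleftrightarrow> c = c' \<or> A c c'" for c c'
  have eq_sym: "eq c c' \<longleftrightarrow> eq c' c" for c c' using sym by (auto simp: eq_def)
  have eq_trans: "eq c c''" if "c \<in> Cs" "c' \<in> Cs" "c'' \<in> Cs" "eq c c'" "eq c' c''" for c c' c''
  proof -
    have "A c c' \<Longrightarrow> A c' c'' \<Longrightarrow> c = c'' \<or> A c c''"
      using col[unfolded columns_def, THEN conjunct1] that(1-3) unfolding Cs_def by blast
    then show ?thesis using that(4,5) unfolding eq_def by blast
  qed
  have ex1: "\<exists>!c'. c' \<in> Cs \<and> eq c' c \<and> A c' u" if "c \<in> Cs" "u \<in> Us" for c u
    using col[unfolded columns_def, THEN conjunct2] that unfolding Cs_def Us_def eq_def by blast
  define \<rho> where "\<rho> u c = (THE c'. c' \<in> Cs \<and> eq c' c \<and> A c' u)" for u c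
  have \<rho>: "\<rho> u c \<in> Cs" "eq (\<rho> u c) c" "A (\<rho> u c) u" if "c \<in> Cs" "u \<in> Us" for c u
    using theI'[OF ex1[OF that]] by (auto simp: \<rho>_def)
  have \<rho>_eq: "\<rho> u c = c'" if "c \<in> Cs" "u \<in> Us" "c' \<in> Cs" "eq c' c" "A c' u" for c c' u
    unfolding \<rho>_def by (rule the1_equality[OF ex1[OF that(1,2)]]) (use that in auto)
  obtain u0 where u0: "u0 \<in> Us"
    using spine_base_u[OF base] unfolding Us_def by blast
  define b where "b = card {c \<in> Cs. A c u0}"
  have "finite {c \<in> Cs. A c u0}" using D by (simp add: Cs_def)
  then obtain e where e: "bij_betw e {c \<in> Cs. A c u0} {..<b}"
    using ex_bij_betw_finite_nat unfolding b_def atLeast0LessThan by blast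
  define \<kappa> where "\<kappa> = e \<circ> \<rho> u0"
  \<comment> \<open>Projecting back to the row u is the inverse, since a clique has only one cell
    there.\<close>
  have \<rho>_bij: "bij_betw (\<rho> u0) {c \<in> Cs. A c u} {c \<in> Cs. A c u0}" if u: "u \<in> Us" for u
  proof (rule bij_betw_byWitness[where f' = "\<rho> u"])
    show "\<forall>c\<in>{c \<in> Cs. A c u}. \<rho> u (\<rho> u0 c) = c"
      using \<rho> u u0 eq_sym by (intro ballI \<rho>_eq) auto
    show "\<forall>c\<in>{c \<in> Cs. A c u0}. \<rho> u0 (\<rho> u c) = c"
      using \<rho> u u0 eq_sym by (intro ballI \<rho>_eq) auto
    show "\<rho> u0 ` {c \<in> Cs. A c u} \<subseteq> {c \<in> Cs. A c u0}" using \<rho> u0 by auto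
    show "\<rho> u ` {c \<in> Cs. A c u0} \<subseteq> {c \<in> Cs. A c u}" using \<rho> u by auto
  qed
  have cardb: "card {c \<in> Cs. A c u} = b" if "u \<in> Us" for u
    using bij_betw_same_card[OF \<rho>_bij[OF that]] by (simp add: b_def)
  have \<kappa>: "bij_betw \<kappa> {c \<in> Cs. A c u} {..<card {c \<in> Cs. A c u}}" if u: "u \<in> Us" for u
    unfolding \<kappa>_def cardb[OF u] by (rule bij_betw_trans[OF \<rho>_bij[OF u] e])
  have cc: "A c c' \<longleftrightarrow> True \<and> \<kappa> c = \<kappa> c' \<and> c \<noteq> c'" if c: "c \<in> Cs" "c' \<in> Cs" for c c'
  proof -
    have "\<kappa> c = \<kappa> c' \<longleftrightarrow> \<rho> u0 c = \<rho> u0 c'"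
    proof -
      have "inj_on e {c \<in> Cs. A c u0}" using e by (simp add: bij_betw_def)
      then show ?thesis using \<rho>[OF c(1) u0] \<rho>[OF c(2) u0] by (auto simp: \<kappa>_def inj_on_def)
    qed
    also have "\<dots> \<longleftrightarrow> eq c c'"
    proof
      assume "\<rho> u0 c = \<rho> u0 c'"
      then show "eq c c'" using \<rho>[OF c(1) u0] \<rho>[OF c(2) u0] eq_trans[of c "\<rho> u0 c" c'] c eq_sym by metis
    next
      assume "eq c c'"
      then have "eq (\<rho> u0 c) c'" using \<rho>[OF c(1) u0] eq_trans[of "\<rho> u0 c" c c'] c by blast
      then show "\<rho> u0 c = \<rho> u0 c'" using \<rho>_eq[OF c(2) u0, of "\<rho> u0 c"] \<rho>[OF c(1) u0] by simp
    qed
    finally show ?thesis using irr by (auto simp: eq_def)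
  qed
  obtain a :: nat and iu g w where r: "bij_betw iu Us {1..a}" "1 \<le> a"
    "\<And>u u'. u \<in> Us \<Longrightarrow> u' \<in> Us \<Longrightarrow> iu u < iu u' \<longleftrightarrow> (\<exists>v\<in>Vs. A u v \<and> \<not> A u' v)"
    "isom g D A (row_graph w) (spine_adj True)" "w 0 = 3 + card {d \<in> D. isolated D A d}"
    "\<And>u. u \<in> Us \<Longrightarrow> w (iu u) = 2 + card {c \<in> Cs. A c u}" "\<And>i. a < i \<Longrightarrow> w i = 0"
    by (rule spine_reconstruction[of D A x y z \<kappa> True, folded Us_def Vs_def Cs_def, OF D A base \<kappa> cc]) (assumption | rule that)+
  have "w i = grid_widths a b (card {d \<in> D. isolated D A d}) i" for i
  proof -
    consider "i = 0" | "i \<in> {1..a}" | "a < i" by force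
    then show ?thesis
    proof cases
      case 2
      then obtain u where "u \<in> Us" "iu u = i" using r(1) unfolding bij_betw_def by (metis imageE)
      then show ?thesis using r(6) cardb 2 by (auto simp: grid_widths_def)
    qed (use r in \<open>auto simp: grid_widths_def\<close>)
  qed
  then have "w = grid_widths a b (card {d \<in> D. isolated D A d})" by (rule ext)
  then show ?thesis using r(2,4) by blast
qed

section \<open>Truth values stabilize as the number of rows grows\<close>

lemma sgn_diff_eq_le_iff:
  fixes i a i' a' :: int
  shows "sgn (i - a) = sgn (i' - a') \<Longrightarrow> i \<le> a \<longleftrightarrow> i' \<le> a'"
  by (auto simp: sgn_if split: if_splits)

text \<open>The widths change only at row 0 and at the last row, and once these are
  \<open>2 ^ qrank \<psi>\<close> apart their distance is clipped. The numbers b and r are kept,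
  since sentences can see them.\<close>

lemma grid_stable:
  assumes "sentence \<psi>" "2 ^ qrank \<psi> \<le> a" "2 ^ qrank \<psi> \<le> a'"
  shows "valid_in (row_graph (grid_widths a b r)) (spine_adj f) \<psi> \<longleftrightarrow>
    valid_in (row_graph (grid_widths a' b r)) (spine_adj f) \<psi>"
proof (rule row_game_sentence[OF row_invariant_spine_adj, where C = "{(0, 0), (int a, int a')}"])
  have Q: "(2::int) ^ qrank \<psi> \<le> int a" "(2::int) ^ qrank \<psi> \<le> int a'"
    using assms(2,3) by (metis of_nat_le_iff of_nat_numeral of_nat_power)+
  show "gaps_agree (2 ^ qrank \<psi>) {(0, 0), (int a, int a')}"
    using Q by (auto simp: gaps_agree_def clip_eq_iff)
  show "widths_agree {(0, 0), (int a, int a')} (grid_widths a b r) (grid_widths a' b r)"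
    unfolding widths_agree_def
  proof (intro allI impI)
    fix i i' assume h: "\<forall>c c'. (c, c') \<in> {(0, 0), (int a, int a')} \<longrightarrow> sgn (int i - c) = sgn (int i' - c')"
    have "sgn (int i - 0) = sgn (int i' - 0)" "sgn (int i - int a) = sgn (int i' - int a')" using h by blast+
    then have "i = 0 \<longleftrightarrow> i' = 0" "i \<le> a \<longleftrightarrow> i' \<le> a'" by (auto simp: sgn_if split: if_splits)
    then show "grid_widths a b r i = grid_widths a' b r i'" by (simp add: grid_widths_def)
  qed
qed (use assms in \<open>auto simp: grid_widths_def split: if_splits\<close>)

text \<open>The row k is paired with itself, so the layer of rows with two leaves may be short; only
  the two layers after it have to be long.\<close>

lemma layer_stable:
  assumes "sentence \<psi>" "2 ^ qrank \<psi> \<le> p" "2 ^ qrank \<psi> \<le> q" "2 ^ qrank \<psi> \<le> p'" "2 ^ qrank \<psi> \<le> q'"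
  shows "valid_in (row_graph (layer_widths k p q)) (spine_adj f) \<psi> \<longleftrightarrow>
    valid_in (row_graph (layer_widths k p' q')) (spine_adj f) \<psi>"
proof (rule row_game_sentence[OF row_invariant_spine_adj, where
      C = "{(0, 0), (int k, int k), (int (k + p), int (k + p')), (int (k + p + q), int (k + p' + q'))}"])
  let ?C = "{(0, 0), (int k, int k), (int (k + p), int (k + p')), (int (k + p + q), int (k + p' + q'))}"
  define Q where "Q = (2::int) ^ qrank \<psi>"
  have Q: "Q \<le> int p" "Q \<le> int q" "Q \<le> int p'" "Q \<le> int q'"
    unfolding Q_def using assms(2-5) by (metis of_nat_le_iff of_nat_numeral of_nat_power)+
  have "Q > 0" by (simp add: Q_def)
  with Q show "gaps_agree (2 ^ qrank \<psi>) ?C"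
    unfolding Q_def[symmetric] by (auto simp: gaps_agree_def clip_eq_iff)
  show "widths_agree ?C (layer_widths k p q) (layer_widths k p' q')"
    unfolding widths_agree_def
  proof (intro allI impI)
    fix i i' assume h: "\<forall>c c'. (c, c') \<in> ?C \<longrightarrow> sgn (int i - c) = sgn (int i' - c')"
    have "sgn (int i - 0) = sgn (int i' - 0)" "sgn (int i - int k) = sgn (int i' - int k)"
      "sgn (int i - int (k + p)) = sgn (int i' - int (k + p'))"
      "sgn (int i - int (k + p + q)) = sgn (int i' - int (k + p' + q'))" using h by blast+
    from this[THEN sgn_diff_eq_le_iff]
    have "i = 0 \<longleftrightarrow> i' = 0" "i \<le> k \<longleftrightarrow> i' \<le> k" "i \<le> k + p \<longleftrightarrow> i' \<le> k + p'"
      "i \<le> k + p + q \<longleftrightarrow> i' \<le> k + p' + q'" by linarith+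
    then show "layer_widths k p q i = layer_widths k p' q' i'" by (simp add: layer_widths_def)
  qed
qed (use assms in \<open>auto simp: layer_widths_def split: if_splits\<close>)

section \<open>Automorphism groups\<close>

text \<open>By rigidity an automorphism can only exchange the two leaves in some of the first k
  rows, and these exchanges are independent: automorphisms correspond to subsets of
  \<open>{1..k}\<close>.\<close>

lemma layer_automorphisms:
  assumes q: "1 \<le> q" "2 \<le> k + p + q"
  shows "card (automorphisms (row_graph (layer_widths k p q)) (spine_adj False)) = 2 ^ k"
proof -
  let ?w = "layer_widths k p q" and ?R = "spine_adj False"
  let ?V = "row_graph ?w"
  note W = spine_widths_layer[OF q]
  \<comment> \<open>Exchanges the leaves, at offsets 2 and 3, in the rows of S.\<close>
  define H where "H S = (\<lambda>(i, j::nat). if i \<in> S \<and> j = 2 then (i, 3) else if i \<in> S \<and> j = 3 then (i, 2) else (i, j))"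
    for S :: "nat set"
  have H_fst: "fst (H S v) = fst v" for S v by (auto simp: H_def split: prod.splits)
  have H_inv: "H S (H S v) = v" for S v by (auto simp: H_def split: prod.splits)
  have H_adj: "?R (H S (i, j)) (H S (i', j')) \<longleftrightarrow> ?R (i, j) (i', j')" if "0 \<notin> S" for S i j i' j'
    using that by (auto simp: H_def adj_defs)
  have H_out: "H S v = v" if "S \<subseteq> {1..k}" "v \<notin> ?V" for S v
    using that by (auto simp: H_def row_graph_def layer_widths_def split: prod.splits if_splits)
  have H_perm: "H S permutes ?V" if "S \<subseteq> {1..k}" for S
    unfolding permutes_def
  proof (intro conjI allI impI)
    show "\<exists>!v. H S v = u" for u by (rule ex1I[of _ "H S u"]) (use H_inv in auto)
  qed (rule H_out[OF that])
  have H_aut: "H S \<in> automorphisms ?V ?R" if S: "S \<subseteq> {1..k}" for S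
  proof -
    have "0 \<notin> S" using S by auto
    from H_adj[OF this] show ?thesis
      using H_perm[OF S] permutes_imp_bij[OF H_perm[OF S]] by (auto simp: automorphisms_def isom_def)
  qed
  have "bij_betw (\<lambda>h. {i \<in> {1..k}. h (i, 2) = (i, 3)}) (automorphisms ?V ?R) (Pow {1..k})"
  proof (rule bij_betw_byWitness[where f' = H])
    show "\<forall>S\<in>Pow {1..k}. {i \<in> {1..k}. H S (i, 2) = (i, 3)} = S" by (auto simp: H_def)
    show "(\<lambda>h. {i \<in> {1..k}. h (i, 2) = (i, 3)}) ` automorphisms ?V ?R \<subseteq> Pow {1..k}" by auto
    show "H ` Pow {1..k} \<subseteq> automorphisms ?V ?R" using H_aut by auto
    show "\<forall>h\<in>automorphisms ?V ?R. H {i \<in> {1..k}. h (i, 2) = (i, 3)} = h"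
    proof (intro ballI ext)
      fix h and v :: "nat \<times> nat" assume h: "h \<in> automorphisms ?V ?R"
      then have hp: "h permutes ?V" and hi: "isom h ?V ?R ?V ?R" by (auto simp: automorphisms_def)
      define S where "S = {i \<in> {1..k}. h (i, 2) = (i, 3)}"
      obtain i j :: nat where v: "v = (i, j)" by force
      have "H S v = h v"
      proof (cases "v \<in> ?V")
        case False
        have "S \<subseteq> {1..k}" by (auto simp: S_def)
        then show ?thesis using H_out[of S v] permutes_not_in[OF hp False] False by simp
      next
        case True
        note iso = spine_isom[OF W W hi True[unfolded v]]
        have ij: "j < ?w i" using True by (simp add: v row_graph_def)
        consider "i = 0" | "0 < i" "j < 2" | "0 < i" "2 \<le> j" by linarith
        then show ?thesis
        proof cases
          case 1
          then have "j < 3" using ij by (simp add: layer_widths_def)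
          then show ?thesis using iso(2)[OF 1] 1 by (auto simp: v H_def S_def)
        next
          case 2
          then show ?thesis using iso(3) by (auto simp: v H_def)
        next
          case 3
          have hV: "h v \<in> ?V" using isom_mem[OF hi True] .
          have hv: "fst (h v) = i" "2 \<le> snd (h v)" "snd (h v) < ?w i"
            using iso(1) iso(4)[OF 3] hV by (auto simp: v row_graph_def)
          show ?thesis
          proof (cases "i \<le> k")
            case False
            then have "j = 2" "snd (h v) = 2" using ij hv 3 by (auto simp: layer_widths_def split: if_splits)
            then show ?thesis using hv False by (auto simp: v H_def S_def prod_eq_iff)
          next
            case ik: True
            have w4: "?w i = 4" using ik 3 by (simp add: layer_widths_def)
            have V23: "(i, 2) \<in> ?V" "(i, 3) \<in> ?V" using w4 by (auto simp: row_graph_def)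
            have r: "h (i, m) = (i, 2) \<or> h (i, m) = (i, 3)" if m: "m = 2 \<or> m = 3" for m
            proof -
              have mV: "(i, m) \<in> ?V" using V23 m by auto
              have "2 \<le> m" using m by auto
              have "fst (h (i, m)) = i" "2 \<le> snd (h (i, m))" "snd (h (i, m)) < 4"
                using spine_isom(1)[OF W W hi mV] spine_isom(4)[OF W W hi mV 3(1) \<open>2 \<le> m\<close>] isom_mem[OF hi mV] w4
                by (auto simp: row_graph_def)
              then show ?thesis by (cases "h (i, m)") auto
            qed
            have ne: "h (i, 2) \<noteq> h (i, 3)" using isom_eq[OF hi V23] by auto
            have j: "j = 2 \<or> j = 3" using ij w4 3 by linarith
            have iS: "i \<in> S \<longleftrightarrow> h (i, 2) = (i, 3)" using ik 3 by (auto simp: S_def)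
            show ?thesis
              using r[of 2] r[of 3] ne j iS by (auto simp: v H_def)
          qed
        qed
      qed
      then show "H {i \<in> {1..k}. h (i, 2) = (i, 3)} v = h v" by (simp add: S_def)
    qed
  qed
  then have "card (automorphisms ?V ?R) = card (Pow {1..k})" by (rule bij_betw_same_card)
  then show ?thesis by (simp add: card_Pow)
qed

text \<open>An automorphism permutes the cells of each row, and since it respects the cliques it
  acts by the same permutation of the b offsets in all rows. A single isolated vertex contributes
  nothing.\<close>

lemma grid_automorphisms:
  assumes ab: "1 \<le> a" "2 \<le> a \<or> 2 \<le> b" and r: "r \<le> 1"
  shows "card (automorphisms (row_graph (grid_widths a b r)) (spine_adj True)) = fact b"
proof -
  let ?w = "grid_widths a b r" and ?R = "spine_adj True"
  let ?V = "row_graph ?w"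
  note W = spine_widths_grid[OF ab]
  define H where "H t = (\<lambda>(i, j). if 1 \<le> i \<and> i \<le> a \<and> 2 \<le> j \<and> j < 2 + b then (i, 2 + t (j - 2)) else (i, j))"
    for t :: "nat \<Rightarrow> nat"
  \<comment> \<open>The permutation of the columns, read off in row 1.\<close>
  define \<Phi> where "\<Phi> h = (\<lambda>j. if j < b then snd (h (1, 2 + j)) - 2 else j)" for h :: "nat \<times> nat \<Rightarrow> nat \<times> nat"
  have cellV: "(i, 2 + j) \<in> ?V" if "1 \<le> i" "i \<le> a" "j < b" for i j
    using that by (auto simp: row_graph_def grid_widths_def)
  have H_comp: "H t (H t' v) = v" if "t permutes {..<b}" "t' permutes {..<b}" "t \<circ> t' = id" for t t' v
  proof -
    have "t (t' m) = m" for m using that(3) by (metis comp_apply id_apply)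
    moreover have "t' m < b" if "m < b" for m using permutes_in_image[OF \<open>t' permutes {..<b}\<close>, of m] that by auto
    ultimately show ?thesis by (auto simp: H_def split: prod.splits)
  qed
  have H_out: "H t v = v" if "v \<notin> ?V" for t v
    using that by (auto simp: H_def row_graph_def grid_widths_def split: prod.splits if_splits)
  have H_perm: "H t permutes ?V" if t: "t permutes {..<b}" for t
    unfolding permutes_def
  proof (intro conjI allI impI)
    have it: "inv t permutes {..<b}" using permutes_inv[OF t] .
    show "\<exists>!v. H t v = u" for u
      using H_comp[OF t it permutes_inv_o(1)[OF t]] H_comp[OF it t permutes_inv_o(2)[OF t]]
      by (intro ex1I[of _ "H (inv t) u"]) auto
  qed (rule H_out)
  have H_aut: "H t \<in> automorphisms ?V ?R" if t: "t permutes {..<b}" for t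
  proof -
    have inj: "t m = t m' \<longleftrightarrow> m = m'" for m m' using permutes_inj[OF t] by (auto simp: inj_def)
    have "?R (i, j) (i', j') \<longleftrightarrow> ?R (H t (i, j)) (H t (i', j'))" if V: "(i, j) \<in> ?V" "(i', j') \<in> ?V" for i j i' j'
    proof -
      have *: "H t (i, j) = (if 1 \<le> i \<and> 2 \<le> j then (i, 2 + t (j - 2)) else (i, j))" if "(i, j) \<in> ?V" for i j
        using that by (auto simp: H_def row_graph_def grid_widths_def split: if_splits)
      have "t (j - 2) = t (j' - 2) \<longleftrightarrow> j = j'" if "2 \<le> j" "2 \<le> j'" using inj that by auto
      then show ?thesis unfolding *[OF V(1)] *[OF V(2)]
        by (auto simp: adj_defs)
    qed
    then show ?thesis
      using H_perm[OF t] permutes_imp_bij[OF H_perm[OF t]] by (auto simp: automorphisms_def isom_def)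
  qed
  have cell_image: "fst (h (i, 2 + j)) = i \<and> 2 \<le> snd (h (i, 2 + j)) \<and> snd (h (i, 2 + j)) < 2 + b"
    if hi: "isom h ?V ?R ?V ?R" and ij: "1 \<le> i" "i \<le> a" "j < b" for h i j
    using spine_isom(1)[OF W W hi cellV[OF ij]] spine_isom(4)[OF W W hi cellV[OF ij]]
      isom_mem[OF hi cellV[OF ij]] ij by (auto simp: row_graph_def grid_widths_def)
  have "bij_betw \<Phi> (automorphisms ?V ?R) {t. t permutes {..<b}}"
  proof (rule bij_betw_byWitness[where f' = H])
    show "\<forall>t\<in>{t. t permutes {..<b}}. \<Phi> (H t) = t"
      using ab(1) by (auto simp: \<Phi>_def H_def permutes_def)
    show "H ` {t. t permutes {..<b}} \<subseteq> automorphisms ?V ?R" using H_aut by auto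
    show "\<Phi> ` automorphisms ?V ?R \<subseteq> {t. t permutes {..<b}}"
    proof clarify
      fix h assume "h \<in> automorphisms ?V ?R"
      then have hi: "isom h ?V ?R ?V ?R" by (auto simp: automorphisms_def)
      note c = cell_image[OF hi order.refl ab(1)]
      have inj: "inj_on (\<Phi> h) {..<b}"
      proof (rule inj_onI)
        fix j j' assume j: "j \<in> {..<b}" "j' \<in> {..<b}" "\<Phi> h j = \<Phi> h j'"
        then have "snd (h (1, 2 + j)) = snd (h (1, 2 + j'))"
          using c[of j] c[of j'] unfolding \<Phi>_def by auto
        then have "h (1, 2 + j) = h (1, 2 + j')" using c[of j] c[of j'] j by (auto simp: prod_eq_iff)
        then show "j = j'" using isom_eq[OF hi cellV cellV, of 1 j 1 j'] ab j by auto
      qed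
      have "\<Phi> h ` {..<b} \<subseteq> {..<b}" using c by (fastforce simp: \<Phi>_def)
      then have "bij_betw (\<Phi> h) {..<b} {..<b}"
        using inj by (simp add: bij_betw_def endo_inj_surj)
      then show "\<Phi> h permutes {..<b}" by (rule bij_imp_permutes) (simp add: \<Phi>_def)
    qed
    show "\<forall>h\<in>automorphisms ?V ?R. H (\<Phi> h) = h"
    proof (intro ballI ext)
      fix h and v :: "nat \<times> nat" assume h: "h \<in> automorphisms ?V ?R"
      then have hp: "h permutes ?V" and hi: "isom h ?V ?R ?V ?R" by (auto simp: automorphisms_def)
      obtain i j :: nat where v: "v = (i, j)" by force
      show "H (\<Phi> h) v = h v"
      proof (cases "v \<in> ?V")
        case False
        then show ?thesis using H_out[OF False] permutes_not_in[OF hp False] by simp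
      next
        case True
        note iso = spine_isom[OF W W hi True[unfolded v]]
        have ij: "j < ?w i" using True by (simp add: v row_graph_def)
        consider "i = 0" "j < 3" | "i = 0" "3 \<le> j" | "0 < i" "j < 2" | "0 < i" "2 \<le> j" by linarith
        then show ?thesis
        proof cases
          case 1
          then show ?thesis using iso(2) by (auto simp: v H_def)
        next
          case 2
          \<comment> \<open>Since r is at most 1, there is only one isolated vertex, which therefore
            has to be fixed.\<close>
          then have "j = 3" using ij r by (auto simp: grid_widths_def)
          moreover have "fst (h v) = 0" "3 \<le> snd (h v)" using iso(1) iso(5)[OF 2] 2 by (auto simp: v)
          moreover have "snd (h v) < 4"
            using isom_mem[OF hi True] \<open>fst (h v) = 0\<close> r by (auto simp: row_graph_def grid_widths_def)
          ultimately show ?thesis using 2 by (auto simp: v H_def prod_eq_iff)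
        next
          case 3
          then show ?thesis using iso(3) by (auto simp: v H_def)
        next
          case 4
          have ia: "1 \<le> i" "i \<le> a" using 4 ij by (auto simp: grid_widths_def split: if_splits)
          define m where "m = j - 2"
          have jm: "j = 2 + m" "m < b" using ij 4 ia by (auto simp: m_def grid_widths_def)
          note c1 = cell_image[OF hi order.refl ab(1) jm(2)] and ci = cell_image[OF hi ia jm(2)]
          have "snd (h (i, 2 + m)) = snd (h (1, 2 + m))"
          proof (cases "i = 1")
            case False
            \<comment> \<open>The cell shares its column with a cell of row 1, so the images share a
              column too and have the same offset.\<close>
            have "?R (i, 2 + m) (1, 2 + m)" using False ia by (auto simp: adj_defs)
            then have "?R (h (i, 2 + m)) (h (1, 2 + m))"
              using isom_adj[OF hi cellV[OF ia jm(2)] cellV[OF order.refl ab(1) jm(2)]] by simp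
            then show ?thesis using c1 ci ia
              by (cases "h (i, 2 + m)"; cases "h (1, 2 + m)") (auto simp: spine_adj_simps)
          qed simp
          then have "h v = (i, 2 + \<Phi> h m)"
            using ci c1 jm by (cases "h (i, 2 + m)") (auto simp: v \<Phi>_def)
          then show ?thesis using ia jm by (simp add: v H_def)
        qed
      qed
    qed
  qed
  then have "card (automorphisms ?V ?R) = card {t. t permutes {..<b}}" by (rule bij_betw_same_card)
  then show ?thesis by (simp add: card_permutations)
qed

section \<open>Models of the axioms on n vertices\<close>

lemma simple_rel_edges: "E \<in> graphs_on n \<Longrightarrow> simple_rel (\<lambda>x y. {x, y} \<in> E)"
  by (auto simp: simple_rel_def graphs_on_def insert_commute)

text \<open>The lower bound on n excludes the only degenerate solution, k = p = 0 and q = 1.\<close>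

lemma models_layered_iff:
  assumes n: "10 \<le> n" and E: "E \<in> graphs_on n"
  shows "models n E fol_spine_layered \<longleftrightarrow>
    (\<exists>k p q. 1 \<le> q \<and> 3 + 4 * k + 3 * p + 2 * q = n \<and> E \<in> copies n (row_graph (layer_widths k p q)) (spine_adj False))"
proof
  assume "models n E fol_spine_layered"
  then obtain x y z where "spine_base {1..n} (\<lambda>x y. {x, y} \<in> E) x y z" "layered {1..n} (\<lambda>x y. {x, y} \<in> E) x y z"
    unfolding models_iff_valid_in valid_in_spine(1)[OF finite_atLeastAtMost] by blast
  from layered_reconstruction[OF finite_atLeastAtMost simple_rel_edges[OF E] this]
  obtain k p q g where g: "1 \<le> q" "isom g {1..n} (\<lambda>x y. {x, y} \<in> E) (row_graph (layer_widths k p q)) (spine_adj False)"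
    by blast
  have "3 + 4 * k + 3 * p + 2 * q = n"
    using g(2) bij_betw_same_card[of g "{1..n}"] unfolding isom_def card_layer[symmetric] by fastforce
  then show "\<exists>k p q. 1 \<le> q \<and> 3 + 4 * k + 3 * p + 2 * q = n \<and> E \<in> copies n (row_graph (layer_widths k p q)) (spine_adj False)"
    using g E unfolding copies_def by blast
next
  assume "\<exists>k p q. 1 \<le> q \<and> 3 + 4 * k + 3 * p + 2 * q = n \<and> E \<in> copies n (row_graph (layer_widths k p q)) (spine_adj False)"
  then obtain k p q where h: "1 \<le> q" "3 + 4 * k + 3 * p + 2 * q = n"
    "E \<in> copies n (row_graph (layer_widths k p q)) (spine_adj False)" by blast
  have "2 \<le> k + p + q" using h(1,2) n by linarith
  from layer_valid[OF h(1) this] valid_in_copies[OF h(3) sentence_spine(1)] show "models n E fol_spine_layered" by simp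
qed

text \<open>Only this direction, as r is unrestricted here and degenerate grids may occur; they are
  excluded later, when r is bounded.\<close>

lemma models_columns:
  assumes E: "E \<in> graphs_on n" and m: "models n E fol_spine_columns"
  defines "r \<equiv> card {d \<in> {1..n}. isolated {1..n} (\<lambda>x y. {x, y} \<in> E) d}"
  shows "\<exists>a b. 1 \<le> a \<and> 3 + r + a * (b + 2) = n \<and> E \<in> copies n (row_graph (grid_widths a b r)) (spine_adj True)"
proof -
  obtain x y z where "spine_base {1..n} (\<lambda>x y. {x, y} \<in> E) x y z" "columns {1..n} (\<lambda>x y. {x, y} \<in> E) x y z"
    using m unfolding models_iff_valid_in valid_in_spine(2)[OF finite_atLeastAtMost] by blast
  from columns_reconstruction[OF finite_atLeastAtMost simple_rel_edges[OF E] this, folded r_def]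
  obtain a b g where g: "1 \<le> a" "isom g {1..n} (\<lambda>x y. {x, y} \<in> E) (row_graph (grid_widths a b r)) (spine_adj True)"
    by blast
  have "3 + r + a * (b + 2) = n"
    using g(2) bij_betw_same_card[of g "{1..n}"] unfolding isom_def card_grid[symmetric] by fastforce
  then show ?thesis using g E unfolding copies_def by blast
qed

lemma models_isolated_less:
  "models n E (fol_isolated_less m) \<longleftrightarrow> card {d \<in> {1..n}. isolated {1..n} (\<lambda>x y. {x, y} \<in> E) d} < m"
  unfolding models_iff_valid_in valid_in_sentence[OF sentence_isolated(2), where \<sigma> = undefined]
  by (rule gsat_isolated(2)) simp

lemma models_Conj: "models n E (Conj \<phi> \<psi>) \<longleftrightarrow> models n E \<phi> \<and> models n E \<psi>"
  by (auto simp: models_def)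

lemma models_on_small: "n < m \<Longrightarrow> models_on (Or (fol_small m) \<phi>) n \<noteq> {}"
proof -
  assume "n < m"
  then have "gsat {1..n} (\<lambda>x y. {x, y} \<in> E) \<sigma> (fol_small m)" for E \<sigma> by (simp add: gsat_small)
  then have "models n E (Or (fol_small m) \<phi>)" for E unfolding models_iff_valid_in valid_in_def by simp
  then show ?thesis unfolding models_on_def graphs_on_def by auto
qed

lemma models_large: "m \<le> n \<Longrightarrow> models n E (Or (fol_small m) \<phi>) \<longleftrightarrow> models n E \<phi>"
  unfolding models_iff_valid_in valid_in_def by (simp add: gsat_small)

section \<open>Classes of sequences\<close>

lemma bounded_range_add:
  fixes f g :: "nat \<Rightarrow> real"
  assumes "bounded (range f)" "bounded (range g)"
  shows "bounded (range (\<lambda>n. f n + g n))"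
  using bounded_plus_comp[OF assms] .

lemma bounded_range_cmult:
  fixes f :: "nat \<Rightarrow> real"
  assumes "bounded (range f)"
  shows "bounded (range (\<lambda>n. c * f n))"
  using bounded_scaleR_comp[OF assms, of c] by simp

lemma bounded_range_sum:
  fixes f :: "'i \<Rightarrow> nat \<Rightarrow> real"
  assumes "\<And>i. i \<in> I \<Longrightarrow> bounded (range (f i))"
  shows "bounded (range (\<lambda>n. \<Sum>i\<in>I. f i n))"
  using assms
proof (induction I rule: infinite_finite_induct)
  case (insert x F)
  then show ?case using bounded_range_add[of "f x" "\<lambda>n. \<Sum>i\<in>F. f i n"] by simp
qed (auto simp: bounded_iff)

lemma seq_class_add:
  assumes "bounded (range f)" "bounded (range g)"
  shows "seq_class (\<lambda>n. f n + g n) = seq_class f + seq_class g"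
proof -
  have "Bcontfun (\<lambda>n. f n + g n) = Bcontfun f + Bcontfun g"
    using assms bounded_range_add[OF assms]
    by (intro bcontfun_eqI) (simp add: plus_bcontfun.rep_eq Bcontfun_inverse bcontfun_nat)
  then show ?thesis unfolding seq_class_def by (simp add: plus_linf_c0.abs_eq)
qed

lemma seq_class_cmult:
  assumes "bounded (range f)"
  shows "seq_class (\<lambda>n. c * f n) = c *\<^sub>R seq_class f"
proof -
  have "Bcontfun (\<lambda>n. c * f n) = c *\<^sub>R Bcontfun f"
    using assms bounded_range_cmult[OF assms, of c]
    by (intro bcontfun_eqI) (simp add: scaleR_bcontfun.rep_eq Bcontfun_inverse bcontfun_nat)
  then show ?thesis unfolding seq_class_def by (simp add: scaleR_linf_c0.abs_eq)
qed

lemma seq_class_zero: "seq_class (\<lambda>n. 0) = 0"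
proof -
  have "bounded (range (\<lambda>n::nat. 0::real))" by simp
  from seq_class_cmult[OF this, of 0] show ?thesis by simp
qed

lemma seq_class_sum:
  assumes "\<And>i. i \<in> I \<Longrightarrow> bounded (range (f i))"
  shows "seq_class (\<lambda>n. \<Sum>i\<in>I. c i * f i n) = (\<Sum>i\<in>I. c i *\<^sub>R seq_class (f i))"
  using assms
proof (induction I rule: infinite_finite_induct)
  case (insert x F)
  have "bounded (range (\<lambda>n. c x * f x n))" "bounded (range (\<lambda>n. \<Sum>i\<in>F. c i * f i n))"
    using insert.prems by (auto intro!: bounded_range_cmult bounded_range_sum)
  from seq_class_add[OF this] show ?case using insert by (simp add: seq_class_cmult)
qed (simp_all add: seq_class_zero)

lemma seq_class_diff:
  assumes "bounded (range f)" "bounded (range g)"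
  shows "seq_class f - seq_class g = seq_class (\<lambda>n. f n - g n)"
  using seq_class_add[OF assms(1) bounded_range_cmult[OF assms(2), of "- 1"]]
    seq_class_cmult[OF assms(2), of "- 1"] by simp

lemma bounded_range_diff:
  fixes f g :: "nat \<Rightarrow> real"
  assumes "bounded (range f)" "bounded (range g)"
  shows "bounded (range (\<lambda>n. f n - g n))"
  using bounded_minus_comp[OF assms] .

lemma dist_seq_class:
  assumes "bounded (range f)" "bounded (range g)"
  shows "limsup (\<lambda>n. ereal \<bar>f n - g n\<bar>) = ereal (dist (seq_class f) (seq_class g))"
proof -
  let ?d = "\<lambda>n. f n - g n"
  have b: "?d \<in> bcontfun" using bounded_range_diff[OF assms] by (simp add: bcontfun_nat)
  have "dist (seq_class f) (seq_class g) = norm (seq_class ?d)"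
    by (simp add: dist_norm seq_class_diff[OF assms])
  also have "\<dots> = limsup_abs (Bcontfun ?d)" unfolding seq_class_def by (rule norm_linf_c0.abs_eq)
  finally show ?thesis using limsup_abs_ereal[of "Bcontfun ?d"] Bcontfun_inverse[OF b] by simp
qed

lemma dist_seq_class_le:
  assumes "bounded (range f)" "bounded (range g)" "\<forall>\<^sub>F n in sequentially. \<bar>f n - g n\<bar> \<le> e"
  shows "dist (seq_class f) (seq_class g) \<le> e"
proof -
  have "limsup (\<lambda>n. ereal \<bar>f n - g n\<bar>) \<le> ereal e"
    by (rule Limsup_bounded) (use assms(3) in simp)
  then show ?thesis unfolding dist_seq_class[OF assms(1,2)] by simp
qed

text \<open>Infinitely many n suffice, the norm being a limsup. The separation in (iv) is only
  visible along the powers of a prime.\<close>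

lemma dist_seq_class_ge:
  assumes "bounded (range f)" "bounded (range g)" "\<exists>\<^sub>F n in sequentially. e \<le> \<bar>f n - g n\<bar>"
  shows "e \<le> dist (seq_class f) (seq_class g)"
proof (rule ccontr)
  assume "\<not> ?thesis"
  then have "limsup (\<lambda>n. ereal \<bar>f n - g n\<bar>) < ereal e" unfolding dist_seq_class[OF assms(1,2)] by simp
  then have "\<forall>\<^sub>F n in sequentially. ereal \<bar>f n - g n\<bar> < ereal e" by (rule Limsup_lessD)
  then have "\<forall>\<^sub>F n in sequentially. \<not> e \<le> \<bar>f n - g n\<bar>" by eventually_elim simp
  then show False using assms(3) by (simp add: frequently_def)
qed

lemma seq_class_cong:
  assumes "bounded (range f)" "bounded (range g)" "\<forall>\<^sub>F n in sequentially. f n = g n"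
  shows "seq_class f = seq_class g"
  unfolding seq_class_eq_iff[OF assms(1,2)]
  by (rule tendsto_eventually) (use assms(3) in eventually_elim, simp)

section \<open>Linear independence, and dimensions from periodic sequences\<close>

text \<open>Independence is needed for a family rather than a set: the injectivity supplies the
  number of basis vectors.\<close>

lemma independent_family:
  fixes x :: "'i \<Rightarrow> 'b::real_vector"
  assumes "\<And>F c i. finite F \<Longrightarrow> F \<subseteq> I \<Longrightarrow> (\<Sum>i\<in>F. c i *\<^sub>R x i) = 0 \<Longrightarrow> i \<in> F \<Longrightarrow> c i = 0"
  shows "inj_on x I" "independent (x ` I)"
proof -
  show inj: "inj_on x I"
  proof (rule inj_onI, rule ccontr)
    fix i j assume ij: "i \<in> I" "j \<in> I" "x i = x j" "i \<noteq> j"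
    have "(\<Sum>k\<in>{i, j}. (if k = i then 1 else - 1) *\<^sub>R x k) = 0" using ij by simp
    from assms[OF _ _ this, of i] ij show False by auto
  qed
  show "independent (x ` I)"
    unfolding dependent_explicit
  proof (rule notI, elim exE conjE bexE)
    fix t u v assume t: "finite t" "t \<subseteq> x ` I" "(\<Sum>v\<in>t. u v *\<^sub>R v) = 0" "v \<in> t" "u v \<noteq> 0"
    then obtain F where F: "F \<subseteq> I" "t = x ` F" by (auto simp: subset_image_iff)
    have injF: "inj_on x F" using inj F(1) by (rule inj_on_subset)
    have "finite F" using t(1) F(2) injF by (simp add: finite_image_iff)
    obtain i where i: "i \<in> F" "v = x i" using t(4) F(2) by auto
    have "(\<Sum>i\<in>F. u (x i) *\<^sub>R x i) = 0" using t(3) unfolding F(2) by (simp add: sum.reindex[OF injF])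
    from assms[OF \<open>finite F\<close> F(1) this i(1)] show False using t(5) i by simp
  qed
qed

abbreviation prob_seq :: "fol \<Rightarrow> fol \<Rightarrow> nat \<Rightarrow> real" where
  "prob_seq \<phi> \<psi> n \<equiv> measure_pmf.prob (random_graph \<phi> n) {E. models n E \<psi>}"

lemma FOC_memI: "sentence \<psi> \<Longrightarrow> seq_class (prob_seq \<phi> \<psi>) \<in> FOC (random_graph \<phi>)"
  by (auto simp: FOC_def)

lemma bounded_of_bool: "bounded (range (\<lambda>n. of_bool (P n) :: real))"
  unfolding bounded_iff by (intro exI[of _ 1]) auto

lemma prob_single_type:
  assumes "simple_rel A" "finite D" "card D = n" "models_on \<phi> n = copies n D A" "sentence \<psi>"
  shows "prob_seq \<phi> \<psi> n = of_bool (valid_in D A \<psi>)"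
proof -
  define \<alpha> where "\<alpha> = real (card (automorphisms D A))"
  have "\<alpha> \<noteq> 0" using card_copies[OF assms(1-3)] fact_nonzero[of n, where ?'a = nat]
    unfolding \<alpha>_def by (metis mult_0_right of_nat_eq_0_iff)
  have "prob_seq \<phi> \<psi> n = (\<Sum>t\<in>{()}. if valid_in D A \<psi> then 1 / \<alpha> else 0) / (\<Sum>t\<in>{()}. 1 / \<alpha>)"
    by (rule prob_random_graph[OF assms(1)]) (use assms in \<open>auto simp: \<alpha>_def\<close>)
  then show ?thesis using \<open>\<alpha> \<noteq> 0\<close> by simp
qed

text \<open>All probability sequences are eventually indicator functions of unions of residue
  classes modulo d. The indicators of the d single classes occur among them and form a basis of the
  span.\<close>

lemma dim_periodic:
  assumes d: "1 \<le> d"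
    and per: "\<And>\<psi>. sentence \<psi> \<Longrightarrow> \<exists>\<theta>. \<forall>\<^sub>F n in sequentially. prob_seq \<phi> \<psi> n = of_bool (\<theta> ((n - 3) mod d))"
    and res: "\<And>r. r < d \<Longrightarrow> \<exists>\<psi>. sentence \<psi> \<and> (\<forall>\<^sub>F n in sequentially. prob_seq \<phi> \<psi> n = of_bool ((n - 3) mod d = r))"
  shows "dim (span (FOC (random_graph \<phi>))) = d"
proof -
  define x where "x r = seq_class (\<lambda>n. of_bool ((n - 3) mod d = r))" for r
  have mem: "x r \<in> FOC (random_graph \<phi>)" if r: "r < d" for r
  proof -
    obtain \<psi> where \<psi>: "sentence \<psi>" "\<forall>\<^sub>F n in sequentially. prob_seq \<phi> \<psi> n = of_bool ((n - 3) mod d = r)"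
      using res[OF r] by blast
    have "seq_class (prob_seq \<phi> \<psi>) = x r"
      unfolding x_def by (rule seq_class_cong[OF bounded_prob_seq bounded_of_bool \<psi>(2)])
    then show ?thesis using FOC_memI[OF \<psi>(1)] by metis
  qed
  have comb: "(\<Sum>r\<in>F. c r *\<^sub>R x r) = seq_class (\<lambda>n. \<Sum>r\<in>F. c r * of_bool ((n - 3) mod d = r))" for F c
    unfolding x_def by (rule seq_class_sum[symmetric]) (rule bounded_of_bool)
  have bnd: "bounded (range (\<lambda>n. \<Sum>r\<in>F. c r * of_bool ((n - 3) mod d = r) :: real))" for F c
    by (intro bounded_range_sum bounded_range_cmult bounded_of_bool)
  have fam: "c i = 0" if h: "finite F" "F \<subseteq> {..<d}" "(\<Sum>r\<in>F. c r *\<^sub>R x r) = 0" "i \<in> F" for F c i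
  proof -
    have "(\<lambda>n. (\<Sum>r\<in>F. c r * of_bool ((n - 3) mod d = r)) - 0) \<longlonglongrightarrow> 0"
      using h(3) unfolding comb seq_class_zero[symmetric]
      by (subst (asm) seq_class_eq_iff[OF bnd]) (auto simp: bounded_iff)
    \<comment> \<open>Along the residue class of i every indicator except that of i vanishes, which
      isolates one coefficient.\<close>
    moreover have "filterlim (\<lambda>t. 3 + i + t * d) sequentially sequentially"
      using d by (intro filterlim_subseq) (auto simp: strict_mono_def)
    ultimately have "(\<lambda>t. (\<Sum>r\<in>F. c r * of_bool ((3 + i + t * d - 3) mod d = r))) \<longlonglongrightarrow> 0"
      by (auto dest: filterlim_compose)
    moreover have "(\<Sum>r\<in>F. c r * of_bool ((3 + i + t * d - 3) mod d = r)) = c i" for t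
    proof -
      have "i < d" using h by auto
      then have "(3 + i + t * d - 3) mod d = i" by simp
      then have "(\<Sum>r\<in>F. c r * of_bool ((3 + i + t * d - 3) mod d = r)) = (\<Sum>r\<in>F. if i = r then c r else 0)"
        by (intro sum.cong) auto
      then show ?thesis using h by simp
    qed
    ultimately show "c i = 0" by (simp add: LIMSEQ_const_iff)
  qed
  have ind: "inj_on x {..<d}" "independent (x ` {..<d})"
    using independent_family[of "{..<d}" x] fam by blast+
  have "FOC (random_graph \<phi>) \<subseteq> span (x ` {..<d})"
  proof
    fix y assume "y \<in> FOC (random_graph \<phi>)"
    then obtain \<psi> where \<psi>: "sentence \<psi>" "y = seq_class (prob_seq \<phi> \<psi>)" by (auto simp: FOC_def)
    obtain \<theta> where \<theta>: "\<forall>\<^sub>F n in sequentially. prob_seq \<phi> \<psi> n = of_bool (\<theta> ((n - 3) mod d))"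
      using per[OF \<psi>(1)] by blast
    have "y = seq_class (\<lambda>n. \<Sum>r<d. of_bool (\<theta> r) * of_bool ((n - 3) mod d = r))"
      unfolding \<psi>(2)
    proof (rule seq_class_cong[OF bounded_prob_seq bnd])
      show "\<forall>\<^sub>F n in sequentially. prob_seq \<phi> \<psi> n = (\<Sum>r<d. of_bool (\<theta> r) * of_bool ((n - 3) mod d = r))"
        using \<theta>
      proof eventually_elim
        case (elim n)
        have "(\<Sum>r<d. of_bool (\<theta> r) * of_bool ((n - 3) mod d = r)) =
            (\<Sum>r<d. if (n - 3) mod d = r then of_bool (\<theta> r) else (0::real))"
          by (intro sum.cong) auto
        also have "\<dots> = of_bool (\<theta> ((n - 3) mod d))" using d by simp
        finally show ?case using elim by simp
      qed
    qed
    also have "\<dots> = (\<Sum>r<d. of_bool (\<theta> r) *\<^sub>R x r)" by (rule comb[symmetric])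
    also have "\<dots> \<in> span (x ` {..<d})" by (intro span_sum span_scale span_base) auto
    finally show "y \<in> span (x ` {..<d})" .
  qed
  then have "span (FOC (random_graph \<phi>)) = span (x ` {..<d})"
    using mem by (intro span_eq[THEN iffD2] conjI) (auto intro: span_base)
  then have "dim (span (FOC (random_graph \<phi>))) = card (x ` {..<d})"
    using ind(2) by (simp add: dim_eq_card_independent)
  then show ?thesis using ind(1) by (simp add: card_image)
qed

section \<open>Spines with columns\<close>

text \<open>Division with remainder: the grid with b columns on n vertices that has fewer than b + 2
  isolated vertices.\<close>

definition grid :: "nat \<Rightarrow> nat \<Rightarrow> (nat \<times> nat) set" where
  "grid n b = row_graph (grid_widths ((n - 3) div (b + 2)) b ((n - 3) mod (b + 2)))"

lemma grid_params:
  fixes n b :: nat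
  assumes "b + 2 \<le> n - 3"
  shows "1 \<le> (n - 3) div (b + 2)" "3 + (n - 3) mod (b + 2) + (n - 3) div (b + 2) * (b + 2) = n"
proof -
  show "1 \<le> (n - 3) div (b + 2)" using div_le_mono[OF assms, of "b + 2"] by simp
  have "(n - 3) div (b + 2) * (b + 2) + (n - 3) mod (b + 2) = n - 3" by (rule div_mult_mod_eq)
  then show "3 + (n - 3) mod (b + 2) + (n - 3) div (b + 2) * (b + 2) = n" using assms by linarith
qed

lemma grid_params_unique:
  fixes n a b r :: nat
  assumes "3 + r + a * (b + 2) = n" "r < b + 2"
  shows "a = (n - 3) div (b + 2)" "r = (n - 3) mod (b + 2)"
proof -
  define c where "c = b + 2"
  have "n - 3 = r + a * c" "r < c" using assms by (auto simp: c_def)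
  then have "a = (n - 3) div c" "r = (n - 3) mod c" by simp_all
  then show "a = (n - 3) div (b + 2)" "r = (n - 3) mod (b + 2)" unfolding c_def .
qed

lemma card_grid_eq: "b + 2 \<le> n - 3 \<Longrightarrow> card (grid n b) = n"
  unfolding grid_def card_grid by (rule grid_params)

text \<open>One row with at most one column gives at most r + 6 vertices.\<close>

lemma grid_nondegenerate:
  fixes n a b r :: nat
  assumes "3 + r + a * (b + 2) = n" "1 \<le> a" "r + 9 \<le> n"
  shows "2 \<le> a \<or> 2 \<le> b"
proof (rule ccontr)
  assume "\<not> ?thesis"
  then have "a = 1" "b \<le> 1" using assms(2) by auto
  then show False using assms(1,3) by simp
qed

text \<open>From b + 10 vertices on there is a row and the degenerate grids are excluded; a and r
  are then determined by n, so only one isomorphism type is left.\<close>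

definition phi_columns :: "nat \<Rightarrow> fol" where
  "phi_columns b = Or (fol_small (b + 10))
     (Conj (Conj fol_spine_columns (fol_num_columns b)) (fol_isolated_less (b + 2)))"

lemma sentence_phi_columns: "sentence (phi_columns b)"
  by (simp add: phi_columns_def sentence_small sentence_spine sentence_num_columns sentence_isolated)

lemma models_on_phi_columns:
  assumes n: "b + 10 \<le> n"
  shows "models_on (phi_columns b) n = copies n (grid n b) (spine_adj True)"
proof (intro subset_antisym subsetI)
  fix E assume "E \<in> models_on (phi_columns b) n"
  then have E: "E \<in> graphs_on n" and m: "models n E fol_spine_columns" "models n E (fol_num_columns b)"
    "models n E (fol_isolated_less (b + 2))"
    using models_large[OF n] by (auto simp: models_on_def phi_columns_def models_Conj)
  define r where "r = card {d \<in> {1..n}. isolated {1..n} (\<lambda>x y. {x, y} \<in> E) d}"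
  have r: "r < b + 2" using m(3) unfolding models_isolated_less r_def .
  obtain a b' where ab: "1 \<le> a" "3 + r + a * (b' + 2) = n"
    and c: "E \<in> copies n (row_graph (grid_widths a b' r)) (spine_adj True)"
    using models_columns[OF E m(1)] unfolding r_def by blast
  have nd: "2 \<le> a \<or> 2 \<le> b'"
  proof (rule ccontr)
    assume "\<not> ?thesis"
    then have "a = 1" "b' \<le> 1" using ab(1) by auto
    then show False using ab(2) r n by simp
  qed
  have "b = b'" using m(2) valid_in_copies[OF c sentence_num_columns] grid_num_columns[OF ab(1) nd] by blast
  then show "E \<in> copies n (grid n b) (spine_adj True)"
    using c grid_params_unique[OF ab(2)] r by (simp add: grid_def)
next
  fix E assume c: "E \<in> copies n (grid n b) (spine_adj True)"
  then have E: "E \<in> graphs_on n" by (simp add: copies_def)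
  have le: "b + 2 \<le> n - 3" using n by simp
  let ?a = "(n - 3) div (b + 2)" and ?r = "(n - 3) mod (b + 2)"
  have r: "?r < b + 2" by simp
  have nd: "2 \<le> ?a \<or> 2 \<le> b"
  proof (rule ccontr)
    assume h: "\<not> ?thesis"
    then have "?a = 1" "b \<le> 1" using grid_params(1)[OF le] by auto
    then have "3 + ?r + (b + 2) = n" using grid_params(2)[OF le] by simp
    then show False using r n \<open>b \<le> 1\<close> by linarith
  qed
  note v = grid_valid[OF grid_params(1)[OF le] nd] grid_num_columns[OF grid_params(1)[OF le] nd]
    grid_num_isolated(2)[OF grid_params(1)[OF le] nd]
  have "models n E fol_spine_columns" "models n E (fol_num_columns b)" "models n E (fol_isolated_less (b + 2))"
    using valid_in_copies[OF c] sentence_spine sentence_num_columns sentence_isolated v r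
    unfolding grid_def by auto
  then show "E \<in> models_on (phi_columns b) n"
    using E models_large[OF n] by (simp add: models_on_def phi_columns_def models_Conj)
qed

lemma finite_grid_eq: "finite (grid n b)"
  unfolding grid_def by (rule finite_grid)

lemma conditionable_phi_columns: "conditionable (phi_columns b)"
  unfolding conditionable_def
proof (intro conjI allI impI sentence_phi_columns)
  fix n :: nat
  show "models_on (phi_columns b) n \<noteq> {}"
  proof (cases "n < b + 10")
    case True then show ?thesis unfolding phi_columns_def by (rule models_on_small)
  next
    case False
    then show ?thesis
      using copies_nonempty[OF simple_rel_spine_adj finite_grid_eq card_grid_eq] by (simp add: models_on_phi_columns)
  qed
qed

lemma dim_phi_columns: "dim (span (FOC (random_graph (phi_columns b)))) = b + 2"
proof (rule dim_periodic)
  have P: "prob_seq (phi_columns b) \<psi> n = of_bool (valid_in (grid n b) (spine_adj True) \<psi>)"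
    if "b + 10 \<le> n" "sentence \<psi>" for n \<psi>
    using that by (intro prob_single_type simple_rel_spine_adj finite_grid_eq card_grid_eq models_on_phi_columns) auto
  show "\<exists>\<theta>. \<forall>\<^sub>F n in sequentially. prob_seq (phi_columns b) \<psi> n = of_bool (\<theta> ((n - 3) mod (b + 2)))"
    if \<psi>: "sentence \<psi>" for \<psi>
  proof (intro exI eventually_sequentiallyI)
    \<comment> \<open>The bound forces at least \<open>2 ^ qrank \<psi>\<close> rows, so the grid
      may be replaced by the one with exactly that many rows and the same remainder.\<close>
    fix n assume n: "b + 10 + (b + 2) * 2 ^ qrank \<psi> \<le> n"
    have "(b + 2) * 2 ^ qrank \<psi> \<le> n - 3" using n by simp
    then have "2 ^ qrank \<psi> \<le> (n - 3) div (b + 2)"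
      by (simp add: less_eq_div_iff_mult_less_eq mult.commute)
    from grid_stable[OF \<psi> this order.refl, of b]
    show "prob_seq (phi_columns b) \<psi> n =
        of_bool ((\<lambda>r. valid_in (row_graph (grid_widths (2 ^ qrank \<psi>) b r)) (spine_adj True) \<psi>) ((n - 3) mod (b + 2)))"
      using n P[OF _ \<psi>, of n] by (simp add: grid_def)
  qed
  show "\<exists>\<psi>. sentence \<psi> \<and> (\<forall>\<^sub>F n in sequentially. prob_seq (phi_columns b) \<psi> n = of_bool ((n - 3) mod (b + 2) = r))"
    if "r < b + 2" for r
  proof (intro exI conjI eventually_sequentiallyI)
    show "sentence (fol_isolated_eq r)" by (rule sentence_isolated)
    \<comment> \<open>Large enough for two rows, which makes the grid nondegenerate.\<close>
    fix n assume n: "2 * b + 20 \<le> n"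
    have le: "b + 2 \<le> n - 3" using n by simp
    have "2 * (b + 2) \<le> n - 3" using n by simp
    then have "2 \<le> (n - 3) div (b + 2)" by (simp add: less_eq_div_iff_mult_less_eq)
    then have "valid_in (grid n b) (spine_adj True) (fol_isolated_eq r) \<longleftrightarrow> (n - 3) mod (b + 2) = r"
      unfolding grid_def by (intro grid_num_isolated) auto
    then show "prob_seq (phi_columns b) (fol_isolated_eq r) n = of_bool ((n - 3) mod (b + 2) = r)"
      using P[OF _ sentence_isolated(1), of n] n by simp
  qed
qed simp

section \<open>Dimension one: graphs without edges\<close>

definition phi_empty :: fol where
  "phi_empty = Forall 0 (Forall 1 (Neg (Adj 0 1)))"

lemma sentence_phi_empty: "sentence phi_empty"
  by (auto simp: phi_empty_def sentence_def)

text \<open>An edgeless graph written as rows of width 1, so that the game for row graphs applies to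
  it too.\<close>

definition empty_widths :: "nat \<Rightarrow> nat \<Rightarrow> nat" where
  "empty_widths n i = (if 1 \<le> i \<and> i \<le> n then 1 else 0)"

lemma isom_empty: "isom (\<lambda>x. (x, 0)) {1..n} (\<lambda>x y. {x, y} \<in> {}) (row_graph (empty_widths n)) (\<lambda>_ _. False)"
  by (auto simp: isom_def bij_betw_def inj_on_def row_graph_def empty_widths_def image_iff split: if_splits)

lemma finite_empty_graph: "finite (row_graph (empty_widths n))"
  and card_empty_graph: "card (row_graph (empty_widths n)) = n"
  using isom_empty[of n] bij_betw_finite bij_betw_same_card unfolding isom_def by fastforce+

lemma models_on_phi_empty: "models_on phi_empty n = copies n (row_graph (empty_widths n)) (\<lambda>_ _. False)"
proof -
  have m: "models n E phi_empty \<longleftrightarrow> (\<forall>x\<in>{1..n}. \<forall>y\<in>{1..n}. {x, y} \<notin> E)" for E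
    unfolding models_sentence[OF sentence_phi_empty, where \<sigma> = undefined] sat_eq_gsat
    by (simp add: phi_empty_def)
  have 1: "models_on phi_empty n = {{}}"
  proof (intro subset_antisym subsetI)
    fix E assume "E \<in> models_on phi_empty n"
    then have "E = {}" by (intro graph_eqI[of E n]) (auto simp: models_on_def m graphs_on_def)
    then show "E \<in> {{}}" by simp
  qed (auto simp: models_on_def m graphs_on_def)
  have 2: "copies n (row_graph (empty_widths n)) (\<lambda>_ _. False) = {{}}"
  proof (intro subset_antisym subsetI)
    fix E assume "E \<in> copies n (row_graph (empty_widths n)) (\<lambda>_ _. False)"
    then have "E = {}" by (intro graph_eqI[of E n]) (auto simp: copies_def isom_def graphs_on_def)
    then show "E \<in> {{}}" by simp
  next
    fix E :: edges assume "E \<in> {{}}"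
    then show "E \<in> copies n (row_graph (empty_widths n)) (\<lambda>_ _. False)"
      unfolding copies_def graphs_on_def using isom_empty[of n] by auto
  qed
  show ?thesis using 1 2 by simp
qed

lemma conditionable_phi_empty: "conditionable phi_empty"
  unfolding conditionable_def
  using sentence_phi_empty copies_nonempty[OF _ finite_empty_graph card_empty_graph]
  by (simp add: models_on_phi_empty simple_rel_def)

lemma dim_phi_empty: "dim (span (FOC (random_graph phi_empty))) = 1"
proof (rule dim_periodic)
  let ?G = "\<lambda>n. row_graph (empty_widths n)"
  have P: "prob_seq phi_empty \<psi> n = of_bool (valid_in (?G n) (\<lambda>_ _. False) \<psi>)" if "sentence \<psi>" for n \<psi>
    using that by (intro prob_single_type finite_empty_graph card_empty_graph models_on_phi_empty)
      (auto simp: simple_rel_def)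
  have stable: "valid_in (?G n) (\<lambda>_ _. False) \<psi> \<longleftrightarrow> valid_in (?G (2 ^ qrank \<psi>)) (\<lambda>_ _. False) \<psi>"
    if \<psi>: "sentence \<psi>" and n: "2 ^ qrank \<psi> \<le> n" for n \<psi>
  proof (rule row_game_sentence[where C = "{(0, 0), (int n, 2 ^ qrank \<psi>)}"])
    have Q: "(2::int) ^ qrank \<psi> \<le> int n" using n by (metis of_nat_le_iff of_nat_numeral of_nat_power)
    then show "gaps_agree (2 ^ qrank \<psi>) {(0, 0), (int n, 2 ^ qrank \<psi>)}"
      by (auto simp: gaps_agree_def clip_eq_iff)
    show "widths_agree {(0, 0), (int n, 2 ^ qrank \<psi>)} (empty_widths n) (empty_widths (2 ^ qrank \<psi>))"
      unfolding widths_agree_def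
    proof (intro allI impI)
      fix i i'
      assume h: "\<forall>c c'. (c, c') \<in> {(0, 0), (int n, 2 ^ qrank \<psi>)} \<longrightarrow> sgn (int i - c) = sgn (int i' - c')"
      have "sgn (int i - 0) = sgn (int i' - 0)" "sgn (int i - int n) = sgn (int i' - 2 ^ qrank \<psi>)" using h by blast+
      from this[THEN sgn_diff_eq_le_iff] have "i = 0 \<longleftrightarrow> i' = 0" "i \<le> n \<longleftrightarrow> int i' \<le> int (2 ^ qrank \<psi>)" by auto
      then have "i = 0 \<longleftrightarrow> i' = 0" "i \<le> n \<longleftrightarrow> i' \<le> 2 ^ qrank \<psi>" by (simp_all only: of_nat_le_iff)
      then show "empty_widths n i = empty_widths (2 ^ qrank \<psi>) i'" by (cases "i = 0") (auto simp: empty_widths_def)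
    qed
    show "\<exists>(c, c')\<in>{(0, 0), (int n, 2 ^ qrank \<psi>)}. int i \<le> c'" if "empty_widths (2 ^ qrank \<psi>) i > 0" for i
    proof -
      have "i \<le> 2 ^ qrank \<psi>" using that by (simp add: empty_widths_def split: if_splits)
      then have "int i \<le> 2 ^ qrank \<psi>" by (metis of_nat_le_iff of_nat_numeral of_nat_power)
      then show ?thesis by auto
    qed
  qed (use \<psi> in \<open>auto simp: empty_widths_def row_invariant_def split: if_splits\<close>)
  show "\<exists>\<theta>. \<forall>\<^sub>F n in sequentially. prob_seq phi_empty \<psi> n = of_bool (\<theta> ((n - 3) mod 1))" if "sentence \<psi>" for \<psi>
  proof (intro exI eventually_sequentiallyI)
    fix n :: nat assume "2 ^ qrank \<psi> \<le> n"
    from stable[OF that this] show "prob_seq phi_empty \<psi> n =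
        of_bool ((\<lambda>_. valid_in (?G (2 ^ qrank \<psi>)) (\<lambda>_ _. False) \<psi>) ((n - 3) mod 1))"
      unfolding P[OF that] by simp
  qed
  show "\<exists>\<psi>. sentence \<psi> \<and> (\<forall>\<^sub>F n in sequentially. prob_seq phi_empty \<psi> n = of_bool ((n - 3) mod 1 = r))" if "r < 1" for r
  proof (intro exI conjI always_eventually allI)
    show "sentence Tru" by simp
    show "prob_seq phi_empty Tru n = of_bool ((n - 3) mod 1 = r)" for n
      unfolding P[OF \<open>sentence Tru\<close>] using that by (simp add: valid_in_def)
  qed
qed simp

section \<open>Grids with any number of columns and few isolated vertices\<close>

text \<open>Used with m = 1 for (iv) and with m = 2 for (iii).\<close>

definition phi_grids :: "nat \<Rightarrow> fol" where
  "phi_grids m = Or (fol_small 10) (Conj fol_spine_columns (fol_isolated_less m))"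

text \<open>For m <= 2 a number of isolated vertices below m is smaller than b + 2 for every b,
  hence equal to the remainder; so b alone names the type.\<close>

definition grid_types :: "nat \<Rightarrow> nat \<Rightarrow> nat set" where
  "grid_types m n = {b. b + 2 \<le> n - 3 \<and> (n - 3) mod (b + 2) < m}"

definition grid_total :: "nat \<Rightarrow> nat \<Rightarrow> real" where
  "grid_total m n = (\<Sum>b\<in>grid_types m n. 1 / fact b)"

lemma finite_grid_types: "finite (grid_types m n)"
  by (rule finite_subset[of _ "{..n}"]) (auto simp: grid_types_def)

lemma sentence_phi_grids: "sentence (phi_grids m)"
  by (simp add: phi_grids_def sentence_small sentence_spine sentence_isolated)

lemma grid_types_nondegenerate:
  assumes "10 \<le> n" "b \<in> grid_types m n" "m \<le> 2"
  shows "1 \<le> (n - 3) div (b + 2)" "2 \<le> (n - 3) div (b + 2) \<or> 2 \<le> b"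
proof -
  have le: "b + 2 \<le> n - 3" "(n - 3) mod (b + 2) < 2" using assms by (auto simp: grid_types_def)
  show 1: "1 \<le> (n - 3) div (b + 2)" using grid_params[OF le(1)] by simp
  show "2 \<le> (n - 3) div (b + 2) \<or> 2 \<le> b"
    by (rule grid_nondegenerate[OF grid_params(2)[OF le(1)] 1]) (use le(2) assms(1) in simp)
qed

lemma models_on_phi_grids:
  assumes n: "10 \<le> n" and m: "m \<le> 2"
  shows "models_on (phi_grids m) n = (\<Union>b\<in>grid_types m n. copies n (grid n b) (spine_adj True))"
proof (intro subset_antisym subsetI)
  fix E assume "E \<in> models_on (phi_grids m) n"
  then have E: "E \<in> graphs_on n" and h: "models n E fol_spine_columns" "models n E (fol_isolated_less m)"
    using models_large[OF n] by (auto simp: models_on_def phi_grids_def models_Conj)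
  define r where "r = card {d \<in> {1..n}. isolated {1..n} (\<lambda>x y. {x, y} \<in> E) d}"
  have r: "r < m" using h(2) unfolding models_isolated_less r_def .
  obtain a b where ab: "1 \<le> a" "3 + r + a * (b + 2) = n"
    and c: "E \<in> copies n (row_graph (grid_widths a b r)) (spine_adj True)"
    using models_columns[OF E h(1)] unfolding r_def by blast
  have "r < b + 2" using r m by simp
  note u = grid_params_unique[OF ab(2) this]
  have "b + 2 \<le> n - 3"
  proof -
    define c where "c = a * (b + 2)"
    have "b + 2 \<le> c" unfolding c_def using mult_le_mono1[OF ab(1), of "b + 2"] by (simp only: mult_1)
    moreover have "3 + r + c = n" using ab(2) by (simp only: c_def)
    ultimately show ?thesis by linarith
  qed
  then have "b \<in> grid_types m n" using u r by (simp add: grid_types_def)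
  moreover have "E \<in> copies n (grid n b) (spine_adj True)" using c u by (simp add: grid_def)
  ultimately show "E \<in> (\<Union>b\<in>grid_types m n. copies n (grid n b) (spine_adj True))" by blast
next
  fix E assume "E \<in> (\<Union>b\<in>grid_types m n. copies n (grid n b) (spine_adj True))"
  then obtain b where b: "b \<in> grid_types m n" and c: "E \<in> copies n (grid n b) (spine_adj True)" by blast
  have E: "E \<in> graphs_on n" using c by (simp add: copies_def)
  note nd = grid_types_nondegenerate[OF n b m]
  have "models n E fol_spine_columns" "models n E (fol_isolated_less m)"
    using valid_in_copies[OF c] sentence_spine sentence_isolated grid_valid[OF nd] grid_num_isolated(2)[OF nd] b
    unfolding grid_def grid_types_def by auto
  then show "E \<in> models_on (phi_grids m) n"
    using E models_large[OF n] by (simp add: models_on_def phi_grids_def models_Conj)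
qed

text \<open>The width of row 1 reveals b.\<close>

lemma grid_isom_unique:
  assumes n: "10 \<le> n" and m: "m \<le> 2" and b: "b \<in> grid_types m n" "b' \<in> grid_types m n"
    and g: "isom g (grid n b) (spine_adj True) (grid n b') (spine_adj True)"
  shows "b = b'"
proof -
  note nd = grid_types_nondegenerate[OF n b(1) m] and nd' = grid_types_nondegenerate[OF n b(2) m]
  have "grid_widths ((n - 3) div (b + 2)) b ((n - 3) mod (b + 2)) =
      grid_widths ((n - 3) div (b' + 2)) b' ((n - 3) mod (b' + 2))"
    using spine_isom_widths[OF spine_widths_grid[OF nd] spine_widths_grid[OF nd']] g unfolding grid_def by blast
  from fun_cong[OF this, of 1] show ?thesis using nd(1) nd'(1) by (simp add: grid_widths_def)
qed

lemma prob_phi_grids: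
  assumes n: "10 \<le> n" and m: "m \<le> 2" and ne: "grid_types m n \<noteq> {}" and \<psi>: "sentence \<psi>"
  shows "prob_seq (phi_grids m) \<psi> n =
    (\<Sum>b\<in>grid_types m n. if valid_in (grid n b) (spine_adj True) \<psi> then 1 / fact b else 0) / grid_total m n"
  unfolding grid_total_def
proof (rule prob_random_graph[OF simple_rel_spine_adj finite_grid_types ne])
  show "models_on (phi_grids m) n = (\<Union>b\<in>grid_types m n. copies n (grid n b) (spine_adj True))"
    by (rule models_on_phi_grids[OF n m])
  show "real (card (automorphisms (grid n b) (spine_adj True))) = fact b" if b: "b \<in> grid_types m n" for b
  proof -
    have "(n - 3) mod (b + 2) \<le> 1" using b m by (auto simp: grid_types_def)
    from grid_automorphisms[OF grid_types_nondegenerate[OF n b m] this] show ?thesis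
      unfolding grid_def by simp
  qed
  show "card (grid n b) = n" if "b \<in> grid_types m n" for b
    using that by (intro card_grid_eq) (simp add: grid_types_def)
qed (use grid_isom_unique[OF n m] \<psi> finite_grid_eq in auto)

text \<open>Parametrized by q = b + 2, so that for q >= 2 the type it identifies exists exactly when
  q divides n - 3.\<close>

definition fol_grid_type :: "nat \<Rightarrow> fol" where
  "fol_grid_type q = Conj (fol_num_columns (q - 2)) (fol_isolated_eq 0)"

lemma sentence_grid_type: "sentence (fol_grid_type q)"
  by (simp add: fol_grid_type_def sentence_num_columns sentence_isolated)

lemma prob_grid_type:
  assumes n: "10 \<le> n" and m: "1 \<le> m" "m \<le> 2" and ne: "grid_types m n \<noteq> {}" and q: "2 \<le> q"
  shows "prob_seq (phi_grids m) (fol_grid_type q) n = (if q dvd n - 3 then 1 / fact (q - 2) else 0) / grid_total m n"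
proof -
  have v: "valid_in (grid n b) (spine_adj True) (fol_grid_type q) \<longleftrightarrow> b = q - 2 \<and> q dvd n - 3"
    if b: "b \<in> grid_types m n" for b
  proof -
    note nd = grid_types_nondegenerate[OF n b m(2)]
    have "valid_in (grid n b) (spine_adj True) (fol_grid_type q) \<longleftrightarrow> q - 2 = b \<and> (n - 3) mod (b + 2) = 0"
      unfolding fol_grid_type_def valid_in_derived(2)[OF sentence_num_columns sentence_isolated(1)]
      unfolding grid_def grid_num_columns[OF nd] grid_num_isolated(1)[OF nd] ..
    moreover have "b + 2 = q" if "b = q - 2" using that q by simp
    ultimately show ?thesis by (metis mod_eq_0_iff_dvd)
  qed
  have mem: "q - 2 \<in> grid_types m n" if "q dvd n - 3"
  proof -
    have "q - 2 + 2 = q" using q by simp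
    then show ?thesis using that q n m dvd_imp_le[OF that] unfolding grid_types_def mem_Collect_eq by simp
  qed
  have "(\<Sum>b\<in>grid_types m n. if valid_in (grid n b) (spine_adj True) (fol_grid_type q) then 1 / fact b else (0::real)) =
     (\<Sum>b\<in>grid_types m n. if b = q - 2 then (if q dvd n - 3 then 1 / fact (q - 2) else 0) else 0)"
    by (intro sum.cong refl) (auto simp: v)
  also have "\<dots> = (if q dvd n - 3 then 1 / fact (q - 2) else 0)"
    using mem finite_grid_types by (simp add: sum.delta)
  finally show ?thesis using prob_phi_grids[OF n m(2) ne sentence_grid_type] by simp
qed

lemma conditionable_phi_grids:
  assumes m: "1 \<le> m" "m \<le> 2"
  shows "conditionable (phi_grids m)"
  unfolding conditionable_def
proof (intro conjI allI impI sentence_phi_grids)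
  fix n :: nat
  show "models_on (phi_grids m) n \<noteq> {}"
  proof (cases "n < 10")
    case True then show ?thesis unfolding phi_grids_def by (rule models_on_small)
  next
    case False
    then have "n - 5 + 2 = n - 3" by simp
    \<comment> \<open>A single row that uses up all n - 3 vertices, leaving none isolated.\<close>
    then have "n - 5 \<in> grid_types m n" using m unfolding grid_types_def mem_Collect_eq by simp
    then show ?thesis
      using copies_nonempty[OF simple_rel_spine_adj finite_grid_eq card_grid_eq, of "n - 5" n True] False m
      by (auto simp: models_on_phi_grids grid_types_def)
  qed
qed

lemma inverse_fact_sums: "(\<lambda>n. 1 / fact n :: real) sums exp 1"
  using exp_converges[of "1::real"] by (simp add: inverse_eq_divide)

lemma sum_inverse_fact_le: "finite B \<Longrightarrow> (\<Sum>b\<in>B. 1 / fact b) \<le> (3::real)"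
proof -
  assume "finite B"
  then have "(\<Sum>b\<in>B. 1 / fact b) \<le> (\<Sum>b. 1 / fact b :: real)"
    using inverse_fact_sums by (intro sum_le_suminf) (auto simp: sums_iff)
  also have "\<dots> = exp 1" using inverse_fact_sums by (simp add: sums_iff)
  also have "\<dots> \<le> 3" by (rule exp_le)
  finally show ?thesis .
qed

lemma grid_total_pos: "grid_types m n \<noteq> {} \<Longrightarrow> grid_total m n > 0"
  unfolding grid_total_def using finite_grid_types by (intro sum_pos) auto

lemma grid_total_le: "grid_total m n \<le> 3"
  unfolding grid_total_def by (rule sum_inverse_fact_le[OF finite_grid_types])

lemma prime_power_size:
  assumes "prime (q::nat)" "3 \<le> t"
  shows "10 \<le> 3 + q ^ t"
proof -
  have "(2::nat) ^ 3 \<le> 2 ^ t" using assms(2) by (intro power_increasing) auto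
  also have "\<dots> \<le> q ^ t" using prime_ge_2_nat[OF assms(1)] by (intro power_mono) auto
  finally show ?thesis by simp
qed

section \<open>No isolated vertices: failure of total boundedness\<close>

text \<open>The sentences for the primes q have pairwise distance at least 1/2. Such an infinite
  family cannot be covered by finitely many balls of radius 1/4.\<close>

lemma not_totally_bounded_phi_grids: "\<not> totally_bounded (FOC (random_graph (phi_grids 1)))"
proof
  assume tb: "totally_bounded (FOC (random_graph (phi_grids 1)))"
  define x where "x q = seq_class (prob_seq (phi_grids 1) (fol_grid_type q))" for q
  have sep: "1 / 2 \<le> dist (x q) (x q')" if q: "prime q" "prime q'" "q \<noteq> q'" for q q' :: nat
    unfolding x_def
  proof (rule dist_seq_class_ge[OF bounded_prob_seq bounded_prob_seq])
    have *: "1 / 2 \<le> \<bar>prob_seq (phi_grids 1) (fol_grid_type q) n - prob_seq (phi_grids 1) (fol_grid_type q') n\<bar>"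
      if n: "n = 3 + q ^ t" "3 \<le> t" for n t
    proof -
      have n10: "10 \<le> n" using prime_power_size[OF q(1) n(2)] n by simp
      have q2: "2 \<le> q" "2 \<le> q'" using q prime_ge_2_nat by auto
      have d: "q dvd n - 3" using n by (simp add: dvd_power)
      have d': "\<not> q' dvd n - 3"
        using n q primes_dvd_imp_eq[of q' q] prime_dvd_power_nat[of q' q t] by auto
      have mem: "q - 2 \<in> grid_types 1 n"
      proof -
        have "q - 2 + 2 = q" using q2 by simp
        then show ?thesis using d q2 n10 dvd_imp_le[OF d] unfolding grid_types_def mem_Collect_eq by simp
      qed
      then have ne: "grid_types 1 n \<noteq> {}" by auto
      \<comment> \<open>The number b + 2 divides a power of q, so it is q or at least
        \<open>q ^ 2\<close>. In the latter case it is at least q + 2, which gives the offset j >=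
        2.\<close>
      have sub: "grid_types 1 n \<subseteq> insert (q - 2) ((\<lambda>j. q - 2 + j) ` {2..n})"
      proof
        fix b assume b: "b \<in> grid_types 1 n"
        then have "b + 2 dvd q ^ t" using n by (auto simp: grid_types_def mod_eq_0_iff_dvd)
        then obtain i where i: "b + 2 = q ^ i" using divides_primepow_nat[OF q(1)] by auto
        have "i \<noteq> 0" using i by (cases i) auto
        show "b \<in> insert (q - 2) ((\<lambda>j. q - 2 + j) ` {2..n})"
        proof (cases "i = 1")
          case True
          then have "b = q - 2" using i by simp
          then show ?thesis by blast
        next
          case False
          then have "q ^ 2 \<le> q ^ i" using \<open>i \<noteq> 0\<close> q2 by (intro power_increasing) auto
          moreover have "2 * q \<le> q ^ 2" using q2 by (simp add: power2_eq_square)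
          ultimately have "q + 2 \<le> b + 2" using i q2 by linarith
          moreover have "b \<le> n" using b by (auto simp: grid_types_def)
          ultimately show ?thesis using q2 by (intro insertI2 image_eqI[of _ _ "b - (q - 2)"]) auto
        qed
      qed
      have "grid_total 1 n \<le> (\<Sum>b\<in>insert (q - 2) ((\<lambda>j. q - 2 + j) ` {2..n}). 1 / fact b)"
        unfolding grid_total_def by (rule sum_mono2[OF _ sub]) auto
      also have "\<dots> \<le> 1 / fact (q - 2) + (\<Sum>b\<in>(\<lambda>j. q - 2 + j) ` {2..n}. 1 / fact b)"
        by (subst sum.insert_if) auto
      also have "(\<Sum>b\<in>(\<lambda>j. q - 2 + j) ` {2..n}. 1 / fact b) = (\<Sum>j\<in>{2..n}. 1 / fact (q - 2 + j) :: real)"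
        by (subst sum.reindex) (auto simp: inj_on_def)
      also have "\<dots> \<le> (\<Sum>j\<in>{2..n}. 1 / fact (q - 2) * (1 / fact j))"
      proof (rule sum_mono)
        fix j
        \<comment> \<open>A binomial coefficient is an integer; this compares the tail with the
          exponential series, scaled by the weight of b = q - 2.\<close>
        have "fact (q - 2) * fact j \<le> (fact (q - 2 + j) :: nat)"
          using fact_fact_dvd_fact[of "q - 2" j] by (intro dvd_imp_le) auto
        then have "fact (q - 2) * fact j \<le> (fact (q - 2 + j) :: real)"
          by (metis of_nat_fact of_nat_le_iff of_nat_mult)
        then show "1 / fact (q - 2 + j) \<le> 1 / fact (q - 2) * (1 / fact j :: real)"
          by (simp add: frac_le)
      qed
      also have "\<dots> = 1 / fact (q - 2) * (\<Sum>j\<in>{2..n}. 1 / fact j)" by (simp add: sum_distrib_left)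
      also have "(\<Sum>j\<in>{2..n}. 1 / fact j) \<le> (1::real)"
      proof -
        have "insert 0 (insert 1 {2..n}) \<subseteq> {..n}" using n10 by auto
        \<comment> \<open>The terms for 0 and 1 account for 2 out of the bound 3.\<close>
        have "(\<Sum>j\<in>insert 0 (insert 1 {2..n}). 1 / fact j) \<le> (3::real)"
          by (rule sum_inverse_fact_le) simp
        then show ?thesis by simp
      qed
      finally have "grid_total 1 n \<le> 2 / fact (q - 2)" by (simp add: mult_left_le field_simps)
      then have "1 / 2 \<le> 1 / fact (q - 2) / grid_total 1 n"
        using grid_total_pos[OF ne] by (simp add: field_simps)
      moreover have "prob_seq (phi_grids 1) (fol_grid_type q) n = 1 / fact (q - 2) / grid_total 1 n"
        using prob_grid_type[OF n10 _ _ ne q2(1)] d by simp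
      moreover have "prob_seq (phi_grids 1) (fol_grid_type q') n = 0"
        using prob_grid_type[OF n10 _ _ ne q2(2)] d' by simp
      ultimately show ?thesis by linarith
    qed
    show "\<exists>\<^sub>F n in sequentially.
        1 / 2 \<le> \<bar>prob_seq (phi_grids 1) (fol_grid_type q) n - prob_seq (phi_grids 1) (fol_grid_type q') n\<bar>"
      unfolding frequently_def eventually_sequentially
    proof (rule notI, elim exE)
      fix N assume N: "\<forall>n\<ge>N. \<not> 1 / 2 \<le> \<bar>prob_seq (phi_grids 1) (fol_grid_type q) n - prob_seq (phi_grids 1) (fol_grid_type q') n\<bar>"
      have "N + 3 < q ^ (N + 3)" using prime_gt_1_nat[OF q(1)] by (intro power_gt_expt) simp
      then show False using N *[OF refl, of "N + 3"] by auto
    qed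
  qed
  \<comment> \<open>By the pigeonhole principle two primes share a ball, so their distance is below
    1/2.\<close>
  obtain k where k: "finite k" "FOC (random_graph (phi_grids 1)) \<subseteq> (\<Union>c\<in>k. {y. dist c y < 1 / 4})"
    using tb[unfolded totally_bounded_metric, rule_format, of "1 / 4"] by auto
  have "\<exists>c\<in>k. dist c (x q) < 1 / 4" for q
    using k(2) FOC_memI[OF sentence_grid_type[of q]] unfolding x_def by blast
  then obtain c where c: "\<And>q. c q \<in> k" "\<And>q. dist (c q) (x q) < 1 / 4" by metis
  have "finite (c ` {q. prime q})" using k(1) c(1) by (auto intro: finite_subset)
  then have "\<not> inj_on c {q::nat. prime q}" using primes_infinite finite_imageD by blast
  then obtain q q' where q: "prime q" "prime q'" "q \<noteq> q'" "c q = c q'" by (auto simp: inj_on_def)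
  have "dist (x q) (x q') \<le> dist (c q) (x q) + dist (c q) (x q')" by (rule dist_triangle3)
  also have "\<dots> < 1 / 4 + 1 / 4" using c(2)[of q] c(2)[of q'] q(4) by simp
  finally show False using sep[OF q(1-3)] by simp
qed

lemma grid_types_2_nonempty: "10 \<le> n \<Longrightarrow> 0 \<in> grid_types 2 n"
  unfolding grid_types_def by (simp add: numeral_2_eq_2[symmetric] del: One_nat_def)

text \<open>The type b = 0 has weight 1. No such uniform bound holds for m = 1, where all admissible
  b may be large.\<close>

lemma grid_total_2_ge: "10 \<le> n \<Longrightarrow> 1 \<le> grid_total 2 n"
  unfolding grid_total_def
  using member_le_sum[of 0 "grid_types 2 n" "\<lambda>b. 1 / fact b :: real"] grid_types_2_nonempty finite_grid_types by simp

section \<open>At most one isolated vertex: infinite dimension and total boundedness\<close>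

text \<open>Along \<open>n = 3 + q ^ t\<close> the sentences for all primes other than q have
  probability 0, while the one for q stays above a positive constant. Hence every coefficient of a
  linear relation vanishes.\<close>

lemma infinite_dim_phi_grids: "\<not> (\<exists>B. finite B \<and> span B = span (FOC (random_graph (phi_grids 2))))"
proof
  assume "\<exists>B. finite B \<and> span B = span (FOC (random_graph (phi_grids 2)))"
  then obtain B where B: "finite B" "span B = span (FOC (random_graph (phi_grids 2)))" by blast
  define x where "x q = seq_class (prob_seq (phi_grids 2) (fol_grid_type q))" for q
  have fam: "c q = 0" if h: "finite F" "F \<subseteq> {q::nat. prime q}" "(\<Sum>q\<in>F. c q *\<^sub>R x q) = 0" "q \<in> F" for F c q
  proof -
    have q: "prime q" using h by auto
    let ?s = "\<lambda>n. \<Sum>p\<in>F. c p * prob_seq (phi_grids 2) (fol_grid_type p) n"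
    have "seq_class ?s = seq_class (\<lambda>n. 0)"
      using h(3) unfolding seq_class_zero x_def by (subst seq_class_sum) (auto intro: bounded_prob_seq)
    then have "(\<lambda>n. ?s n - 0) \<longlonglongrightarrow> 0"
      by (subst (asm) seq_class_eq_iff) (auto intro!: bounded_range_sum bounded_range_cmult bounded_prob_seq)
    moreover have "filterlim (\<lambda>t. 3 + q ^ (t + 3)) sequentially sequentially"
      using prime_gt_1_nat[OF q] by (intro filterlim_subseq) (auto simp: strict_mono_def)
    ultimately have "(\<lambda>t. ?s (3 + q ^ (t + 3)) - 0) \<longlonglongrightarrow> 0"
      by (rule filterlim_compose)
    then have lim: "(\<lambda>t. \<bar>?s (3 + q ^ (t + 3))\<bar>) \<longlonglongrightarrow> 0" by (simp add: tendsto_rabs_zero)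
    have "\<bar>c q\<bar> / (fact (q - 2) * 3) \<le> \<bar>?s (3 + q ^ (t + 3))\<bar>" for t
    proof -
      define n where "n = 3 + q ^ (t + 3)"
      have n10: "10 \<le> n" using prime_power_size[OF q, of "t + 3"] by (simp add: n_def)
      have ne: "grid_types 2 n \<noteq> {}" using grid_types_2_nonempty[OF n10] by auto
      have "prob_seq (phi_grids 2) (fol_grid_type p) n = (if p = q then 1 / fact (q - 2) / grid_total 2 n else 0)"
        if "p \<in> F" for p
      proof -
        have p: "prime p" using h that by auto
        have "p dvd n - 3 \<longleftrightarrow> p = q"
          using p q primes_dvd_imp_eq[of p q] prime_dvd_power_nat[of p q "t + 3"]
          by (auto simp: n_def dvd_power)
        then show ?thesis using prob_grid_type[OF n10 _ _ ne prime_ge_2_nat[OF p]] by simp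
      qed
      then have "?s n = (\<Sum>p\<in>F. if p = q then c q * (1 / fact (q - 2) / grid_total 2 n) else 0)"
        by (intro sum.cong) auto
      also have "\<dots> = c q * (1 / fact (q - 2) / grid_total 2 n)" using h by simp
      finally have "\<bar>?s n\<bar> = \<bar>c q\<bar> / (fact (q - 2) * grid_total 2 n)"
        using grid_total_pos[OF ne] by (simp add: abs_mult)
      also have "\<dots> \<ge> \<bar>c q\<bar> / (fact (q - 2) * 3)"
        using grid_total_pos[OF ne] grid_total_le[of 2 n] by (intro divide_left_mono mult_left_mono) auto
      finally show ?thesis by (simp add: n_def)
    qed
    then have "\<bar>c q\<bar> / (fact (q - 2) * 3) \<le> 0" by (intro LIMSEQ_le_const[OF lim]) auto
    moreover have "0 < (fact (q - 2) * 3 :: real)" by simp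
    ultimately have "\<bar>c q\<bar> \<le> 0" by (simp only: divide_le_0_iff) linarith
    then show "c q = 0" by simp
  qed
  have "inj_on x {q. prime q}" "independent (x ` {q. prime q})"
    using independent_family[of "{q. prime q}" x] fam by blast+
  moreover have "x ` {q. prime q} \<subseteq> span B"
    unfolding B(2) x_def using FOC_memI[OF sentence_grid_type] by (auto intro: span_base)
  ultimately have "finite (x ` {q. prime q})" using independent_span_bound[OF B(1)] by blast
  then show False using \<open>inj_on x {q. prime q}\<close> primes_infinite finite_imageD by blast
qed

text \<open>Up to a uniformly small tail a sentence matters only through its stable truth values for
  the finitely many pairs of b < K and r < 2. The sets of such pairs yield a finite net.\<close>

lemma totally_bounded_phi_grids: "totally_bounded (FOC (random_graph (phi_grids 2)))"
  unfolding totally_bounded_metric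
proof (intro allI impI)
  fix e :: real assume e: "e > 0"
  have "(\<lambda>K. \<Sum>b. 1 / fact (b + K) :: real) \<longlonglongrightarrow> 0"
    using suminf_exist_split2[of "\<lambda>b. 1 / fact b :: real"] inverse_fact_sums by (simp add: sums_iff)
  from order_tendstoD(2)[OF this, of "e / 2"] e obtain K where K: "(\<Sum>b. 1 / fact (b + K) :: real) < e / 2"
    by (auto simp: eventually_sequentially)
  \<comment> \<open>The limiting behaviour of a sentence that ultimately holds exactly for the pairs
    in \<open>\<theta>\<close>, cut off at K columns.\<close>
  define s where "s \<theta> n = (\<Sum>b\<in>grid_types 2 n \<inter> {..<K}. if (b, (n - 3) mod (b + 2)) \<in> \<theta> then 1 / fact b else 0) / grid_total 2 n"
    for \<theta> :: "(nat \<times> nat) set" and n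
  have s_nonneg: "0 \<le> s \<theta> n" for \<theta> n
    unfolding s_def grid_total_def by (intro divide_nonneg_nonneg sum_nonneg) auto
  have s_le: "s \<theta> n \<le> 1" for \<theta> n
  proof -
    have "(\<Sum>b\<in>grid_types 2 n \<inter> {..<K}. if (b, (n - 3) mod (b + 2)) \<in> \<theta> then 1 / fact b else (0::real)) \<le>
        (\<Sum>b\<in>grid_types 2 n \<inter> {..<K}. 1 / fact b)" by (intro sum_mono) auto
    also have "\<dots> \<le> grid_total 2 n"
      unfolding grid_total_def using finite_grid_types by (intro sum_mono2) auto
    finally show ?thesis unfolding s_def
      by (cases "grid_total 2 n = 0") (auto simp: divide_le_eq_1 less_le grid_total_def intro!: sum_nonneg)
  qed
  have bs: "bounded (range (s \<theta>))" for \<theta>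
    unfolding bounded_iff using s_nonneg s_le by (intro exI[of _ 1]) simp
  let ?k = "(\<lambda>\<theta>. seq_class (s \<theta>)) ` Pow ({..<K} \<times> {..<2})"
  have "FOC (random_graph (phi_grids 2)) \<subseteq> (\<Union>c\<in>?k. {y. dist c y < e})"
  proof
    fix y assume "y \<in> FOC (random_graph (phi_grids 2))"
    then obtain \<psi> where \<psi>: "sentence \<psi>" "y = seq_class (prob_seq (phi_grids 2) \<psi>)" by (auto simp: FOC_def)
    define Q where "Q = (2::nat) ^ qrank \<psi>"
    define \<theta> where "\<theta> = {(b, r) \<in> {..<K} \<times> {..<2}. valid_in (row_graph (grid_widths Q b r)) (spine_adj True) \<psi>}"
    have "dist (seq_class (s \<theta>)) (seq_class (prob_seq (phi_grids 2) \<psi>)) \<le> e / 2"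
    proof (rule dist_seq_class_le[OF bs bounded_prob_seq], rule eventually_sequentiallyI)
      \<comment> \<open>Large enough for at least Q rows in all grids with fewer than K columns
        simultaneously.\<close>
      fix n assume n: "10 + (K + 2) * Q \<le> n"
      then have n10: "10 \<le> n" by simp
      have ne: "grid_types 2 n \<noteq> {}" using grid_types_2_nonempty[OF n10] by auto
      let ?T = "grid_types 2 n"
      let ?f = "\<lambda>b. if valid_in (grid n b) (spine_adj True) \<psi> then 1 / fact b else (0::real)"
      have st: "valid_in (grid n b) (spine_adj True) \<psi> \<longleftrightarrow> (b, (n - 3) mod (b + 2)) \<in> \<theta>"
        if b: "b \<in> ?T \<inter> {..<K}" for b
      proof -
        have "Q * (b + 2) \<le> Q * (K + 2)" using b by auto
        moreover have "Q * (K + 2) = (K + 2) * Q" by (rule mult.commute)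
        ultimately have "Q * (b + 2) \<le> n - 3" using n by linarith
        then have "Q \<le> (n - 3) div (b + 2)" by (simp add: less_eq_div_iff_mult_less_eq)
        from grid_stable[OF \<psi>(1) this[unfolded Q_def] order.refl] show ?thesis
          using b unfolding grid_def \<theta>_def Q_def by (auto simp: grid_types_def)
      qed
      have "prob_seq (phi_grids 2) \<psi> n = (\<Sum>b\<in>?T. ?f b) / grid_total 2 n"
        by (rule prob_phi_grids[OF n10 _ ne \<psi>(1)]) simp
      also have "(\<Sum>b\<in>?T. ?f b) = (\<Sum>b\<in>?T \<inter> {..<K}. ?f b) + (\<Sum>b\<in>?T - {..<K}. ?f b)"
        by (subst sum.Int_Diff[of ?T _ "{..<K}"]) (auto simp: finite_grid_types)
      also have "(\<Sum>b\<in>?T \<inter> {..<K}. ?f b) = (\<Sum>b\<in>?T \<inter> {..<K}. if (b, (n - 3) mod (b + 2)) \<in> \<theta> then 1 / fact b else 0)"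
        by (intro sum.cong refl) (simp add: st)
      finally have eq: "prob_seq (phi_grids 2) \<psi> n = s \<theta> n + (\<Sum>b\<in>?T - {..<K}. ?f b) / grid_total 2 n"
        by (simp add: s_def add_divide_distrib)
      have nn: "0 \<le> (\<Sum>b\<in>?T - {..<K}. ?f b)" by (intro sum_nonneg) auto
      have "(\<Sum>b\<in>?T - {..<K}. ?f b) \<le> (\<Sum>b\<in>?T - {..<K}. 1 / fact b)" by (intro sum_mono) auto
      also have "\<dots> = (\<Sum>b\<in>(\<lambda>b. b - K) ` (?T - {..<K}). 1 / fact (b + K))"
        by (subst sum.reindex) (auto simp: inj_on_def intro!: sum.cong)
      also have "\<dots> \<le> (\<Sum>b. 1 / fact (b + K) :: real)"
        using summable_ignore_initial_segment[of "\<lambda>b. 1 / fact b :: real" K] inverse_fact_sums finite_grid_types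
        by (intro sum_le_suminf) (auto simp: sums_iff)
      finally have "(\<Sum>b\<in>?T - {..<K}. ?f b) \<le> e / 2" using K by simp
      then have "(\<Sum>b\<in>?T - {..<K}. ?f b) / grid_total 2 n \<le> e / 2"
        using grid_total_2_ge[OF n10] nn
        by (smt (verit, best) divide_le_eq_1 frac_le div_by_1)
      moreover have "0 \<le> (\<Sum>b\<in>?T - {..<K}. ?f b) / grid_total 2 n"
        using nn grid_total_pos[OF ne] by simp
      ultimately show "\<bar>s \<theta> n - prob_seq (phi_grids 2) \<psi> n\<bar> \<le> e / 2" unfolding eq by simp
    qed
    then have "dist (seq_class (s \<theta>)) y < e" using e \<psi>(2) by simp
    moreover have "\<theta> \<in> Pow ({..<K} \<times> {..<2})" by (auto simp: \<theta>_def)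
    ultimately show "y \<in> (\<Union>c\<in>?k. {y. dist c y < e})" by blast
  qed
  moreover have "finite ?k" by simp
  ultimately show "\<exists>k. finite k \<and> FOC (random_graph (phi_grids 2)) \<subseteq> (\<Union>c\<in>k. {y. dist c y < e})" by blast
qed

section \<open>Spines with layers\<close>

definition phi_layers :: fol where
  "phi_layers = Or (fol_small 10) fol_spine_layered"

text \<open>The solutions of \<open>3 + 4k + 3p + 2q = n\<close>, \<open>q \<ge> 1\<close>, are \<open>p = 2s + parity n\<close>,
  \<open>q = half_size n - 2k - 3s\<close> for \<open>2k + 3s < half_size n\<close>.\<close>

definition parity :: "nat \<Rightarrow> nat" where
  "parity n = (n - 3) mod 2"

definition half_size :: "nat \<Rightarrow> nat" where
  "half_size n = (n - 3) div 2 - parity n"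

definition layer_types :: "nat \<Rightarrow> (nat \<times> nat) set" where
  "layer_types n = (SIGMA k:{..<half_size n}. {s. 2 * k + 3 * s < half_size n})"

definition layer_graph :: "nat \<Rightarrow> nat \<times> nat \<Rightarrow> (nat \<times> nat) set" where
  "layer_graph n = (\<lambda>(k, s). row_graph (layer_widths k (2 * s + parity n) (half_size n - 2 * k - 3 * s)))"

text \<open>The bound on n keeps the subtraction in \<open>half_size\<close> from being
  truncated.\<close>

lemma half_size_eq:
  assumes "10 \<le> n"
  shows "n = 3 + 3 * parity n + 2 * half_size n" "0 < half_size n"
proof -
  define d where "d = (n - 3) div 2"
  have "d * 2 + parity n = n - 3" unfolding d_def parity_def by (rule div_mult_mod_eq)
  moreover have "parity n < 2" by (simp add: parity_def)
  ultimately show "n = 3 + 3 * parity n + 2 * half_size n" "0 < half_size n"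
    using assms unfolding half_size_def d_def[symmetric] by linarith+
qed

lemma layer_types_iff: "(k, s) \<in> layer_types n \<longleftrightarrow> 2 * k + 3 * s < half_size n"
  by (auto simp: layer_types_def)

lemma finite_layer_types: "finite (layer_types n)"
proof -
  have "{s. 2 * k + 3 * s < half_size n} \<subseteq> {..<half_size n}" for k by auto
  then show ?thesis unfolding layer_types_def by (auto intro: finite_subset)
qed

lemma layer_types_nondegenerate:
  assumes "10 \<le> n" "(k, s) \<in> layer_types n"
  shows "1 \<le> half_size n - 2 * k - 3 * s" "2 \<le> k + (2 * s + parity n) + (half_size n - 2 * k - 3 * s)"
    "3 + 4 * k + 3 * (2 * s + parity n) + 2 * (half_size n - 2 * k - 3 * s) = n"
proof -
  have h: "2 * k + 3 * s < half_size n" using assms(2) by (simp add: layer_types_iff)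
  note e = half_size_eq(1)[OF assms(1)]
  show "1 \<le> half_size n - 2 * k - 3 * s" using h by simp
  show 3: "3 + 4 * k + 3 * (2 * s + parity n) + 2 * (half_size n - 2 * k - 3 * s) = n" using h e by simp
  define P Q where "P = 2 * s + parity n" and "Q = half_size n - 2 * k - 3 * s"
  have "2 \<le> k + P + Q" using 3 assms(1) unfolding P_def[symmetric] Q_def[symmetric] by linarith
  then show "2 \<le> k + (2 * s + parity n) + (half_size n - 2 * k - 3 * s)" by (simp only: P_def Q_def)
qed

lemma sentence_phi_layers: "sentence phi_layers"
  by (simp add: phi_layers_def sentence_small sentence_spine)

lemma layer_graph_card: "10 \<le> n \<Longrightarrow> t \<in> layer_types n \<Longrightarrow> card (layer_graph n t) = n"
  using layer_types_nondegenerate(3) by (cases t) (simp add: layer_graph_def card_layer)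

lemma layer_graph_finite: "finite (layer_graph n t)"
  by (cases t) (simp add: layer_graph_def finite_layer)

lemma models_on_phi_layers:
  assumes n: "10 \<le> n"
  shows "models_on phi_layers n = (\<Union>t\<in>layer_types n. copies n (layer_graph n t) (spine_adj False))"
proof (intro subset_antisym subsetI)
  fix E assume "E \<in> models_on phi_layers n"
  then have E: "E \<in> graphs_on n" and "models n E fol_spine_layered"
    using models_large[OF n] by (auto simp: models_on_def phi_layers_def)
  then obtain k p q where h: "1 \<le> q" "3 + 4 * k + 3 * p + 2 * q = n"
    and c: "E \<in> copies n (row_graph (layer_widths k p q)) (spine_adj False)"
    using models_layered_iff[OF n E] by blast
  define s where "s = p div 2"
  have "n - 3 = p + 2 * (2 * k + p + q)" using h(2) by simp
  then have "parity n = p mod 2" unfolding parity_def by (simp only: mod_mult_self2)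
  then have p: "p = 2 * s + parity n" by (simp add: s_def)
  have q: "half_size n = 2 * k + 3 * s + q" using half_size_eq(1)[OF n] h(2) p by linarith
  have "(k, s) \<in> layer_types n" using q h(1) by (simp add: layer_types_iff)
  moreover have "E \<in> copies n (layer_graph n (k, s)) (spine_adj False)"
    using c p q by (simp add: layer_graph_def)
  ultimately show "E \<in> (\<Union>t\<in>layer_types n. copies n (layer_graph n t) (spine_adj False))" by blast
next
  fix E assume "E \<in> (\<Union>t\<in>layer_types n. copies n (layer_graph n t) (spine_adj False))"
  then obtain k s where t: "(k, s) \<in> layer_types n" and c: "E \<in> copies n (layer_graph n (k, s)) (spine_adj False)"
    by auto
  have E: "E \<in> graphs_on n" using c by (simp add: copies_def)
  have "models n E fol_spine_layered"
    using models_layered_iff[OF n E] layer_types_nondegenerate[OF n t] c unfolding layer_graph_def by auto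
  then show "E \<in> models_on phi_layers n"
    using E models_large[OF n] by (simp add: models_on_def phi_layers_def)
qed

lemma layer_widths_inject:
  assumes "layer_widths k p q = layer_widths k' p' q'"
  shows "k = k'" "p = p'"
proof -
  have "{i. layer_widths k p q i = 4} = {1..k}" "{i. 0 < i \<and> 3 \<le> layer_widths k p q i} = {1..k + p}" for k p q
    by (auto simp: layer_widths_def split: if_splits)
  then have "{1..k} = {1..k'}" "{1..k + p} = {1..k' + p'}" using assms by metis+
  then have "card {1..k} = card {1..k'}" "card {1..k + p} = card {1..k' + p'}" by (simp_all only:)
  then show "k = k'" "p = p'" by simp_all
qed

lemma layer_isom_unique:
  assumes n: "10 \<le> n" and t: "t \<in> layer_types n" "t' \<in> layer_types n"
    and g: "isom g (layer_graph n t) (spine_adj False) (layer_graph n t') (spine_adj False)"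
  shows "t = t'"
proof -
  obtain k s k' s' where ks: "t = (k, s)" "t' = (k', s')" by force
  note nd = layer_types_nondegenerate[OF n t(1)[unfolded ks]]
    and nd' = layer_types_nondegenerate[OF n t(2)[unfolded ks]]
  have "layer_widths k (2 * s + parity n) (half_size n - 2 * k - 3 * s) =
      layer_widths k' (2 * s' + parity n) (half_size n - 2 * k' - 3 * s')"
    using spine_isom_widths[OF spine_widths_layer[OF nd(1,2)] spine_widths_layer[OF nd'(1,2)]] g
    unfolding layer_graph_def ks by auto
  from layer_widths_inject[OF this] show ?thesis by (simp add: ks)
qed

section \<open>The limit distribution of the number of rows with two leaves\<close>

definition layer_count :: "fol \<Rightarrow> nat \<Rightarrow> nat \<Rightarrow> nat" where
  "layer_count \<psi> n k = card {s. 2 * k + 3 * s < half_size n \<and> valid_in (layer_graph n (k, s)) (spine_adj False) \<psi>}"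

text \<open>Only finitely many terms are nonzero. The form of a series, normalized by
  \<open>half_size n\<close>, is chosen so that the limit can be taken term by term.\<close>

definition layer_sum :: "fol \<Rightarrow> nat \<Rightarrow> real" where
  "layer_sum \<psi> n = (\<Sum>k. (1 / 2) ^ k * (layer_count \<psi> n k / half_size n))"

lemma finite_layer_row: "finite {s. 2 * k + 3 * s < (h::nat)}"
  by (rule finite_subset[of _ "{..<h}"]) auto

lemma layer_sum_eq:
  assumes n: "10 \<le> n"
  shows "(\<Sum>t\<in>layer_types n. if valid_in (layer_graph n t) (spine_adj False) \<psi> then 1 / 2 ^ fst t else 0) =
    half_size n * layer_sum \<psi> n"
proof -
  let ?v = "\<lambda>k s. valid_in (layer_graph n (k, s)) (spine_adj False) \<psi>"
  let ?h = "half_size n"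
  have row: "(\<Sum>s\<in>{s. 2 * k + 3 * s < ?h}. if ?v k s then 1 / 2 ^ k else (0::real)) = (1 / 2) ^ k * layer_count \<psi> n k" for k
  proof -
    have "(\<Sum>s\<in>{s. 2 * k + 3 * s < ?h}. if ?v k s then 1 / 2 ^ k else (0::real)) =
        (\<Sum>s\<in>{s \<in> {s. 2 * k + 3 * s < ?h}. ?v k s}. 1 / 2 ^ k)"
      by (rule sum.inter_filter[symmetric]) (rule finite_layer_row)
    also have "\<dots> = layer_count \<psi> n k * (1 / 2 ^ k)" by (simp add: layer_count_def)
    finally show ?thesis by (simp add: power_one_over)
  qed
  have "(\<Sum>t\<in>layer_types n. if valid_in (layer_graph n t) (spine_adj False) \<psi> then 1 / 2 ^ fst t else (0::real)) =
      (\<Sum>k<?h. \<Sum>s\<in>{s. 2 * k + 3 * s < ?h}. if ?v k s then 1 / 2 ^ k else 0)"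
    unfolding layer_types_def by (subst sum.Sigma) (auto simp: finite_layer_row intro!: sum.cong)
  also have "\<dots> = (\<Sum>k<?h. (1 / 2) ^ k * layer_count \<psi> n k)" by (simp add: row)
  also have "\<dots> = (\<Sum>k<?h. ?h * ((1 / 2) ^ k * (layer_count \<psi> n k / ?h)))"
    using half_size_eq(2)[OF n] by (intro sum.cong) auto
  also have "\<dots> = ?h * (\<Sum>k<?h. (1 / 2) ^ k * (layer_count \<psi> n k / ?h))"
    by (simp add: sum_distrib_left)
  also have "(\<Sum>k<?h. (1 / 2) ^ k * (layer_count \<psi> n k / ?h)) = layer_sum \<psi> n"
    unfolding layer_sum_def
  proof (rule suminf_finite[symmetric])
    fix k assume "k \<notin> {..<?h}"
    then have "{s. 2 * k + 3 * s < ?h \<and> ?v k s} = {}" by auto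
    then have "layer_count \<psi> n k = 0" unfolding layer_count_def by (simp only: card.empty)
    then show "(1 / 2) ^ k * (layer_count \<psi> n k / ?h) = 0" by simp
  qed simp
  finally show ?thesis .
qed

lemma prob_phi_layers:
  assumes n: "10 \<le> n" and \<psi>: "sentence \<psi>"
  shows "prob_seq phi_layers \<psi> n = layer_sum \<psi> n / layer_sum Tru n"
proof -
  have tru: "valid_in D A Tru" for D :: "(nat \<times> nat) set" and A by (simp add: valid_in_def)
  have "prob_seq phi_layers \<psi> n =
      (\<Sum>t\<in>layer_types n. if valid_in (layer_graph n t) (spine_adj False) \<psi> then 1 / 2 ^ fst t else 0) /
      (\<Sum>t\<in>layer_types n. 1 / 2 ^ fst t)"
  proof (rule prob_random_graph[OF simple_rel_spine_adj finite_layer_types _ layer_graph_finite layer_graph_card[OF n] _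
      models_on_phi_layers[OF n] _ \<psi>])
    show "layer_types n \<noteq> {}" using layer_types_iff[of 0 0 n] half_size_eq(2)[OF n] by auto
    show "real (card (automorphisms (layer_graph n t) (spine_adj False))) = 2 ^ fst t" if t: "t \<in> layer_types n" for t
    proof -
      obtain k s where ks: "t = (k, s)" by force
      from layer_automorphisms[OF layer_types_nondegenerate(1,2)[OF n t[unfolded ks]]] show ?thesis
        by (simp add: ks layer_graph_def)
    qed
  qed (use layer_isom_unique[OF n] in auto)
  also have "(\<Sum>t\<in>layer_types n. 1 / 2 ^ fst t) = half_size n * layer_sum Tru n"
    using layer_sum_eq[OF n, of Tru] by (simp add: tru)
  finally show ?thesis using layer_sum_eq[OF n, of \<psi>] half_size_eq(2)[OF n] by simp
qed

text \<open>The truth value of the sentence for k when both remaining layers are long; by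
  \<open>layer_stable\<close> any lengths beyond the threshold give the same value.\<close>

definition layer_limit :: "fol \<Rightarrow> nat \<Rightarrow> bool" where
  "layer_limit \<psi> k \<longleftrightarrow> valid_in (row_graph (layer_widths k (2 ^ qrank \<psi>) (2 ^ qrank \<psi>))) (spine_adj False) \<psi>"

text \<open>The number of s is (h - 2k) / 3 rounded up.\<close>

lemma card_layer_row:
  "3 * card {s. 2 * k + 3 * s < (h::nat)} \<le> h + 2" "h \<le> 2 * k + 3 * card {s. 2 * k + 3 * s < h}"
proof -
  define d where "d = h - 2 * k"
  have "2 * k + 3 * s < h \<longleftrightarrow> s < (d + 2) div 3" for s
    using less_eq_div_iff_mult_less_eq[of 3 "Suc s" "d + 2"] by (auto simp: d_def Suc_le_eq)
  then have "{s. 2 * k + 3 * s < h} = {..<(d + 2) div 3}" by auto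
  then have c: "card {s. 2 * k + 3 * s < h} = (d + 2) div 3" by simp
  define e where "e = (d + 2) div 3"
  have "3 * e + (d + 2) mod 3 = d + 2" "(d + 2) mod 3 < 3" unfolding e_def by simp_all
  then show "3 * card {s. 2 * k + 3 * s < h} \<le> h + 2" "h \<le> 2 * k + 3 * card {s. 2 * k + 3 * s < h}"
    unfolding c e_def[symmetric] using d_def by linarith+
qed

text \<open>For all but boundedly many s both p and q exceed the threshold of the sentence, and then
  its truth depends on k only.\<close>

lemma layer_count_estimate:
  assumes n: "10 \<le> n" and \<psi>: "sentence \<psi>"
  shows "\<bar>layer_count \<psi> n k - of_bool (layer_limit \<psi> k) * (half_size n / 3)\<bar> \<le> 2 * 2 ^ qrank \<psi> + 2 * real k + 1"
proof -
  define Q where "Q = (2::nat) ^ qrank \<psi>"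
  define h where "h = half_size n"
  define B where "B = {s. 2 * k + 3 * s < h}"
  define W where "W = {s \<in> B. valid_in (layer_graph n (k, s)) (spine_adj False) \<psi>}"
  \<comment> \<open>The exceptional s: the first set contains all s with p below Q, the second is
    the set of s with q below Q. Each has at most Q elements.\<close>
  define X where "X = {..<Q} \<union> {s \<in> B. h - 2 * k - 3 * s < Q}"
  have fin: "finite B" "finite X" "finite W" unfolding B_def W_def X_def by (auto simp: finite_layer_row)
  have count: "layer_count \<psi> n k = card W" by (simp add: layer_count_def W_def B_def h_def)
  have good: "s \<in> W \<longleftrightarrow> layer_limit \<psi> k" if "s \<in> B" "s \<notin> X" for s
  proof -
    have "2 ^ qrank \<psi> \<le> 2 * s + parity n" "2 ^ qrank \<psi> \<le> h - 2 * k - 3 * s"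
      using that by (auto simp: X_def Q_def)
    from layer_stable[OF \<psi> this order.refl order.refl] show ?thesis
      using that by (simp add: W_def layer_limit_def layer_graph_def h_def)
  qed
  have cX: "card X \<le> 2 * Q"
  proof -
    have inj: "inj_on (\<lambda>s. h - 2 * k - 3 * s) {s \<in> B. h - 2 * k - 3 * s < Q}"
      by (auto simp: inj_on_def B_def)
    have "card {s \<in> B. h - 2 * k - 3 * s < Q} \<le> card {..<Q}"
      by (rule card_inj_on_le[OF inj]) auto
    then show ?thesis unfolding X_def using card_Un_le[of "{..<Q}" "{s \<in> B. h - 2 * k - 3 * s < Q}"] by simp
  qed
  have cB: "3 * real (card B) \<le> real h + 2" "real h \<le> 2 * real k + 3 * real (card B)"
    using card_layer_row[where k = k and h = h] unfolding B_def[symmetric] by linarith+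
  have Q: "real Q = 2 ^ qrank \<psi>" by (simp add: Q_def)
  show ?thesis
  proof (cases "layer_limit \<psi> k")
    case True
    have "card W \<le> card B" using fin by (intro card_mono) (auto simp: W_def)
    moreover have "B \<subseteq> W \<union> X" using good True by blast
    then have "card B \<le> card (W \<union> X)" using fin by (intro card_mono) auto
    then have "card B \<le> card W + 2 * Q" using card_Un_le[of W X] cX by linarith
    ultimately have "real (card W) \<le> card B" "real (card B) \<le> card W + 2 * Q" by linarith+
    then show ?thesis using cB True unfolding count h_def[symmetric] Q[symmetric] by (simp add: abs_le_iff)
  next
    case False
    have "W \<subseteq> X" using good False by (auto simp: W_def)
    from card_mono[OF fin(2) this] have "card W \<le> 2 * Q" using cX by linarith
    then have "real (card W) \<le> 2 * Q" by linarith
    then show ?thesis using False unfolding count Q[symmetric] by simp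
  qed
qed

lemma half_size_at_top: "filterlim (\<lambda>n. real (half_size n)) at_top sequentially"
proof (rule filterlim_at_top_mono)
  show "filterlim (\<lambda>n. real n / 2 - 4) at_top sequentially" by real_asymp
  show "\<forall>\<^sub>F n in sequentially. real n / 2 - 4 \<le> real (half_size n)"
  proof (rule eventually_sequentiallyI)
    fix n :: nat assume "10 \<le> n"
    from half_size_eq(1)[OF this] have "n \<le> 8 + 2 * half_size n" by (simp add: parity_def)
    then show "real n / 2 - 4 \<le> real (half_size n)" by linarith
  qed
qed

lemma layer_count_limit:
  assumes \<psi>: "sentence \<psi>"
  shows "(\<lambda>n. layer_count \<psi> n k / half_size n) \<longlonglongrightarrow> of_bool (layer_limit \<psi> k) / 3"
proof -
  let ?C = "2 * 2 ^ qrank \<psi> + 2 * real k + 1"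
  have "(\<lambda>n. layer_count \<psi> n k / half_size n - of_bool (layer_limit \<psi> k) / 3) \<longlonglongrightarrow> 0"
  proof (rule Lim_null_comparison)
    show "\<forall>\<^sub>F n in sequentially. norm (layer_count \<psi> n k / half_size n - of_bool (layer_limit \<psi> k) / 3) \<le> ?C / half_size n"
    proof (rule eventually_sequentiallyI)
      fix n :: nat assume n: "10 \<le> n"
      have h: "real (half_size n) > 0" using half_size_eq(2)[OF n] by simp
      have "layer_count \<psi> n k / half_size n - of_bool (layer_limit \<psi> k) / 3 =
          (layer_count \<psi> n k - of_bool (layer_limit \<psi> k) * (half_size n / 3)) / half_size n"
        using h by (simp add: diff_divide_distrib)
      then show "norm (layer_count \<psi> n k / half_size n - of_bool (layer_limit \<psi> k) / 3) \<le> ?C / half_size n"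
        using layer_count_estimate[OF n \<psi>, of k] h by (simp only: real_norm_def abs_divide) (simp add: divide_right_mono)
    qed
    show "(\<lambda>n. ?C / half_size n) \<longlonglongrightarrow> 0"
      by (rule tendsto_divide_0[OF tendsto_const filterlim_at_top_imp_at_infinity[OF half_size_at_top]])
  qed
  then show ?thesis by (simp add: LIM_zero_iff)
qed

text \<open>Dominated convergence for series: the counts are at most \<open>half_size n\<close>, so
  the geometric series dominates.\<close>

lemma layer_sum_limit:
  assumes \<psi>: "sentence \<psi>"
  shows "layer_sum \<psi> \<longlonglongrightarrow> (\<Sum>k. (1 / 2) ^ k * (of_bool (layer_limit \<psi> k) / 3))"
proof -
  have count_le: "layer_count \<psi> n k \<le> half_size n" for n k
  proof -
    have "layer_count \<psi> n k \<le> card {..<half_size n}"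
      unfolding layer_count_def by (rule card_mono) auto
    then show ?thesis by simp
  qed
  have "norm ((1 / 2) ^ k * (layer_count \<psi> n k / half_size n)) \<le> (1 / 2 :: real) ^ k" for k n
  proof -
    have "real (layer_count \<psi> n k) / real (half_size n) \<le> 1"
      using count_le[of n k] by (cases "half_size n = 0") (auto simp: divide_le_eq_1)
    then show ?thesis by (simp only: norm_mult norm_power norm_divide norm_one norm_numeral norm_of_nat)
        (rule mult_left_le, auto)
  qed
  then have "eventually (\<lambda>(k, n). norm ((1 / 2) ^ k * (layer_count \<psi> n k / half_size n)) \<le> (1 / 2 :: real) ^ k)
      (at_top \<times>\<^sub>F sequentially)" by (intro always_eventually) auto
  moreover have "summable (\<lambda>k. (1 / 2 :: real) ^ k)" by (rule summable_geometric) simp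
  ultimately show ?thesis
    unfolding layer_sum_def
    using tannerys_theorem[where F = sequentially and a = "\<lambda>k n. (1 / 2) ^ k * (layer_count \<psi> n k / half_size n)"]
      tendsto_mult[OF tendsto_const layer_count_limit[OF \<psi>]] by auto
qed

lemma prob_phi_layers_limit:
  assumes \<psi>: "sentence \<psi>"
  shows "prob_seq phi_layers \<psi> \<longlonglongrightarrow> (\<Sum>k. (1 / 2) ^ Suc k * of_bool (layer_limit \<psi> k))"
proof -
  have tru: "layer_limit Tru k" for k by (simp add: layer_limit_def valid_in_def)
  have geo: "(\<lambda>k. (1 / 2 :: real) ^ k) sums 2" using geometric_sums[of "1 / 2 :: real"] by simp
  \<comment> \<open>The normalizing sum; dividing by it turns the weights into the geometric
    distribution.\<close>
  have T: "(\<Sum>k. (1 / 2) ^ k * (of_bool (layer_limit Tru k) / 3)) = (2 / 3 :: real)"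
    using sums_mult2[OF geo, of "1 / 3"] by (simp add: tru sums_iff)
  have sm: "summable (\<lambda>k. (1 / 2) ^ k * of_bool (layer_limit \<psi> k) :: real)"
    by (rule summable_comparison_test[OF _ sums_summable[OF geo]]) auto
  have "(\<lambda>n. layer_sum \<psi> n / layer_sum Tru n) \<longlonglongrightarrow> (\<Sum>k. (1 / 2) ^ k * (of_bool (layer_limit \<psi> k) / 3)) / (2 / 3)"
    using layer_sum_limit[of Tru] unfolding T by (intro tendsto_divide layer_sum_limit[OF \<psi>]) auto
  also have "(\<Sum>k. (1 / 2) ^ k * (of_bool (layer_limit \<psi> k) / 3)) / (2 / 3) = (\<Sum>k. (1 / 2) ^ Suc k * of_bool (layer_limit \<psi> k) :: real)"
    using suminf_mult[OF sm, of "1 / 3"] suminf_mult[OF sm, of "1 / 2"] by (simp add: mult.assoc mult.commute)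
  finally have "(\<lambda>n. layer_sum \<psi> n / layer_sum Tru n) \<longlonglongrightarrow> (\<Sum>k. (1 / 2) ^ Suc k * of_bool (layer_limit \<psi> k))" .
  moreover have "\<forall>\<^sub>F n in sequentially. layer_sum \<psi> n / layer_sum Tru n = prob_seq phi_layers \<psi> n"
    using prob_phi_layers[OF _ \<psi>] by (intro eventually_sequentiallyI[of 10]) simp
  ultimately show ?thesis by (rule Lim_transform_eventually)
qed

lemma conditionable_phi_layers: "conditionable phi_layers"
  unfolding conditionable_def
proof (intro conjI allI impI sentence_phi_layers)
  fix n :: nat
  show "models_on phi_layers n \<noteq> {}"
  proof (cases "n < 10")
    case True then show ?thesis unfolding phi_layers_def by (rule models_on_small)
  next
    case False
    then have n: "10 \<le> n" by simp
    have "(0, 0) \<in> layer_types n" using half_size_eq(2)[OF n] by (simp add: layer_types_iff)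
    moreover from this have "copies n (layer_graph n (0, 0)) (spine_adj False) \<noteq> {}"
      by (intro copies_nonempty simple_rel_spine_adj layer_graph_finite layer_graph_card n)
    ultimately show ?thesis unfolding models_on_phi_layers[OF n] by blast
  qed
qed

section \<open>The limits form a dense subset of the unit interval\<close>

lemma FOC_phi_layers_subset: "FOC (random_graph phi_layers) \<subseteq> const_class ` {0..1}"
proof
  fix y assume "y \<in> FOC (random_graph phi_layers)"
  then obtain \<psi> where \<psi>: "sentence \<psi>" "y = seq_class (prob_seq phi_layers \<psi>)" by (auto simp: FOC_def)
  let ?L = "\<Sum>k. (1 / 2) ^ Suc k * of_bool (layer_limit \<psi> k) :: real"
  note lim = prob_phi_layers_limit[OF \<psi>(1)]
  have "y = const_class ?L" unfolding \<psi>(2) seq_class_eq_const_class_iff[OF bounded_prob_seq] by (rule lim)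
  moreover have "0 \<le> ?L" by (rule LIMSEQ_le_const[OF lim]) auto
  moreover have "?L \<le> 1" by (rule LIMSEQ_le_const2[OF lim]) auto
  ultimately show "y \<in> const_class ` {0..1}" by auto
qed

text \<open>A list stands for a finite set of values of k; its limit probability is the
  corresponding sum of powers of 1/2.\<close>

definition fol_doubles_in :: "nat list \<Rightarrow> fol" where
  "fol_doubles_in ks = foldr (\<lambda>k. Or (fol_num_doubles k)) ks (Neg Tru)"

lemma sentence_doubles_in: "sentence (fol_doubles_in ks)"
  by (induction ks) (auto simp: fol_doubles_in_def sentence_num_doubles)

lemma valid_in_doubles_in: "valid_in D A (fol_doubles_in ks) \<longleftrightarrow> (\<exists>k\<in>set ks. valid_in D A (fol_num_doubles k))"
proof (induction ks)
  case Nil then show ?case by (simp add: fol_doubles_in_def valid_in_def)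
next
  case (Cons k ks)
  have "fol_doubles_in (k # ks) = Or (fol_num_doubles k) (fol_doubles_in ks)" by (simp add: fol_doubles_in_def)
  then show ?case using valid_in_derived(1)[OF sentence_num_doubles sentence_doubles_in, where D = D and A = A] Cons by simp
qed

lemma layer_limit_doubles_in: "layer_limit (fol_doubles_in ks) k \<longleftrightarrow> k \<in> set ks"
proof -
  define Q where "Q = (2::nat) ^ qrank (fol_doubles_in ks)"
  have "1 \<le> Q" "2 \<le> k + Q + Q" using one_le_power[of "2::nat" "qrank (fol_doubles_in ks)"] unfolding Q_def by linarith+
  from layer_num_doubles[OF this] show ?thesis
    unfolding layer_limit_def Q_def[symmetric] valid_in_doubles_in by simp
qed

text \<open>Binary expansion of N, with the lowest digit split off at each step.\<close>

lemma dyadic_subset_sum: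
  "N < 2 ^ m \<Longrightarrow> \<exists>ks. set ks \<subseteq> {..<m} \<and> (\<Sum>k\<in>set ks. (1 / 2 :: real) ^ Suc k) = real N / 2 ^ m"
proof (induction m arbitrary: N)
  case 0 then show ?case by (intro exI[of _ "[]"]) simp
next
  case (Suc m)
  have "N div 2 < 2 ^ m" using Suc.prems by auto
  from Suc.IH[OF this] obtain ks where ks: "set ks \<subseteq> {..<m}"
    "(\<Sum>k\<in>set ks. (1 / 2 :: real) ^ Suc k) = real (N div 2) / 2 ^ m" by blast
  have N: "real N = 2 * real (N div 2) + real (N mod 2)"
    by (metis of_nat_add of_nat_mult of_nat_numeral mult_div_mod_eq)
  show ?case
  proof (cases "N mod 2 = 0")
    case True
    then show ?thesis using ks N by (intro exI[of _ ks]) auto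
  next
    case False
    then have "N mod 2 = 1" by simp
    moreover have "m \<notin> set ks" using ks(1) by auto
    ultimately show ?thesis using ks N
      by (intro exI[of _ "m # ks"]) (auto simp: power_one_over field_simps)
  qed
qed

lemma FOC_phi_layers_dense: "const_class ` {0..1} \<subseteq> closure (FOC (random_graph phi_layers))"
proof clarify
  fix x :: real assume x: "x \<in> {0..1}"
  show "const_class x \<in> closure (FOC (random_graph phi_layers))"
    unfolding closure_approachable
  proof (intro allI impI)
    fix e :: real assume e: "e > 0"
    obtain m where m: "(1 / 2 :: real) ^ m < e" using real_arch_pow_inv[OF e, of "1 / 2"] by auto
    \<comment> \<open>The minimum matters only for x = 1, where the floor would give
      \<open>2 ^ m\<close>, out of reach of a finite sum; the error stays within
      \<open>(1 / 2) ^ m\<close>.\<close>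
    define N where "N = min (nat \<lfloor>x * 2 ^ m\<rfloor>) (2 ^ m - 1)"
    have "N < 2 ^ m" unfolding N_def by (simp add: min_less_iff_disj)
    then obtain ks where ks: "(\<Sum>k\<in>set ks. (1 / 2 :: real) ^ Suc k) = real N / 2 ^ m"
      using dyadic_subset_sum by blast
    have "\<bar>real N - x * 2 ^ m\<bar> \<le> 1"
    proof (cases "x = 1")
      case True
      then have "N = 2 ^ m - 1" by (simp add: N_def nat_power_eq)
      then show ?thesis using True by (simp add: of_nat_diff)
    next
      case False
      then have "x * 2 ^ m < 2 ^ m" "0 \<le> x * 2 ^ m" using x by auto
      then have "nat \<lfloor>x * 2 ^ m\<rfloor> < 2 ^ m"
        by (metis floor_less_iff nat_less_iff of_int_numeral of_int_power of_nat_numeral of_nat_power floor_mono floor_zero zero_le_floor)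
      then have "N = nat \<lfloor>x * 2 ^ m\<rfloor>" unfolding N_def by linarith
      then have "real N = of_int \<lfloor>x * 2 ^ m\<rfloor>" using \<open>0 \<le> x * 2 ^ m\<close> by simp
      then show ?thesis by linarith
    qed
    then have "\<bar>real N / 2 ^ m - x\<bar> \<le> (1 / 2) ^ m"
      by (simp add: abs_le_iff power_one_over field_simps)
    then have close: "\<bar>real N / 2 ^ m - x\<bar> < e" using m by simp
    let ?\<psi> = "fol_doubles_in ks"
    have "(\<Sum>k. (1 / 2) ^ Suc k * of_bool (layer_limit ?\<psi> k) :: real) = (\<Sum>k\<in>set ks. (1 / 2) ^ Suc k * of_bool (layer_limit ?\<psi> k))"
      by (rule suminf_finite) (auto simp: layer_limit_doubles_in)
    also have "\<dots> = real N / 2 ^ m" using ks by (simp add: layer_limit_doubles_in)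
    finally have "seq_class (prob_seq phi_layers ?\<psi>) = const_class (real N / 2 ^ m)"
      unfolding seq_class_eq_const_class_iff[OF bounded_prob_seq]
      using prob_phi_layers_limit[OF sentence_doubles_in, of ks] by simp
    then have "const_class (real N / 2 ^ m) \<in> FOC (random_graph phi_layers)"
      using FOC_memI[OF sentence_doubles_in, of phi_layers ks] by (simp only:)
    moreover have "dist (const_class (real N / 2 ^ m)) (const_class x) < e" using close by (simp add: dist_const_class)
    ultimately show "\<exists>y\<in>FOC (random_graph phi_layers). dist y (const_class x) < e" by blast
  qed
qed

theorem theorem3:
  shows "(\<exists>\<phi>. conditionable \<phi> \<and>
            FOC (random_graph \<phi>) \<subseteq> const_class ` {0..1} \<and>
            const_class ` {0..1} \<subseteq> closure (FOC (random_graph \<phi>))) \<and>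
         (\<forall>d::nat. d \<ge> 1 \<longrightarrow>
            (\<exists>\<phi>. conditionable \<phi> \<and> dim (span (FOC (random_graph \<phi>))) = d)) \<and>
         (\<exists>\<phi>. conditionable \<phi> \<and>
            totally_bounded (FOC (random_graph \<phi>)) \<and>
            \<not> (\<exists>B. finite B \<and> span B = span (FOC (random_graph \<phi>)))) \<and>
         (\<exists>\<phi>. conditionable \<phi> \<and> \<not> totally_bounded (FOC (random_graph \<phi>)))"
proof (intro conjI allI impI)
  show "\<exists>\<phi>. conditionable \<phi> \<and> FOC (random_graph \<phi>) \<subseteq> const_class ` {0..1} \<and>
      const_class ` {0..1} \<subseteq> closure (FOC (random_graph \<phi>))"
    using conditionable_phi_layers FOC_phi_layers_subset FOC_phi_layers_dense by blast
  show "\<exists>\<phi>. conditionable \<phi> \<and> dim (span (FOC (random_graph \<phi>))) = d" if "d \<ge> 1" for d :: nat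
  proof (cases "d = 1")
    case True
    then show ?thesis using conditionable_phi_empty dim_phi_empty by blast
  next
    case False
    \<comment> \<open>A grid with b columns gives dimension b + 2, so this reaches every d from 2
      on.\<close>
    with that have "d - 2 + 2 = d" by simp
    with dim_phi_columns[of "d - 2"] conditionable_phi_columns[of "d - 2"] show ?thesis by metis
  qed
  show "\<exists>\<phi>. conditionable \<phi> \<and> totally_bounded (FOC (random_graph \<phi>)) \<and>
      \<not> (\<exists>B. finite B \<and> span B = span (FOC (random_graph \<phi>)))"
    using conditionable_phi_grids[of 2] totally_bounded_phi_grids infinite_dim_phi_grids by auto
  show "\<exists>\<phi>. conditionable \<phi> \<and> \<not> totally_bounded (FOC (random_graph \<phi>))"
    using conditionable_phi_grids[of 1] not_totally_bounded_phi_grids by auto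
qed

end
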